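(* Let $\Omega\subset\mathbb{R}^{n}$ be non-empty, open and convex. If the set of extreme points of the closure $\overline{\Omega}$ is infinite, then the Nehari theorem fails for $\Omega$ (i.e. it is not the case that the Nehari theorem is true for $\Omega$). In particular, if $\Omega$ is bounded and $\overline{\Omega}$ is not a polytope, then the Nehari theorem fails for $\Omega$.
   Context: Fourier transform: $\widehat{f}(x)=\int_{\mathbb{R}^{n}}f(y)e^{-2\pi i x\cdot y}\,dy$, extended as usual to $L^{2}(\mathbb{R}^{n})$ and to the tempered distributions $S'(\mathbb{R}^{n})$. For $\Omega\subset\mathbb{R}^{n}$ non-empty, open and convex, the Paley-Wiener space $\mathrm{PW}(\Omega)$ is the closed subspace of $L^{2}(\mathbb{R}^{n})$ of functions $f$ whose Fourier transform is supported in $\Omega$, i.e. $\widehat{f}=0$ almost everywhere outside $\Omega$. For $\phi\in S'(\mathbb{R}^{n})$ the Hankel operator $\mathrm{H}_{\phi}$ on $\mathrm{PW}(\Omega)$ is given by $$\widehat{\mathrm{H}_{\phi}f}(x)=\int_{\Omega}\widehat{f}(y)\,\widehat{\phi}(x+y)\,dy,\qquad x\in\Omega,$$ densely defined on those $f$ with $\widehat{f}$ smooth and compactly supported in $\Omega$ (the integral being understood as a distributional pairing); it depends only on the restriction of $\widehat\phi$ to $2\Omega=\{2x:x\in\Omega\}$. One says $\phi$ generates a bounded Hankel operator if $\mathrm{H}_{\phi}$ extends to a bounded operator on $\mathrm{PW}(\Omega)$. The Nehari theorem is true for $\Omega$ if for every $\phi\in S'(\mathbb{R}^{n})$ that generates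 a bounded Hankel operator on $\mathrm{PW}(\Omega)$ there exists $\psi\in L^{\infty}(\mathbb{R}^{n})$ such that $\widehat{\phi}=\widehat{\psi}$ in $2\Omega$ (as distributions on $2\Omega$). A point $x\in\partial K$ of a closed convex set $K$ is an extreme point of $K$ if for all $y,z\in K$, $x\in[y,z]=\{ty+(1-t)z:t\in[0,1]\}$ implies $x=y$ or $x=z$. A polytope is the convex hull of finitely many points. *)

theory Defs
  imports "HOL-Analysis.Analysis"
begin

definition partials :: "'a::euclidean_space list \<Rightarrow> ('a \<Rightarrow> complex) \<Rightarrow> 'a \<Rightarrow> complex" where
  "partials bs f = foldr (\<lambda>b g x. frechet_derivative g (at x) b) bs f"

definition smooth :: "('a::euclidean_space \<Rightarrow> complex) \<Rightarrow> bool" where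
  "smooth f \<longleftrightarrow> (\<forall>bs x. set bs \<subseteq> Basis \<longrightarrow> partials bs f differentiable (at x))"

definition schwartz :: "('a::euclidean_space \<Rightarrow> complex) set" where
  "schwartz = {f. smooth f \<and>
     (\<forall>bs N. set bs \<subseteq> Basis \<longrightarrow> bounded (range (\<lambda>x. (1 + norm x) ^ N *\<^sub>R partials bs f x)))}"

text \<open>The increasing family of seminorms that defines the topology of the Schwartz space; the
  supremum is finite on \<^const>\<open>schwartz\<close>, because there are only finitely many lists \<open>bs\<close>.\<close>

definition schwartz_seminorm :: "nat \<Rightarrow> ('a::euclidean_space \<Rightarrow> complex) \<Rightarrow> real" where
  "schwartz_seminorm N f =
     (SUP (bs, x) \<in> {bs. set bs \<subseteq> Basis \<and> length bs \<le> N} \<times> UNIV.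
        (1 + norm x) ^ N * norm (partials bs f x))"

text \<open>A tempered distribution is a continuous linear functional on \<^const>\<open>schwartz\<close>; its values at
  functions outside \<^const>\<open>schwartz\<close> are irrelevant.\<close>

definition tempered_distribution :: "(('a::euclidean_space \<Rightarrow> complex) \<Rightarrow> complex) \<Rightarrow> bool" where
  "tempered_distribution \<phi> \<longleftrightarrow>
     (\<forall>f\<in>schwartz. \<forall>g\<in>schwartz. \<phi> (\<lambda>x. f x + g x) = \<phi> f + \<phi> g) \<and>
     (\<forall>c. \<forall>f\<in>schwartz. \<phi> (\<lambda>x. c * f x) = c * \<phi> f) \<and>
     (\<exists>C N. \<forall>f\<in>schwartz. norm (\<phi> f) \<le> C * schwartz_seminorm N f)"

definition function_distribution ::
    "('a::euclidean_space \<Rightarrow> complex) \<Rightarrow> ('a \<Rightarrow> complex) \<Rightarrow> complex" where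
  "function_distribution f h = (LINT x|lborel. f x * h x)"

definition fourier :: "('a::euclidean_space \<Rightarrow> complex) \<Rightarrow> 'a \<Rightarrow> complex" where
  "fourier f x = (LINT y|lborel. f y * exp (- 2 * of_real pi * \<i> * of_real (x \<bullet> y)))"

definition fourier_distribution ::
    "(('a::euclidean_space \<Rightarrow> complex) \<Rightarrow> complex) \<Rightarrow> ('a \<Rightarrow> complex) \<Rightarrow> complex" where
  "fourier_distribution \<phi> h = \<phi> (fourier h)"

definition test_functions :: "'a::euclidean_space set \<Rightarrow> ('a \<Rightarrow> complex) set" where
  "test_functions U =
     {f. smooth f \<and> compact (closure {x. f x \<noteq> 0}) \<and> closure {x. f x \<noteq> 0} \<subseteq> U}"

definition distributions_eq_on ::
    "'a::euclidean_space set \<Rightarrow> (('a \<Rightarrow> complex) \<Rightarrow> complex) \<Rightarrow> (('a \<Rightarrow> complex) \<Rightarrow> complex) \<Rightarrow> bool" where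
  "distributions_eq_on U \<phi> \<psi> \<longleftrightarrow> (\<forall>h\<in>test_functions U. \<phi> h = \<psi> h)"

text \<open>Elements of \<open>L\<^sup>2\<close> and \<open>L\<^sup>\<infinity>\<close> are represented by functions; everything below is
  insensitive to modifications on null sets.\<close>

definition L2 :: "('a::euclidean_space \<Rightarrow> complex) set" where
  "L2 = {f \<in> borel_measurable lborel. integrable lborel (\<lambda>x. (norm (f x))\<^sup>2)}"

definition L2_norm :: "('a::euclidean_space \<Rightarrow> complex) \<Rightarrow> real" where
  "L2_norm f = sqrt (LINT x|lborel. (norm (f x))\<^sup>2)"

definition L_infinity :: "('a::euclidean_space \<Rightarrow> complex) set" where
  "L_infinity = {f \<in> borel_measurable lborel. \<exists>C. AE x in lborel. norm (f x) \<le> C}"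

text \<open>\<open>L2_fourier f g\<close>: the Fourier transform of \<open>f \<in> L\<^sup>2\<close>, taken in the tempered distributions,
  is (represented by) \<open>g \<in> L\<^sup>2\<close>.\<close>

definition L2_fourier :: "('a::euclidean_space \<Rightarrow> complex) \<Rightarrow> ('a \<Rightarrow> complex) \<Rightarrow> bool" where
  "L2_fourier f g \<longleftrightarrow> f \<in> L2 \<and> g \<in> L2 \<and>
     (\<forall>h\<in>schwartz. fourier_distribution (function_distribution f) h = function_distribution g h)"

definition paley_wiener :: "'a::euclidean_space set \<Rightarrow> ('a \<Rightarrow> complex) set" where
  "paley_wiener \<Omega> = {f. \<exists>g. L2_fourier f g \<and> (AE x in lborel. x \<notin> \<Omega> \<longrightarrow> g x = 0)}"

definition hankel_domain :: "'a::euclidean_space set \<Rightarrow> ('a \<Rightarrow> complex) set" where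
  "hankel_domain \<Omega> = {f. \<exists>g\<in>test_functions \<Omega>. L2_fourier f g}"

text \<open>\<open>is_hankel_image \<Omega> \<phi> f k\<close> says \<open>k = H\<^sub>\<phi> f\<close>. With \<open>g\<close> the Fourier transform of \<open>f\<close>, the
  integral of \<open>g(y) F\<phi>(x + y)\<close> over \<open>y \<in> \<Omega>\<close> (\<open>F\<close> the Fourier transform) is, after the change of variables \<open>z = x + y\<close>, the
  pairing of the Fourier transform of \<open>\<phi>\<close> with the test function \<open>z \<mapsto> g(z - x)\<close>. For \<open>x \<in> \<Omega>\<close>
  the latter is supported in \<open>x + \<Omega> \<subseteq> 2\<Omega>\<close>.\<close>

definition is_hankel_image ::
    "'a::euclidean_space set \<Rightarrow> (('a \<Rightarrow> complex) \<Rightarrow> complex) \<Rightarrow> ('a \<Rightarrow> complex) \<Rightarrow> ('a \<Rightarrow> complex) \<Rightarrow> bool" where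
  "is_hankel_image \<Omega> \<phi> f k \<longleftrightarrow> k \<in> paley_wiener \<Omega> \<and>
     (\<exists>g\<in>test_functions \<Omega>. \<exists>k'. L2_fourier f g \<and> L2_fourier k k' \<and>
        (AE x in lborel. x \<in> \<Omega> \<longrightarrow> k' x = fourier_distribution \<phi> (\<lambda>z. g (z - x))))"

definition bounded_operator_on_paley_wiener ::
    "'a::euclidean_space set \<Rightarrow> (('a \<Rightarrow> complex) \<Rightarrow> 'a \<Rightarrow> complex) \<Rightarrow> bool" where
  "bounded_operator_on_paley_wiener \<Omega> T \<longleftrightarrow>
     (\<forall>f\<in>paley_wiener \<Omega>. T f \<in> paley_wiener \<Omega>) \<and>
     (\<forall>f\<in>paley_wiener \<Omega>. \<forall>g\<in>paley_wiener \<Omega>.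
        AE x in lborel. T (\<lambda>y. f y + g y) x = T f x + T g x) \<and>
     (\<forall>c. \<forall>f\<in>paley_wiener \<Omega>. AE x in lborel. T (\<lambda>y. c * f y) x = c * T f x) \<and>
     (\<exists>C. \<forall>f\<in>paley_wiener \<Omega>. L2_norm (T f) \<le> C * L2_norm f)"

definition generates_bounded_hankel ::
    "'a::euclidean_space set \<Rightarrow> (('a \<Rightarrow> complex) \<Rightarrow> complex) \<Rightarrow> bool" where
  "generates_bounded_hankel \<Omega> \<phi> \<longleftrightarrow>
     (\<exists>T. bounded_operator_on_paley_wiener \<Omega> T \<and>
          (\<forall>f\<in>hankel_domain \<Omega>. is_hankel_image \<Omega> \<phi> f (T f)))"

definition nehari_theorem_true :: "'a::euclidean_space set \<Rightarrow> bool" where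
  "nehari_theorem_true \<Omega> \<longleftrightarrow>
     (\<forall>\<phi>. tempered_distribution \<phi> \<and> generates_bounded_hankel \<Omega> \<phi> \<longrightarrow>
        (\<exists>\<psi>\<in>L_infinity. distributions_eq_on ((*\<^sub>R) 2 ` \<Omega>)
            (fourier_distribution \<phi>) (fourier_distribution (function_distribution \<psi>))))"

end

theory Submission
  imports Defs "HOL-Probability.Characteristic_Functions" "HOL-Probability.Sinc_Integral"
begin

text \<open>Choose infinitely many extreme points \<open>x n\<close> of the closure of \<open>\<Omega>\<close> with pairwise disjoint balls around
  them. If \<open>p\<close> is close enough to \<open>x n\<close>, then \<open>y + z = 2 p\<close> with \<open>y, z \<in> \<Omega>\<close> forces both \<open>y\<close> and \<open>z\<close> into the ball
  around \<open>x n\<close>. Hence the Hankel operator whose symbol has as Fourier transform a sum of unit masses with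
  coefficients \<open>\<plusminus>1\<close> at such points \<open>2 p n\<close> is an orthogonal sum of reflections, bounded regardless of the number
  of points and of the signs. A second mass of opposite sign very close to each point makes the
  infinite sum a tempered distribution. On the other hand, test it against a sum of \<open>N\<close> small bumps
  at the points \<open>2 p n\<close> with the same signs: the value is \<open>N\<close> times a constant, while for suitable signs the
  Fourier transform of the test function has \<open>L\<^sup>1\<close> norm of order \<open>sqrt N\<close> only, by orthogonality on average.
  No bounded \<open>\<psi>\<close> can have this property for all \<open>N\<close>.\<close>

section \<open>Fourier transform of Gaussians\<close>

text \<open>A single symbol has to defeat every constant at once. The signs are therefore assembled
  from disjoint index blocks of size 4^k: block \<open>k\<close> gets signs adapted to its own
  bumps, and the test function of that block sees none of the other masses. Boundedness is
  insensitive to this choice, since only \<open>\<bar>c n\<bar> \<le> 1\<close> enters. The points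
  \<open>p n\<close> lie inside \<Omega>, so that a small bump around \<open>2 p n\<close> is a test
  function on the doubled domain. How small it is does not matter: dilating a bump leaves the L1
  norm of its transform unchanged. The analytic obstacle is that \<open>L2_fourier\<close> is a weak
  relation: a function in the Paley-Wiener space carries no formula for its transform. Uniqueness of
  the transform and \<open>L2_norm g \<le> L2_norm f\<close> have to be extracted from testing
  against Schwartz functions, which is what the mollifiers are for. Only norm inequalities are used,
  never the isometry. Gaussian factors act as a summability method: they make Fubini and Fourier
  inversion available for \<open>fourier h\<close> whatever its decay.\<close>

definition unit_char :: "real \<Rightarrow> complex" where
  "unit_char x = cis (2 * pi * x)"

lemma unit_char_add: "unit_char (x + y) = unit_char x * unit_char y"
  by (simp add: unit_char_def cis_mult ring_distribs)

lemma unit_char_diff: "unit_char (x - y) = unit_char x * unit_char (- y)"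
  using unit_char_add[of x "- y"] by simp

lemma unit_char_0 [simp]: "unit_char 0 = 1"
  by (simp add: unit_char_def)

lemma norm_unit_char [simp]: "norm (unit_char x) = 1"
  by (simp add: unit_char_def)

lemma cnj_unit_char [simp]: "cnj (unit_char x) = unit_char (- x)"
  by (simp add: unit_char_def cis_cnj)

lemma unit_char_sum: "finite A \<Longrightarrow> unit_char (\<Sum>a\<in>A. f a) = (\<Prod>a\<in>A. unit_char (f a))"
  by (induction A rule: finite_induct) (simp_all add: unit_char_add)

lemma continuous_on_unit_char [continuous_intros]:
  "continuous_on S f \<Longrightarrow> continuous_on S (\<lambda>x. unit_char (f x))"
  unfolding unit_char_def cis_conv_exp by (intro continuous_intros)

lemma borel_measurable_unit_char [measurable]: "unit_char \<in> borel_measurable borel"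
  by (intro borel_measurable_continuous_onI continuous_intros)

lemma norm_unit_char_diff_le: "norm (unit_char x - unit_char y) \<le> 2 * pi * \<bar>x - y\<bar>"
proof -
  have "norm (unit_char x - unit_char y) = norm (unit_char (x - y) - 1) * norm (unit_char y)"
    by (metis (no_types, lifting) diff_add_cancel left_diff_distrib mult_1 norm_mult unit_char_add)
  also have "unit_char (x - y) - 1 = iexp (2 * pi * (x - y)) - (\<Sum>k \<le> 0. (\<i> * complex_of_real (2 * pi * (x - y)))^k / (fact k))"
    by (simp add: unit_char_def cis_conv_exp)
  also have "norm \<dots> \<le> \<bar>2 * pi * (x - y)\<bar> ^ Suc 0 / fact (Suc 0)"
    by (rule iexp_approx1)
  finally show ?thesis
    by (simp add: abs_mult)
qed

lemma fourier_unit_char: "fourier f x = (LINT y|lborel. f y * unit_char (- (x \<bullet> y)))"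
proof -
  have "unit_char (- r) = exp (- 2 * of_real pi * \<i> * of_real r)" for r
    by (simp add: unit_char_def cis_conv_exp mult_ac)
  then show ?thesis
    by (simp add: fourier_def)
qed

section \<open>Tensor products and affine changes of variables\<close>

lemma
  fixes f :: "'a::euclidean_space \<Rightarrow> real \<Rightarrow> complex"
  assumes "\<And>b. b \<in> Basis \<Longrightarrow> integrable lborel (f b)"
  shows integrable_lborel_prod: "integrable lborel (\<lambda>x::'a. \<Prod>b\<in>Basis. f b (x \<bullet> b))"
    and integral_lborel_prod:
      "(LINT x|lborel. (\<Prod>b\<in>Basis. f b (x \<bullet> b))) = (\<Prod>b\<in>(Basis::'a set). LINT t|lborel. f b t)"
proof -
  interpret product_sigma_finite "\<lambda>_::'a. lborel :: real measure" ..
  let ?T = "\<lambda>f::'a \<Rightarrow> real. \<Sum>b\<in>Basis. f b *\<^sub>R b"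
  have [measurable]: "f b \<in> borel_measurable borel" if "b \<in> Basis" for b
    using borel_measurable_integrable[OF assms[OF that]] by simp
  have T: "?T \<in> measurable (\<Pi>\<^sub>M b\<in>Basis. lborel) borel"
    by measurable
  have m: "(\<lambda>x::'a. \<Prod>b\<in>Basis. f b (x \<bullet> b)) \<in> borel_measurable borel"
    by measurable
  have *: "(\<Prod>b\<in>Basis. f b (?T x \<bullet> b)) = (\<Prod>b\<in>Basis. f b (x b))" for x
    by (intro prod.cong refl) simp
  show "integrable lborel (\<lambda>x::'a. \<Prod>b\<in>Basis. f b (x \<bullet> b))"
    by (subst lborel_eq, subst integrable_distr_eq[OF T m], unfold *)
      (use assms in \<open>auto intro!: product_integrable_prod\<close>)
  show "(LINT x|lborel. (\<Prod>b\<in>Basis. f b (x \<bullet> b))) = (\<Prod>b\<in>(Basis::'a set). LINT t|lborel. f b t)"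
    by (subst lborel_eq, subst integral_distr[OF T m], unfold *)
      (use assms in \<open>auto intro!: product_integral_prod\<close>)
qed

lemma nn_integral_lborel_affine:
  fixes f :: "'a::euclidean_space \<Rightarrow> ennreal"
  assumes [measurable]: "f \<in> borel_measurable borel" and c: "c \<noteq> 0"
  shows "(\<integral>\<^sup>+x. f x \<partial>lborel) = ennreal (\<bar>c\<bar> ^ DIM('a)) * (\<integral>\<^sup>+x. f (t + c *\<^sub>R x) \<partial>lborel)"
  by (subst lborel_affine[OF c, of t])
    (simp add: nn_integral_density nn_integral_distr nn_integral_cmult)

lemma
  fixes f :: "'a::euclidean_space \<Rightarrow> 'b::{banach, second_countable_topology}"
  assumes c: "c \<noteq> 0"
  shows integrable_lborel_affine: "integrable lborel f \<Longrightarrow> integrable lborel (\<lambda>x. f (t + c *\<^sub>R x))"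
    and integral_lborel_affine:
      "integrable lborel f \<Longrightarrow> (LINT x|lborel. f x) = \<bar>c\<bar> ^ DIM('a) *\<^sub>R (LINT x|lborel. f (t + c *\<^sub>R x))"
proof -
  assume i: "integrable lborel f"
  then have [measurable]: "f \<in> borel_measurable borel"
    by auto
  show *: "integrable lborel (\<lambda>x. f (t + c *\<^sub>R x))"
    using i c nn_integral_lborel_affine[OF _ c, of "\<lambda>x. norm (f x)" t] unfolding integrable_iff_bounded
    by (auto simp: ennreal_mult_less_top)
  show "(LINT x|lborel. f x) = \<bar>c\<bar> ^ DIM('a) *\<^sub>R (LINT x|lborel. f (t + c *\<^sub>R x))"
    by (subst lborel_affine[OF c, of t])
      (simp add: integral_density integral_distr *)
qed

text \<open>As \<open>s\<close> grows, \<open>gauss s\<close> increases to 1, while its transform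
  \<open>gauss_hat s\<close> keeps mass 1 and concentrates at the origin. Removing the cut-off on
  one side thus produces an approximate identity on the other.\<close>

definition gauss :: "real \<Rightarrow> 'a::euclidean_space \<Rightarrow> real" where
  "gauss s x = exp (- pi * (norm x)\<^sup>2 / s\<^sup>2)"

definition gauss_hat :: "real \<Rightarrow> 'a::euclidean_space \<Rightarrow> real" where
  "gauss_hat s x = s ^ DIM('a) * exp (- pi * s\<^sup>2 * (norm x)\<^sup>2)"

lemma integral_gauss_real:
  assumes s: "s > 0"
  shows "integrable lborel (\<lambda>t::real. complex_of_real (exp (- pi * t\<^sup>2 / s\<^sup>2)) * unit_char (- (p * t)))" (is "integrable _ ?f")
    and "(LINT t|lborel. complex_of_real (exp (- pi * t\<^sup>2 / s\<^sup>2)) * unit_char (- (p * t)))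
           = complex_of_real (s * exp (- pi * s\<^sup>2 * p\<^sup>2))"
proof -
  \<comment> \<open>The substitution \<open>t = c * x\<close> turns the Gaussian into exp(-x^2/2),
    so that the characteristic function of the standard normal law gives the transform.\<close>
  define c where "c = s / sqrt (2 * pi)"
  have c: "c > 0" using s by (simp add: c_def)
  have f: "?f (c * x) = sqrt (2 * pi) * (std_normal_density x * iexp ((- 2 * pi * p * c) * x))" for x
    using s by (simp add: std_normal_density_def unit_char_def c_def cis_conv_exp
        power_mult_distrib power_divide field_simps flip: exp_of_real)
  have i: "integrable lborel (\<lambda>x. complex_of_real (std_normal_density x) * iexp (t * x))" for t
    by (rule Bochner_Integration.integrable_bound[OF integrable_normal_density[of 1 0, OF zero_less_one]])
      (auto simp: norm_mult)
  have "integrable lborel (\<lambda>x. ?f (0 + c *\<^sub>R x))"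
    using i[of "- 2 * pi * p * c"] unfolding real_scaleR_def add_0 f
    by (intro integrable_mult_right)
  from integrable_lborel_affine[OF _ this, of "1 / c" 0] c show i2: "integrable lborel ?f"
    by simp
  have char: "(LINT x|lborel. std_normal_density x * iexp (t * x)) = complex_of_real (exp (- (t\<^sup>2) / 2))" for t
    using fun_cong[OF char_std_normal_distribution, of t]
    unfolding char_def by (subst (asm) integral_density) (auto simp: scaleR_conv_of_real)
  have "(LINT t|lborel. ?f t) = c *\<^sub>R (LINT x|lborel. ?f (c * x))"
    using integral_lborel_affine[OF _ i2, of c 0] c by simp
  also have "\<dots> = complex_of_real (c * sqrt (2 * pi)) *
      (LINT x|lborel. std_normal_density x * iexp ((- 2 * pi * p * c) * x))"
    unfolding f by (simp add: scaleR_conv_of_real del: of_real_mult) simp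
  also have "\<dots> = complex_of_real (c * sqrt (2 * pi)) * complex_of_real (exp (- ((- 2 * pi * p * c)\<^sup>2) / 2))"
    by (subst char) simp
  also have "\<dots> = complex_of_real (s * exp (- pi * s\<^sup>2 * p\<^sup>2))"
    using s by (simp add: c_def power_mult_distrib power_divide power2_eq_square field_simps flip: exp_of_real)
  finally show "(LINT t|lborel. ?f t) = complex_of_real (s * exp (- pi * s\<^sup>2 * p\<^sup>2))" .
qed

lemma norm_sq_Basis: "(norm x)\<^sup>2 = (\<Sum>b\<in>Basis. (x \<bullet> b)\<^sup>2)"
  for x :: "'a::euclidean_space"
  unfolding power2_norm_eq_inner by (subst euclidean_inner) (simp add: power2_eq_square)

text \<open>Both exponents are sums over coordinates, which reduces the transform in several
  dimensions to the one-dimensional one.\<close>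

lemma gauss_unit_char_prod:
  "complex_of_real (gauss s x) * unit_char (- (p \<bullet> x)) =
     (\<Prod>b\<in>(Basis::'a::euclidean_space set). complex_of_real (exp (- pi * (x \<bullet> b)\<^sup>2 / s\<^sup>2)) * unit_char (- ((p \<bullet> b) * (x \<bullet> b))))"
  unfolding gauss_def norm_sq_Basis prod.distrib
  by (subst (1) euclidean_inner)
    (simp add: exp_sum sum_distrib_left sum_divide_distrib flip: unit_char_sum sum_negf)

lemma
  fixes p :: "'a::euclidean_space"
  assumes s: "s > 0"
  shows fourier_gauss: "fourier (\<lambda>t. complex_of_real (gauss s t)) p = complex_of_real (gauss_hat s p)"
    and integrable_gauss: "integrable lborel (\<lambda>t::'a. gauss s t)"
proof -
  have "(LINT y|lborel. complex_of_real (gauss s y) * unit_char (- (p \<bullet> y))) =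
     (\<Prod>b\<in>(Basis::'a::euclidean_space set). complex_of_real (s * exp (- pi * s\<^sup>2 * (p \<bullet> b)\<^sup>2)))"
    unfolding gauss_unit_char_prod
    by (subst integral_lborel_prod) (use integral_gauss_real[OF s] in auto)
  also have "\<dots> = complex_of_real (gauss_hat s p)"
    unfolding gauss_hat_def norm_sq_Basis of_real_prod[symmetric] prod.distrib
    by (simp add: exp_sum sum_distrib_left)
  finally show "fourier (\<lambda>t. complex_of_real (gauss s t)) p = complex_of_real (gauss_hat s p)"
    unfolding fourier_unit_char .
  have "integrable lborel (\<lambda>x::'a. complex_of_real (gauss s x) * unit_char (- (0 \<bullet> x)))"
    unfolding gauss_unit_char_prod
    by (rule integrable_lborel_prod) (use integral_gauss_real(1)[OF s] in blast)
  then have "integrable lborel (\<lambda>x::'a. complex_of_real (gauss s x))"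
    by simp
  from integrable_Re[OF this] show "integrable lborel (\<lambda>t::'a. gauss s t)"
    by simp
qed

lemma gauss_nonneg [simp]: "0 \<le> gauss s x"
  and gauss_le_1 [simp]: "gauss s x \<le> 1"
  by (auto simp: gauss_def)

lemma gauss_hat_nonneg [simp]: "0 \<le> s \<Longrightarrow> 0 \<le> gauss_hat s x"
  by (simp add: gauss_hat_def)

lemma borel_measurable_gauss [measurable]:
  "gauss s \<in> borel_measurable borel" "gauss_hat s \<in> borel_measurable borel"
  unfolding gauss_def gauss_hat_def by measurable

lemma gauss_hat_minus_commute: "gauss_hat s (x - y) = gauss_hat s (y - x)"
  by (simp add: gauss_hat_def norm_minus_commute)

lemma gauss_hat_scale:
  fixes x :: "'a::euclidean_space"
  shows "gauss_hat s x = s ^ DIM('a) * gauss_hat 1 (s *\<^sub>R x)"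
  by (simp add: gauss_hat_def power_mult_distrib algebra_simps)

lemma gauss_hat_bound:
  fixes x :: "'a::euclidean_space"
  shows "0 \<le> s \<Longrightarrow> gauss_hat s x \<le> s ^ DIM('a)"
  by (simp add: gauss_hat_def mult_left_le)

lemma
  fixes s :: real
  assumes s: "s > 0"
  shows integrable_gauss_hat: "integrable lborel (\<lambda>x::'a::euclidean_space. gauss_hat s x)"
    and integral_gauss_hat: "(LINT x::'a|lborel. gauss_hat s x) = 1"
proof -
  have eq: "gauss_hat s = (\<lambda>x::'a. s ^ DIM('a) * gauss (1 / s) x)"
    using s by (simp add: gauss_hat_def gauss_def power_divide field_simps fun_eq_iff)
  show "integrable lborel (\<lambda>x::'a. gauss_hat s x)"
    unfolding eq by (intro integrable_mult_right integrable_gauss) (use s in auto)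
  have "complex_of_real (LINT x::'a|lborel. gauss (1 / s) x) = complex_of_real (1 / s ^ DIM('a))"
    using fourier_gauss[of "1 / s" "0::'a"] s
    by (simp add: fourier_unit_char gauss_hat_def power_divide)
  then have "(LINT x::'a|lborel. gauss (1 / s) x) = 1 / s ^ DIM('a)"
    by (simp only: of_real_eq_iff)
  then show "(LINT x::'a|lborel. gauss_hat s x) = 1"
    unfolding eq using s by simp
qed

lemma gauss_tendsto: "(\<lambda>n. gauss (real (Suc n)) x) \<longlonglongrightarrow> 1"
proof -
  have "(\<lambda>n. exp (- (pi * (norm x)\<^sup>2) * (inverse (real (Suc n)))\<^sup>2)) \<longlonglongrightarrow> exp (- (pi * (norm x)\<^sup>2) * 0\<^sup>2)"
    by (intro tendsto_intros LIMSEQ_inverse_real_of_nat)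
  then show ?thesis
    by (simp add: gauss_def power_divide divide_inverse power_inverse)
qed

text \<open>The product majorant \<open>a x * b y\<close> gives joint integrability on the product
  space, which is what Fubini's theorem asks for.\<close>

lemma
  fixes f :: "'a::euclidean_space \<Rightarrow> 'b::euclidean_space \<Rightarrow> complex"
  assumes m: "(\<lambda>(x, y). f x y) \<in> borel_measurable (lborel \<Otimes>\<^sub>M lborel)"
    and a: "integrable lborel a" and b: "integrable lborel b"
    and le: "\<And>x y. norm (f x y) \<le> a x * b y"
  shows Fubini_lborel_bound: "(LINT x|lborel. LINT y|lborel. f x y) = (LINT y|lborel. LINT x|lborel. f x y)"
    and integrable_lborel_bound: "integrable lborel (\<lambda>x. LINT y|lborel. f x y)"
proof -
  have "integrable (lborel \<Otimes>\<^sub>M lborel) (\<lambda>(x, y). a x * b y)"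
  proof (rule lborel_pair.Fubini_integrable)
    show "(\<lambda>(x, y). a x * b y) \<in> borel_measurable (lborel \<Otimes>\<^sub>M lborel)"
      using a b by measurable
    show "integrable lborel (\<lambda>x. LINT y|lborel. norm (case (x, y) of (x, y) \<Rightarrow> a x * b y))"
      using a by (simp add: abs_mult)
    show "AE x in lborel. integrable lborel (\<lambda>y. case (x, y) of (x, y) \<Rightarrow> a x * b y)"
      using b by simp
  qed
  then have i: "integrable (lborel \<Otimes>\<^sub>M lborel) (\<lambda>(x, y). f x y)"
    by (rule Bochner_Integration.integrable_bound[OF _ m])
      (auto intro!: AE_I2 order.trans[OF le] simp del: abs_mult)
  show "(LINT x|lborel. LINT y|lborel. f x y) = (LINT y|lborel. LINT x|lborel. f x y)"
    by (rule lborel_pair.Fubini_integral[OF i, symmetric])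
  show "integrable lborel (\<lambda>x. LINT y|lborel. f x y)"
    by (rule lborel_pair.integrable_fst[OF i])
qed

section \<open>Parseval formula with a Gaussian factor and the Plancherel inequality for integrable
  functions\<close>

definition inv_fourier :: "('a::euclidean_space \<Rightarrow> complex) \<Rightarrow> 'a \<Rightarrow> complex" where
  "inv_fourier v t = (LINT p|lborel. v p * unit_char (p \<bullet> t))"

lemma inv_fourier_conv_fourier: "inv_fourier v t = fourier v (- t)"
  by (simp add: inv_fourier_def fourier_unit_char inner_commute)

lemma borel_measurable_fourier [measurable]:
  assumes [measurable]: "u \<in> borel_measurable borel"
  shows "fourier u \<in> borel_measurable borel"
  unfolding fourier_unit_char[abs_def] by (rule lborel.borel_measurable_lebesgue_integral) measurable

lemma borel_measurable_inv_fourier [measurable]: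
  assumes [measurable]: "u \<in> borel_measurable borel"
  shows "inv_fourier u \<in> borel_measurable borel"
  unfolding inv_fourier_def[abs_def] by (rule lborel.borel_measurable_lebesgue_integral) measurable

lemma norm_fourier_le: "norm (fourier u t) \<le> (LINT y|lborel. norm (u y))"
proof -
  have "norm (fourier u t) \<le> (LINT y|lborel. norm (u y * unit_char (- (t \<bullet> y))))"
    unfolding fourier_unit_char by (rule integral_norm_bound)
  then show ?thesis by (simp add: norm_mult)
qed

text \<open>Without the Gaussian the integral over \<open>t\<close> may diverge, since
  \<open>fourier u\<close> is merely bounded. With it Fubini applies, and the inner integral is the
  transform of the Gaussian at \<open>y - p\<close>.\<close>

lemma fourier_gauss_mult:
  fixes u :: "'a::euclidean_space \<Rightarrow> complex"
  assumes u: "integrable lborel u" and s: "s > 0"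
  shows "(LINT t|lborel. fourier u t * unit_char (p \<bullet> t) * complex_of_real (gauss s t)) =
         (LINT y|lborel. u y * complex_of_real (gauss_hat s (y - p)))"
proof -
  have [measurable]: "u \<in> borel_measurable borel"
    using u by auto
  have "(LINT t|lborel. fourier u t * unit_char (p \<bullet> t) * complex_of_real (gauss s t)) =
      (LINT t|lborel. LINT y|lborel. u y * (complex_of_real (gauss s t) * unit_char (- ((y - p) \<bullet> t))))"
  proof (intro Bochner_Integration.integral_cong refl)
    fix t :: 'a
    have "fourier u t * unit_char (p \<bullet> t) * complex_of_real (gauss s t) =
        (LINT y|lborel. u y * unit_char (- (t \<bullet> y)) * (unit_char (p \<bullet> t) * complex_of_real (gauss s t)))"
      unfolding fourier_unit_char by simp
    also have "\<dots> = (LINT y|lborel. u y * (complex_of_real (gauss s t) * unit_char (- ((y - p) \<bullet> t))))"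
      by (intro Bochner_Integration.integral_cong refl)
        (simp add: inner_diff_left inner_commute[of t] unit_char_diff[of "p \<bullet> t"] mult_ac)
    finally show "fourier u t * unit_char (p \<bullet> t) * complex_of_real (gauss s t) = \<dots>" .
  qed
  also have "\<dots> = (LINT y|lborel. LINT t|lborel. u y * (complex_of_real (gauss s t) * unit_char (- ((y - p) \<bullet> t))))"
    by (rule Fubini_lborel_bound[of _ "gauss s" "\<lambda>y. norm (u y)"])
      (use u s in \<open>auto simp: norm_mult integrable_gauss mult_ac\<close>)
  also have "\<dots> = (LINT y|lborel. u y * complex_of_real (gauss_hat s (y - p)))"
    unfolding fourier_gauss[OF s, symmetric] fourier_unit_char by simp
  finally show ?thesis .
qed

text \<open>Integrating the preceding identity against \<open>v\<close> gives a Parseval formula in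
  which both sides converge for arbitrary integrable \<open>u\<close> and \<open>v\<close>.\<close>

lemma fourier_inv_fourier_gauss:
  fixes u v :: "'a::euclidean_space \<Rightarrow> complex"
  assumes u: "integrable lborel u" and v: "integrable lborel v" and s: "s > 0"
  shows "(LINT t|lborel. fourier u t * inv_fourier v t * complex_of_real (gauss s t)) =
         (LINT p|lborel. v p * (LINT y|lborel. u y * complex_of_real (gauss_hat s (y - p))))"
    (is "?A = ?B")
    and "integrable lborel (\<lambda>p. v p * (LINT y|lborel. u y * complex_of_real (gauss_hat s (y - p))))"
proof -
  have [measurable]: "u \<in> borel_measurable borel" "v \<in> borel_measurable borel"
    using u v by auto
  let ?F = "\<lambda>p t. v p * (fourier u t * unit_char (p \<bullet> t) * complex_of_real (gauss s t))"
  let ?C = "LINT y|lborel. norm (u y)"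
  have le: "norm (?F p t) \<le> norm (v p) * (?C * gauss s t)" for t p
    by (auto simp: norm_mult intro!: mult_left_mono mult_right_mono norm_fourier_le)
  have m: "(\<lambda>(p, t). ?F p t) \<in> borel_measurable (lborel \<Otimes>\<^sub>M lborel)"
    by measurable
  have i: "integrable lborel (\<lambda>t::'a. ?C * gauss s t)"
    by (intro integrable_mult_right integrable_gauss s)
  have "?A = (LINT t|lborel. LINT p|lborel. ?F p t)"
    unfolding inv_fourier_def by (simp add: mult_ac flip: integral_mult_right_zero integral_mult_left_zero)
  also have "\<dots> = (LINT p|lborel. LINT t|lborel. ?F p t)"
    by (rule Fubini_lborel_bound[OF m _ i le, symmetric]) (use v in auto)
  also have "\<dots> = ?B"
    by (simp add: fourier_gauss_mult[OF u s])
  finally show "?A = ?B" .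
  show "integrable lborel (\<lambda>p. v p * (LINT y|lborel. u y * complex_of_real (gauss_hat s (y - p))))"
    using integrable_lborel_bound[OF m _ i le] v by (simp add: fourier_gauss_mult[OF u s])
qed

lemma nn_integral_gauss_hat:
  assumes "s > 0"
  shows "(\<integral>\<^sup>+y. ennreal (gauss_hat s (y - p)) \<partial>lborel) = 1"
    and "(\<integral>\<^sup>+p. ennreal (gauss_hat s (y - p)) \<partial>lborel) = 1"
proof -
  have *: "(\<integral>\<^sup>+y. ennreal (gauss_hat s y) \<partial>lborel) = 1"
    using integral_gauss_hat[OF assms] integrable_gauss_hat[OF assms] assms
    by (subst nn_integral_eq_integral) auto
  show 1: "(\<integral>\<^sup>+y. ennreal (gauss_hat s (y - p)) \<partial>lborel) = 1" for p
    using nn_integral_lborel_affine[of "\<lambda>y. ennreal (gauss_hat s (y - p))" 1 p] * by simp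
  show "(\<integral>\<^sup>+p. ennreal (gauss_hat s (y - p)) \<partial>lborel) = 1"
    using 1[of y] by (simp add: gauss_hat_minus_commute)
qed

text \<open>This is a Schur test: \<open>2 * a * b \<le> a\<^sup>2 + b\<^sup>2\<close> takes the
  place of the Cauchy-Schwarz inequality, and the kernel has mass 1 in either variable. Values in
  \<open>ennreal\<close> allow the right-hand side to be infinite.\<close>

lemma gauss_hat_bilinear_bound:
  fixes u v :: "'a::euclidean_space \<Rightarrow> complex"
  assumes u: "integrable lborel u" and v: "integrable lborel v" and s: "s > 0"
  shows "2 * ennreal (norm (LINT p|lborel. v p * (LINT y|lborel. u y * complex_of_real (gauss_hat s (y - p)))))
    \<le> (\<integral>\<^sup>+y. (norm (u y))\<^sup>2 \<partial>lborel) + (\<integral>\<^sup>+y. (norm (v y))\<^sup>2 \<partial>lborel)"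
proof -
  have [measurable]: "u \<in> borel_measurable borel" "v \<in> borel_measurable borel"
    using u v by auto
  let ?g = "\<lambda>y p. ennreal (gauss_hat s (y - p))"
  have [simp]: "0 \<le> gauss_hat s y" for y :: 'a
    using s by simp
  have i: "integrable lborel (\<lambda>y. u y * complex_of_real (gauss_hat s (y - p)))" for p
    by (rule Bochner_Integration.integrable_bound[OF integrable_mult_right[OF u, of "complex_of_real (s ^ DIM('a))"]])
      (use s in \<open>auto simp: norm_mult norm_power mult_ac intro!: mult_left_mono gauss_hat_bound\<close>)
  have "ennreal (norm (LINT p|lborel. v p * (LINT y|lborel. u y * complex_of_real (gauss_hat s (y - p)))))
      \<le> (\<integral>\<^sup>+p. norm (v p * (LINT y|lborel. u y * complex_of_real (gauss_hat s (y - p)))) \<partial>lborel)"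
    by (rule integral_norm_bound_ennreal[OF fourier_inv_fourier_gauss(2)[OF u v s]])
  also have "\<dots> \<le> (\<integral>\<^sup>+p. norm (v p) * (\<integral>\<^sup>+y. norm (u y * complex_of_real (gauss_hat s (y - p))) \<partial>lborel) \<partial>lborel)"
    by (intro nn_integral_mono, subst norm_mult, subst ennreal_mult)
      (auto intro!: mult_left_mono integral_norm_bound_ennreal[OF i])
  finally have "2 * ennreal (norm (LINT p|lborel. v p * (LINT y|lborel. u y * complex_of_real (gauss_hat s (y - p)))))
     \<le> 2 * (\<integral>\<^sup>+p. norm (v p) * (\<integral>\<^sup>+y. norm (u y * complex_of_real (gauss_hat s (y - p))) \<partial>lborel) \<partial>lborel)"
    by (rule mult_left_mono) simp
  also have "\<dots> = (\<integral>\<^sup>+p. \<integral>\<^sup>+y. ennreal (2 * norm (u y) * norm (v p)) * ?g y p \<partial>lborel \<partial>lborel)"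
    by (simp add: nn_integral_cmult[symmetric] norm_mult ennreal_mult mult_ac)
  also have "\<dots> \<le> (\<integral>\<^sup>+p. \<integral>\<^sup>+y. ennreal ((norm (u y))\<^sup>2 + (norm (v p))\<^sup>2) * ?g y p \<partial>lborel \<partial>lborel)"
    by (intro nn_integral_mono mult_right_mono ennreal_leI sum_squares_bound) auto
  also have "\<dots> = (\<integral>\<^sup>+p. \<integral>\<^sup>+y. (norm (u y))\<^sup>2 * ?g y p \<partial>lborel \<partial>lborel) + (\<integral>\<^sup>+p. \<integral>\<^sup>+y. (norm (v p))\<^sup>2 * ?g y p \<partial>lborel \<partial>lborel)"
    by (simp add: distrib_right nn_integral_add)
  also have "(\<integral>\<^sup>+p. \<integral>\<^sup>+y. (norm (u y))\<^sup>2 * ?g y p \<partial>lborel \<partial>lborel) = (\<integral>\<^sup>+y. \<integral>\<^sup>+p. (norm (u y))\<^sup>2 * ?g y p \<partial>lborel \<partial>lborel)"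
    by (rule lborel_pair.Fubini') measurable
  also have "\<dots> = (\<integral>\<^sup>+y. (norm (u y))\<^sup>2 \<partial>lborel)"
    by (simp add: nn_integral_cmult nn_integral_gauss_hat[OF s])
  also have "(\<integral>\<^sup>+p. \<integral>\<^sup>+y. (norm (v p))\<^sup>2 * ?g y p \<partial>lborel \<partial>lborel) = (\<integral>\<^sup>+y. (norm (v y))\<^sup>2 \<partial>lborel)"
    by (simp add: nn_integral_cmult nn_integral_gauss_hat[OF s])
  finally show ?thesis .
qed

text \<open>With \<open>v\<close> the conjugate of \<open>u\<close>, the left side of the Parseval
  formula is the integral of the squared modulus of \<open>fourier u\<close> times the Gaussian.
  Fatou's lemma then lets the Gaussian tend to 1.\<close>

lemma nn_integral_fourier_le:
  fixes u :: "'a::euclidean_space \<Rightarrow> complex"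
  assumes u: "integrable lborel u"
  shows "(\<integral>\<^sup>+t. (norm (fourier u t))\<^sup>2 \<partial>lborel) \<le> (\<integral>\<^sup>+y. (norm (u y))\<^sup>2 \<partial>lborel)"
proof -
  have [measurable]: "u \<in> borel_measurable borel"
    using u by auto
  let ?C = "\<integral>\<^sup>+y. (norm (u y))\<^sup>2 \<partial>lborel"
  have b: "(\<integral>\<^sup>+t. (norm (fourier u t))\<^sup>2 * gauss s t \<partial>lborel) \<le> ?C" if s: "s > 0" for s
  proof -
    have cnj: "inv_fourier (\<lambda>y. cnj (u y)) t = cnj (fourier u t)" for t
    proof -
      have "cnj (fourier u t) = (LINT y|lborel. cnj (u y * unit_char (- (t \<bullet> y))))"
        unfolding fourier_unit_char by (rule Bochner_Integration.integral_cnj[symmetric])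
      also have "\<dots> = inv_fourier (\<lambda>y. cnj (u y)) t"
        unfolding inv_fourier_def by (intro Bochner_Integration.integral_cong refl) (simp add: inner_commute)
      finally show ?thesis ..
    qed
    have "complex_of_real (LINT t|lborel. (norm (fourier u t))\<^sup>2 * gauss s t) =
        (LINT t|lborel. fourier u t * inv_fourier (\<lambda>y. cnj (u y)) t * complex_of_real (gauss s t))"
      unfolding cnj integral_complex_of_real[symmetric]
      by (intro Bochner_Integration.integral_cong refl) (simp only: of_real_mult complex_norm_square)
    also have "\<dots> = (LINT p|lborel. cnj (u p) * (LINT y|lborel. u y * complex_of_real (gauss_hat s (y - p))))" (is "_ = ?R")
      by (rule fourier_inv_fourier_gauss[OF u _ s]) (use u in simp)
    finally have eq: "complex_of_real (LINT t|lborel. (norm (fourier u t))\<^sup>2 * gauss s t) = ?R" .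
    have "integrable lborel (\<lambda>t. (norm (fourier u t))\<^sup>2 * gauss s t)"
      by (rule Bochner_Integration.integrable_bound[OF integrable_mult_right[OF integrable_gauss[OF s], of "(LINT y|lborel. norm (u y))\<^sup>2"]])
        (auto intro!: mult_right_mono power_mono norm_fourier_le)
    then have "(\<integral>\<^sup>+t. (norm (fourier u t))\<^sup>2 * gauss s t \<partial>lborel) = ennreal (LINT t|lborel. (norm (fourier u t))\<^sup>2 * gauss s t)"
      by (intro nn_integral_eq_integral) auto
    also have "\<dots> \<le> ennreal (norm ?R)"
      unfolding eq[symmetric] by (intro ennreal_leI) simp
    finally have *: "(\<integral>\<^sup>+t. (norm (fourier u t))\<^sup>2 * gauss s t \<partial>lborel) \<le> ennreal (norm ?R)" .
    have "2 * ennreal (norm ?R) \<le> 2 * ?C"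
      using gauss_hat_bilinear_bound[OF u _ s, of "\<lambda>y. cnj (u y)"] u by (simp add: mult_2)
    then have "ennreal (norm ?R) \<le> ?C"
      by (subst (asm) ennreal_mult_le_mult_iff) auto
    with * show ?thesis by (rule order.trans)
  qed
  have "(\<integral>\<^sup>+t. (norm (fourier u t))\<^sup>2 \<partial>lborel) =
      (\<integral>\<^sup>+t. liminf (\<lambda>n. ennreal ((norm (fourier u t))\<^sup>2 * gauss (real (Suc n)) t)) \<partial>lborel)"
  proof (intro nn_integral_cong)
    fix t
    have "(\<lambda>n. ennreal ((norm (fourier u t))\<^sup>2 * gauss (real (Suc n)) t)) \<longlonglongrightarrow> ennreal ((norm (fourier u t))\<^sup>2 * 1)"
      by (intro tendsto_ennrealI tendsto_intros gauss_tendsto)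
    then show "ennreal ((norm (fourier u t))\<^sup>2) = liminf (\<lambda>n. ennreal ((norm (fourier u t))\<^sup>2 * gauss (real (Suc n)) t))"
      using lim_imp_Liminf[OF trivial_limit_sequentially] by fastforce
  qed
  also have "\<dots> \<le> liminf (\<lambda>n. \<integral>\<^sup>+t. ennreal ((norm (fourier u t))\<^sup>2 * gauss (real (Suc n)) t) \<partial>lborel)"
    by (rule nn_integral_liminf) measurable
  also have "\<dots> \<le> ?C"
    by (intro Liminf_le always_eventually allI b) auto
  finally show ?thesis .
qed

section \<open>Gaussian regularisation and approximation\<close>

text \<open>Substituting \<open>y = p + w / s\<close> freezes the kernel at
  \<open>gauss_hat 1\<close> and moves the parameter into the argument of \<open>u\<close>, where
  continuity and boundedness give dominated convergence.\<close>

lemma integral_gauss_hat_tendsto: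
  fixes u :: "'a::euclidean_space \<Rightarrow> complex"
  assumes c: "continuous_on UNIV u" and b: "\<And>x. norm (u x) \<le> M"
  shows "(\<lambda>n. LINT y|lborel. u y * complex_of_real (gauss_hat (real (Suc n)) (y - p))) \<longlonglongrightarrow> u p"
proof -
  have [measurable]: "u \<in> borel_measurable borel"
    using c by (rule borel_measurable_continuous_onI)
  let ?g = "\<lambda>w::'a. complex_of_real (gauss_hat 1 w)"
  have eq: "(LINT y|lborel. u y * complex_of_real (gauss_hat s (y - p))) =
      (LINT w|lborel. u (p + (1 / s) *\<^sub>R w) * ?g w)" if s: "s > 0" for s
  proof -
    have "integrable lborel (\<lambda>y. complex_of_real (gauss_hat s (- p + 1 *\<^sub>R y)))"
      by (rule integrable_lborel_affine) (use integrable_gauss_hat[OF s] in auto)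
    then have "integrable lborel (\<lambda>y. complex_of_real M * complex_of_real (gauss_hat s (y - p)))"
      by (intro integrable_mult_right) simp
    then have "integrable lborel (\<lambda>y. u y * complex_of_real (gauss_hat s (y - p)))"
      by (rule Bochner_Integration.integrable_bound)
        (use s in \<open>auto simp: norm_mult intro!: mult_right_mono order.trans[OF b]\<close>)
    then have "(LINT y|lborel. u y * complex_of_real (gauss_hat s (y - p))) =
      \<bar>1 / s\<bar> ^ DIM('a) *\<^sub>R (LINT w|lborel. u (p + (1 / s) *\<^sub>R w) * complex_of_real (gauss_hat s (p + (1 / s) *\<^sub>R w - p)))"
      by (intro integral_lborel_affine) (use s in auto)
    also have "\<dots> = (LINT w|lborel. u (p + (1 / s) *\<^sub>R w) * ?g w)"
      unfolding integral_scaleR_right[symmetric] using s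
      by (intro Bochner_Integration.integral_cong refl)
        (simp add: gauss_hat_scale[of s] scaleR_conv_of_real power_divide)
    finally show ?thesis .
  qed
  have "(\<lambda>n. LINT w|lborel. u (p + (1 / real (Suc n)) *\<^sub>R w) * ?g w) \<longlonglongrightarrow> (LINT w|lborel. u p * ?g w)"
  proof (rule integral_dominated_convergence)
    show "integrable lborel (\<lambda>w::'a. M * gauss_hat 1 w)"
      by (intro integrable_mult_right integrable_gauss_hat) simp
    show "AE w in lborel. (\<lambda>n. u (p + (1 / real (Suc n)) *\<^sub>R w) * ?g w) \<longlonglongrightarrow> u p * ?g w"
    proof (intro AE_I2 tendsto_intros)
      fix w
      have "(\<lambda>n. p + (1 / real (Suc n)) *\<^sub>R w) \<longlonglongrightarrow> p + 0 *\<^sub>R w"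
        by (intro tendsto_intros LIMSEQ_Suc[OF lim_1_over_n])
      then have "(\<lambda>n. p + (1 / real (Suc n)) *\<^sub>R w) \<longlonglongrightarrow> p"
        by simp
      then show "(\<lambda>n. u (p + (1 / real (Suc n)) *\<^sub>R w)) \<longlonglongrightarrow> u p"
        using continuous_on_tendsto_compose[OF c] by auto
    qed
    show "AE w in lborel. norm (u (p + (1 / real (Suc n)) *\<^sub>R w) * ?g w) \<le> M * gauss_hat 1 w" for n
      by (auto simp: norm_mult intro!: mult_right_mono b)
  qed measurable
  also have "(LINT w|lborel. u p * ?g w) = u p"
    using integral_gauss_hat[of 1, where 'a='a] by simp
  finally show ?thesis
    by (subst eq) auto
qed

text \<open>Fourier inversion in the sense of Gaussian means, which makes sense even when
  \<open>fourier u\<close> fails to be integrable.\<close>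

lemma inv_fourier_fourier_tendsto:
  fixes u :: "'a::euclidean_space \<Rightarrow> complex"
  assumes c: "continuous_on UNIV u" and b: "\<And>x. norm (u x) \<le> M" and i: "integrable lborel u"
  shows "(\<lambda>n. LINT t|lborel. fourier u t * unit_char (p \<bullet> t) * complex_of_real (gauss (real (Suc n)) t)) \<longlonglongrightarrow> u p"
  using integral_gauss_hat_tendsto[OF c b, of p]
  by (subst fourier_gauss_mult[OF i]) auto

text \<open>The predicate \<open>measurable_on\<close> provides continuous approximants off a
  negligible set; the rest translates between \<open>lebesgue\<close> and
  \<open>lborel\<close>.\<close>

lemma AE_limit_of_continuous:
  fixes f :: "'a::euclidean_space \<Rightarrow> complex"
  assumes "f \<in> borel_measurable borel"
  obtains g where "\<And>n. continuous_on UNIV (g n)" "AE x in lborel. (\<lambda>n. g n x) \<longlonglongrightarrow> f x"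
proof -
  have "f \<in> borel_measurable lebesgue"
    using assms by (simp add: measurable_completion)
  then have "f measurable_on UNIV"
    by (intro lebesgue_measurable_imp_measurable_on) (auto simp: lebesgue_on_UNIV_eq)
  then obtain N g where N: "negligible N" and g: "\<And>n. continuous_on UNIV (g n)"
      and lim: "\<And>x. x \<notin> N \<Longrightarrow> (\<lambda>n. g n x) \<longlonglongrightarrow> f x"
    unfolding measurable_on_def by auto
  have "AE x in lebesgue. x \<notin> N"
    using N by (simp add: negligible_iff_null_sets AE_not_in)
  then have "AE x in lborel. x \<notin> N"
    by (simp add: AE_completion_iff)
  then have "AE x in lborel. (\<lambda>n. g n x) \<longlonglongrightarrow> f x"
    by eventually_elim (rule lim)
  with g show thesis by (rule that)
qed

text \<open>Truncate first, then approximate the bounded function almost everywhere.\<close>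

lemma continuous_L1_approx:
  fixes f :: "'a::euclidean_space \<Rightarrow> complex"
  assumes i: "integrable lborel f" and e: "e > 0" and B: "B \<in> sets borel" "emeasure lborel B < \<infinity>"
  obtains u M where "continuous_on UNIV u" "\<And>x. norm (u x) \<le> M"
    "(LINT x|lborel. indicator B x * norm (f x - u x)) < e"
proof -
  have [measurable]: "f \<in> borel_measurable borel" and [measurable]: "B \<in> sets borel"
    using i B by auto
  \<comment> \<open>The nearest-point projection onto a disc is a continuous truncation: composed
    with a continuous approximant it keeps continuity and adds the bound \<open>M\<close>.\<close>
  define c where "c M = closest_point (cball (0::complex) M)" for M :: real
  have contc: "continuous_on UNIV (c M)" if "M \<ge> 0" for M
    unfolding c_def using that by (intro continuous_on_closest_point) auto
  have normc: "norm (c M z) \<le> M" if "M \<ge> 0" for M z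
    using closest_point_exists(1)[of "cball 0 M" z] that by (auto simp: c_def)
  have cz: "c M z = z" if "norm z \<le> M" for M z
    unfolding c_def using that by (intro closest_point_self) auto
  have normc2: "norm (c M z) \<le> 2 * norm z" if "M \<ge> 0" for M z
    using closest_point_le[of "cball 0 M" 0 z] that norm_triangle_ineq4[of z "z - c M z"]
    by (auto simp: c_def dist_norm)
  have normc3: "norm (indicator B x * norm (f x - c (real n) (f x))) \<le> 3 * norm (f x)" for x n
    using normc2[of "real n" "f x"] norm_triangle_ineq4[of "f x" "c (real n) (f x)"]
    by (auto simp: indicator_def)
  have [measurable]: "c M \<in> borel_measurable borel" if "M \<ge> 0" for M
    using contc[OF that] by (rule borel_measurable_continuous_onI)
  have "(\<lambda>n. LINT x|lborel. indicator B x * norm (f x - c (real n) (f x))) \<longlonglongrightarrow> (LINT x::'a|lborel. 0)"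
  proof (rule integral_dominated_convergence)
    show "integrable lborel (\<lambda>x. 3 * norm (f x))"
      using i by auto
    show "AE x in lborel. (\<lambda>n. indicator B x * norm (f x - c (real n) (f x))) \<longlonglongrightarrow> 0"
    proof (intro AE_I2 tendsto_eventually)
      fix x
      obtain n0 :: nat where "norm (f x) \<le> real n0"
        using real_arch_simple by blast
      then show "\<forall>\<^sub>F n in sequentially. indicator B x * norm (f x - c (real n) (f x)) = 0"
        by (intro eventually_sequentiallyI[of n0]) (simp add: cz)
    qed
    show "AE x in lborel. norm (indicator B x * norm (f x - c (real n) (f x))) \<le> 3 * norm (f x)" for n
      using normc3 by blast
  qed measurable
  then have "\<forall>\<^sub>F n in sequentially. (LINT x|lborel. indicator B x * norm (f x - c (real n) (f x))) < e / 2"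
    using e by (intro order_tendstoD) auto
  then obtain n where n: "(LINT x|lborel. indicator B x * norm (f x - c (real n) (f x))) < e / 2"
    by (auto simp: eventually_sequentially)
  let ?c = "c (real n)"
  obtain g where g: "\<And>n. continuous_on UNIV (g n)" and lim: "AE x in lborel. (\<lambda>n. g n x) \<longlonglongrightarrow> f x"
    by (rule AE_limit_of_continuous[of f]) auto
  have cont: "continuous_on UNIV (\<lambda>x. ?c (g k x))" for k
    by (rule continuous_on_compose2[OF contc g]) auto
  have [measurable]: "(\<lambda>x. ?c (g k x)) \<in> borel_measurable borel" for k
    by (rule borel_measurable_continuous_onI[OF cont])
  \<comment> \<open>Both truncated functions are at most \<open>n\<close> in norm and
    \<open>B\<close> has finite measure, so a constant on \<open>B\<close> is an integrable
    majorant.\<close>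
  have iB: "integrable lborel (\<lambda>x. indicator B x * (2 * real n))"
    using B by (intro integrable_mult_left integrable_real_indicator) auto
  have le: "norm (indicator B x * norm (?c (f x) - ?c (g k x))) \<le> indicator B x * (2 * real n)" for k x
    using norm_triangle_ineq4[of "?c (f x)" "?c (g k x)"] normc[of "real n" "f x"] normc[of "real n" "g k x"]
    by (auto simp: indicator_def)
  have "(\<lambda>k. LINT x|lborel. indicator B x * norm (?c (f x) - ?c (g k x))) \<longlonglongrightarrow> (LINT x::'a|lborel. 0)"
  proof (rule integral_dominated_convergence[OF _ _ iB])
    show "AE x in lborel. (\<lambda>k. indicator B x * norm (?c (f x) - ?c (g k x))) \<longlonglongrightarrow> 0"
      using lim
    proof eventually_elim
      case (elim x)
      have "(\<lambda>k. ?c (g k x)) \<longlonglongrightarrow> ?c (f x)"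
        by (rule continuous_on_tendsto_compose[OF contc elim]) auto
      then have "(\<lambda>k. indicator B x * norm (?c (f x) - ?c (g k x))) \<longlonglongrightarrow> indicator B x * norm (?c (f x) - ?c (f x))"
        by (intro tendsto_intros)
      then show ?case by simp
    qed
    show "AE x in lborel. norm (indicator B x * norm (?c (f x) - ?c (g k x))) \<le> indicator B x * (2 * real n)" for k
      using le by blast
  qed measurable
  then have "\<forall>\<^sub>F k in sequentially. (LINT x|lborel. indicator B x * norm (?c (f x) - ?c (g k x))) < e / 2"
    using e by (intro order_tendstoD) auto
  then obtain k where k: "(LINT x|lborel. indicator B x * norm (?c (f x) - ?c (g k x))) < e / 2"
    by (auto simp: eventually_sequentially)
  have i1: "integrable lborel (\<lambda>x. indicator B x * norm (f x - ?c (f x)))"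
    by (rule Bochner_Integration.integrable_bound[where f="\<lambda>x. 3 * norm (f x)"])
      (use normc3 i in auto)
  have i2: "integrable lborel (\<lambda>x. indicator B x * norm (?c (f x) - ?c (g k x)))"
    by (rule Bochner_Integration.integrable_bound[OF iB]) (use le[of _ k] in \<open>auto simp: abs_mult\<close>)
  have "(LINT x|lborel. indicator B x * norm (f x - ?c (g k x)))
      \<le> (LINT x|lborel. indicator B x * norm (f x - ?c (f x)) + indicator B x * norm (?c (f x) - ?c (g k x)))"
    unfolding distrib_left[symmetric]
  proof (rule integral_mono')
    show "integrable lborel (\<lambda>x. indicator B x * (norm (f x - ?c (f x)) + norm (?c (f x) - ?c (g k x))))"
      unfolding distrib_left using i1 i2 by auto
    show "indicator B x * norm (f x - ?c (g k x)) \<le> indicator B x * (norm (f x - ?c (f x)) + norm (?c (f x) - ?c (g k x)))" for x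
      using norm_triangle_ineq[of "f x - ?c (f x)" "?c (f x) - ?c (g k x)"] by (auto simp: indicator_def)
  qed auto
  also have "\<dots> < e"
    using i1 i2 n k by simp
  finally show thesis
    by (intro that[OF cont, of _ "real n"]) (use normc in auto)
qed

section \<open>Schwartz functions and the Fourier transform on L2\<close>

text \<open>The exponent arises from
  \<open>1 + (x \<bullet> b)\<^sup>2 \<le> (1 + norm x)\<^sup>2\<close>, multiplied over all basis
  vectors: the weight is dominated by a tensor product of integrable functions of one
  variable.\<close>

lemma integrable_inverse_one_plus_norm:
  "integrable lborel (\<lambda>x::'a::euclidean_space. inverse ((1 + norm x) ^ (2 * DIM('a))))"
proof -
  have "set_integrable lborel (einterval (- \<infinity>) \<infinity>) (\<lambda>x::real. inverse (1 + x\<^sup>2))"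
    by (rule integrable_inverse_1_plus_square)
  then have "integrable lborel (\<lambda>x::real. inverse (1 + x\<^sup>2))"
    by (simp add: set_integrable_def)
  then have "integrable lborel (\<lambda>x::'a. \<Prod>b\<in>Basis. complex_of_real (inverse (1 + (x \<bullet> b)\<^sup>2)))"
    by (intro integrable_lborel_prod integrable_of_real)
  then show ?thesis
  proof (rule Bochner_Integration.integrable_bound)
    show "AE x::'a in lborel. norm (inverse ((1 + norm x) ^ (2 * DIM('a)))) \<le>
        norm (\<Prod>b\<in>Basis. complex_of_real (inverse (1 + (x \<bullet> b)\<^sup>2)))"
    proof (rule AE_I2)
      fix x :: 'a
      have "(\<Prod>b\<in>(Basis::'a set). 1 + (x \<bullet> b)\<^sup>2) \<le> (\<Prod>b\<in>(Basis::'a set). (1 + norm x)\<^sup>2)"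
      proof (intro prod_mono conjI)
        fix b :: 'a assume b: "b \<in> Basis"
        have "(x \<bullet> b)\<^sup>2 \<le> (norm x)\<^sup>2"
          using power_mono[OF Basis_le_norm[OF b, of x] abs_ge_zero, of 2] by simp
        then show "1 + (x \<bullet> b)\<^sup>2 \<le> (1 + norm x)\<^sup>2"
          by (simp add: power2_sum add_increasing2)
      qed (auto intro!: add_nonneg_nonneg)
      also have "\<dots> = (1 + norm x) ^ (2 * DIM('a))"
        by (simp add: power_mult)
      finally have "inverse ((1 + norm x) ^ (2 * DIM('a))) \<le> inverse (\<Prod>b\<in>(Basis::'a set). 1 + (x \<bullet> b)\<^sup>2)"
        by (intro le_imp_inverse_le prod_pos) (auto intro!: add_pos_nonneg)
      also have "\<dots> \<le> norm (\<Prod>b\<in>Basis. complex_of_real (inverse (1 + (x \<bullet> b)\<^sup>2)))"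
        by (simp add: prod_inversef[symmetric] flip: of_real_add of_real_power of_real_prod of_real_inverse)
      finally show "norm (inverse ((1 + norm x) ^ (2 * DIM('a)))) \<le> norm (\<Prod>b\<in>Basis. complex_of_real (inverse (1 + (x \<bullet> b)\<^sup>2)))"
        by simp
    qed
  qed measurable
qed

lemma smooth_imp_continuous: "smooth f \<Longrightarrow> continuous_on UNIV f"
proof -
  assume "smooth f"
  then have "partials [] f differentiable (at x)" for x
    unfolding smooth_def by fastforce
  then have "f differentiable (at x)" for x
    by (simp add: partials_def)
  then show ?thesis
    by (simp add: differentiable_imp_continuous_within continuous_on_eq_continuous_at)
qed

text \<open>A real supremum bounds its members only if the family is bounded above. Here the family
  is a finite union, over the lists \<open>bs\<close>, of families that are bounded by the
  definition of \<open>schwartz\<close>.\<close>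

lemma schwartz_seminorm_bound:
  assumes "f \<in> schwartz"
  shows "(1 + norm x) ^ N * norm (f x) \<le> schwartz_seminorm N f"
proof -
  let ?A = "{bs::'a list. set bs \<subseteq> Basis \<and> length bs \<le> N}"
  have fin: "finite ?A"
    by (rule finite_lists_length_le) simp
  have "bdd_above ((\<lambda>x. (1 + norm x) ^ N * norm (partials bs f x)) ` UNIV)" if "bs \<in> ?A" for bs
  proof -
    have "bounded (range (\<lambda>x. (1 + norm x) ^ N *\<^sub>R partials bs f x))"
      using assms that by (auto simp: schwartz_def)
    then obtain C where "\<And>x. norm ((1 + norm x) ^ N *\<^sub>R partials bs f x) \<le> C"
      by (auto simp: bounded_iff)
    then show ?thesis
      by (intro bdd_aboveI[of _ C]) (auto simp: norm_power abs_of_nonneg)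
  qed
  then have "bdd_above (\<Union>bs\<in>?A. (\<lambda>x. (1 + norm x) ^ N * norm (partials bs f x)) ` UNIV)"
    using fin by (subst bdd_above_UN) auto
  also have "(\<Union>bs\<in>?A. (\<lambda>x. (1 + norm x) ^ N * norm (partials bs f x)) ` UNIV) =
      (\<lambda>(bs, x). (1 + norm x) ^ N * norm (partials bs f x)) ` (?A \<times> UNIV)"
    by auto
  finally have "(case ([], x) of (bs, x) \<Rightarrow> (1 + norm x) ^ N * norm (partials bs f x)) \<le> schwartz_seminorm N f"
    unfolding schwartz_seminorm_def by (intro cSUP_upper) auto
  then show ?thesis
    by (simp add: partials_def)
qed

lemma schwartz_decay:
  assumes "f \<in> schwartz"
  shows "norm (f x) \<le> schwartz_seminorm N f * inverse ((1 + norm x) ^ N)"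
  using schwartz_seminorm_bound[OF assms, of x N]
  by (simp add: field_simps add_pos_nonneg)

lemma schwartz_continuous: "f \<in> schwartz \<Longrightarrow> continuous_on UNIV f"
  by (simp add: schwartz_def smooth_imp_continuous)

lemma schwartz_measurable: "f \<in> schwartz \<Longrightarrow> f \<in> borel_measurable borel"
  by (intro borel_measurable_continuous_onI schwartz_continuous)

lemma schwartz_integrable: "f \<in> schwartz \<Longrightarrow> integrable lborel f"
  by (rule Bochner_Integration.integrable_bound[OF integrable_mult_right[OF integrable_inverse_one_plus_norm, of "schwartz_seminorm (2 * DIM('a)) f"]])
    (auto intro!: schwartz_measurable order.trans[OF schwartz_decay abs_ge_self])

lemma schwartz_bounded: "f \<in> schwartz \<Longrightarrow> norm (f x) \<le> schwartz_seminorm 0 f"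
  using schwartz_decay[of f x 0] by simp

section \<open>Square-integrable functions and their Fourier integrals\<close>

lemma L2_norm_nonneg [simp]: "0 \<le> L2_norm f"
  by (simp add: L2_norm_def)

lemma L2_iff_nn_integral:
  "f \<in> L2 \<longleftrightarrow> f \<in> borel_measurable borel \<and> (\<integral>\<^sup>+x. (norm (f x))\<^sup>2 \<partial>lborel) < \<infinity>"
  by (auto simp: L2_def integrable_iff_bounded)

lemma nn_integral_L2_norm:
  "f \<in> L2 \<Longrightarrow> (\<integral>\<^sup>+x. (norm (f x))\<^sup>2 \<partial>lborel) = ennreal ((L2_norm f)\<^sup>2)"
  unfolding L2_norm_def by (subst nn_integral_eq_integral) (auto simp: L2_def)

lemma L2_norm_le:
  assumes f: "f \<in> borel_measurable borel" and g: "g \<in> L2" and c: "c \<ge> 0"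
    and le: "(\<integral>\<^sup>+x. (norm (f x))\<^sup>2 \<partial>lborel) \<le> ennreal (c\<^sup>2) * (\<integral>\<^sup>+x. (norm (g x))\<^sup>2 \<partial>lborel)"
  shows "f \<in> L2" and "L2_norm f \<le> c * L2_norm g"
proof -
  have "(\<integral>\<^sup>+x. (norm (f x))\<^sup>2 \<partial>lborel) \<le> ennreal ((c * L2_norm g)\<^sup>2)"
    using le unfolding nn_integral_L2_norm[OF g] by (simp add: power_mult_distrib ennreal_mult)
  then show *: "f \<in> L2"
    unfolding L2_iff_nn_integral using f by (auto intro: order.strict_trans1)
  have "(L2_norm f)\<^sup>2 \<le> (c * L2_norm g)\<^sup>2"
    using le unfolding nn_integral_L2_norm[OF g] nn_integral_L2_norm[OF *]
    by (simp add: power_mult_distrib flip: ennreal_mult)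
  then show "L2_norm f \<le> c * L2_norm g"
    using c by (simp add: power2_le_iff_abs_le)
qed

lemma L2_bounded_integrable:
  fixes h :: "'a::euclidean_space \<Rightarrow> complex"
  assumes "integrable lborel h" "\<And>x. norm (h x) \<le> M"
  shows "h \<in> L2"
  unfolding L2_def
proof (safe)
  have [measurable]: "h \<in> borel_measurable borel"
    using assms by auto
  then show "h \<in> borel_measurable lborel" by simp
  show "integrable lborel (\<lambda>x. (norm (h x))\<^sup>2)"
    by (rule Bochner_Integration.integrable_bound[OF integrable_mult_right[OF integrable_norm[OF assms(1)], of M]])
      (auto simp: power2_eq_square abs_mult intro!: mult_right_mono order.trans[OF assms(2) abs_ge_self])
qed

lemma schwartz_L2: "h \<in> schwartz \<Longrightarrow> h \<in> L2"
  by (rule L2_bounded_integrable[OF schwartz_integrable schwartz_bounded])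

lemma norm_mult_le_squares: "norm (a * b) \<le> (norm a)\<^sup>2 + (norm b)\<^sup>2" for a b :: complex
  using sum_squares_bound[of "norm a" "norm b"] zero_le_power2[of "norm a"] zero_le_power2[of "norm b"]
  unfolding norm_mult by linarith

lemma L2_mult_integrable:
  assumes "f \<in> L2" "g \<in> L2"
  shows "integrable lborel (\<lambda>x. f x * g x)"
  by (rule Bochner_Integration.integrable_bound[where f="\<lambda>x. (norm (f x))\<^sup>2 + (norm (g x))\<^sup>2"])
    (use assms in \<open>auto simp: L2_def intro!: norm_mult_le_squares[THEN order.trans]\<close>)

lemma L2_add:
  assumes "f \<in> L2" "g \<in> L2"
  shows "(\<lambda>x. f x + g x) \<in> L2"
  unfolding L2_def
proof safe
  have [measurable]: "f \<in> borel_measurable borel" "g \<in> borel_measurable borel"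
    using assms by (auto simp: L2_def)
  then show "(\<lambda>x. f x + g x) \<in> borel_measurable lborel" by simp
  have *: "(norm (a + b))\<^sup>2 \<le> 2 * ((norm a)\<^sup>2 + (norm b)\<^sup>2)" for a b :: complex
    using power_mono[OF norm_triangle_ineq[of a b], of 2] sum_squares_bound[of "norm a" "norm b"]
    by (simp add: power2_sum)
  show "integrable lborel (\<lambda>x. (norm (f x + g x))\<^sup>2)"
    by (rule Bochner_Integration.integrable_bound[where f="\<lambda>x. 2 * ((norm (f x))\<^sup>2 + (norm (g x))\<^sup>2)"])
      (use assms * in \<open>auto simp: L2_def\<close>)
qed

lemma L2_cmult: "f \<in> L2 \<Longrightarrow> (\<lambda>x. c * f x) \<in> L2"
  by (auto simp: L2_def norm_mult power_mult_distrib)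

lemma fourier_L2:
  assumes "integrable lborel u" "u \<in> L2"
  shows "fourier u \<in> L2" and "L2_norm (fourier u) \<le> L2_norm u"
  using L2_norm_le[of "fourier u" u 1] assms nn_integral_fourier_le[OF assms(1)] by auto

lemma inv_fourier_L2:
  fixes u :: "'a::euclidean_space \<Rightarrow> complex"
  assumes "integrable lborel u" "u \<in> L2"
  shows "inv_fourier u \<in> L2" and "L2_norm (inv_fourier u) \<le> L2_norm u"
proof -
  have [measurable]: "u \<in> borel_measurable borel"
    using assms by auto
  have "(\<integral>\<^sup>+t. (norm (inv_fourier u t))\<^sup>2 \<partial>lborel) = (\<integral>\<^sup>+t. (norm (fourier u t))\<^sup>2 \<partial>lborel)"
    unfolding inv_fourier_conv_fourier
    using nn_integral_lborel_affine[of "\<lambda>t. ennreal ((norm (fourier u t))\<^sup>2)" "-1" 0] by simp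
  then show "inv_fourier u \<in> L2" and "L2_norm (inv_fourier u) \<le> L2_norm u"
    using L2_norm_le[of "inv_fourier u" u 1] assms nn_integral_fourier_le[OF assms(1)] by auto
qed

text \<open>The pairing with a Gaussian factor has two limits as the Gaussian tends to 1. On one
  side the factor simply disappears, because a product of two square-integrable functions is
  integrable. On the other the Gaussian means of \<open>h\<close> converge to \<open>h\<close> and
  stay bounded. Equating the limits gives the weak relation.\<close>

lemma L2_fourier_inv_fourier:
  fixes v :: "'a::euclidean_space \<Rightarrow> complex"
  assumes v: "integrable lborel v" "v \<in> L2"
  shows "L2_fourier (inv_fourier v) v"
  unfolding L2_fourier_def
proof (intro conjI ballI inv_fourier_L2 v)
  fix h :: "'a \<Rightarrow> complex" assume h: "h \<in> schwartz"
  have [measurable]: "v \<in> borel_measurable borel" "h \<in> borel_measurable borel"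
    using v h by (auto simp: schwartz_measurable)
  let ?M = "schwartz_seminorm 0 h"
  have hi: "integrable lborel h"
    by (rule schwartz_integrable[OF h])
  have prod: "integrable lborel (\<lambda>t. inv_fourier v t * fourier h t)"
    by (intro L2_mult_integrable inv_fourier_L2 fourier_L2 v hi schwartz_L2 h)
  let ?g = "\<lambda>n. gauss (real (Suc n)) :: 'a \<Rightarrow> real"
  have "(\<lambda>n. LINT t|lborel. fourier h t * inv_fourier v t * complex_of_real (?g n t))
     \<longlonglongrightarrow> (LINT t|lborel. fourier h t * inv_fourier v t)"
  proof (rule integral_dominated_convergence[OF _ _ integrable_norm[OF prod]])
    show "AE t in lborel. (\<lambda>n. fourier h t * inv_fourier v t * complex_of_real (?g n t)) \<longlonglongrightarrow> fourier h t * inv_fourier v t"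
    proof (rule AE_I2)
      fix t
      have "(\<lambda>n. fourier h t * inv_fourier v t * complex_of_real (?g n t)) \<longlonglongrightarrow> fourier h t * inv_fourier v t * complex_of_real 1"
        by (intro tendsto_intros gauss_tendsto)
      then show "(\<lambda>n. fourier h t * inv_fourier v t * complex_of_real (?g n t)) \<longlonglongrightarrow> fourier h t * inv_fourier v t"
        by simp
    qed
    show "AE t in lborel. norm (fourier h t * inv_fourier v t * complex_of_real (?g n t)) \<le> norm (inv_fourier v t * fourier h t)" for n
      by (auto simp: norm_mult mult_ac intro!: mult_left_le mult_left_mono)
  qed measurable
  moreover have "(\<lambda>n. LINT t|lborel. fourier h t * inv_fourier v t * complex_of_real (?g n t))
     \<longlonglongrightarrow> (LINT p|lborel. v p * h p)"
  proof (subst fourier_inv_fourier_gauss(1)[OF hi v(1)], simp, rule integral_dominated_convergence)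
    let ?I = "\<lambda>n p. LINT y|lborel. h y * complex_of_real (gauss_hat (real (Suc n)) (y - p))"
    show "integrable lborel (\<lambda>p. ?M * norm (v p))"
      using v by auto
    show "(\<lambda>p. v p * ?I n p) \<in> borel_measurable lborel" for n
      by (intro borel_measurable_times lborel.borel_measurable_lebesgue_integral) measurable
    show "AE p in lborel. (\<lambda>n. v p * ?I n p) \<longlonglongrightarrow> v p * h p"
      by (intro AE_I2 tendsto_intros integral_gauss_hat_tendsto[OF schwartz_continuous[OF h] schwartz_bounded[OF h]])
    show "AE p in lborel. norm (v p * ?I n p) \<le> ?M * norm (v p)" for n
    proof (rule AE_I2)
      fix p :: 'a
      have i: "integrable lborel (\<lambda>y. complex_of_real (gauss_hat (real (Suc n)) (- p + 1 *\<^sub>R y)))"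
        by (rule integrable_lborel_affine) (use integrable_gauss_hat[of "real (Suc n)"] in auto)
      have int: "(LINT y|lborel. gauss_hat (real (Suc n)) (y - p)) = 1"
        using integral_lborel_affine[OF _ integrable_gauss_hat, of 1 "real (Suc n)" "- p", symmetric]
          integral_gauss_hat[of "real (Suc n)", where 'a='a] by simp
      have i': "integrable lborel (\<lambda>y. gauss_hat (real (Suc n)) (y - p))"
        using i integrable_Re[OF i] by simp
      have "norm (?I n p) \<le> (LINT y|lborel. norm (h y * complex_of_real (gauss_hat (real (Suc n)) (y - p))))"
        by (rule integral_norm_bound)
      also have "\<dots> \<le> (LINT y|lborel. ?M * gauss_hat (real (Suc n)) (y - p))"
        by (rule integral_mono') (use i' in \<open>auto simp: norm_mult intro!: mult_right_mono mult_nonneg_nonneg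
            schwartz_bounded[OF h] order.trans[OF norm_ge_zero schwartz_bounded[OF h]]\<close>)
      also have "\<dots> = ?M"
        using int by simp
      finally have "norm (?I n p) \<le> ?M" .
      then show "norm (v p * ?I n p) \<le> ?M * norm (v p)"
        using mult_left_mono[of "norm (?I n p)" ?M "norm (v p)"] by (simp add: norm_mult mult.commute)
    qed
  qed measurable
  ultimately have "(LINT t|lborel. fourier h t * inv_fourier v t) = (LINT p|lborel. v p * h p)"
    by (rule LIMSEQ_unique)
  then show "fourier_distribution (function_distribution (inv_fourier v)) h = function_distribution v h"
    by (simp add: fourier_distribution_def function_distribution_def mult.commute)
qed

section \<open>Smooth functions and test functions\<close>

lemma partials_Cons: "partials (b # bs) f = (\<lambda>x. frechet_derivative (partials bs f) (at x) b)"
  by (simp add: partials_def)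

lemma partials_Nil [simp]: "partials [] f = f"
  by (simp add: partials_def)

lemma smooth_partials_has_derivative:
  "smooth f \<Longrightarrow> set bs \<subseteq> Basis \<Longrightarrow> (partials bs f has_derivative frechet_derivative (partials bs f) (at x)) (at x)"
  by (simp add: smooth_def frechet_derivative_works[symmetric])

lemma partials_add:
  assumes "smooth f" "smooth g" "set bs \<subseteq> Basis"
  shows "partials bs (\<lambda>x. f x + g x) = (\<lambda>x. partials bs f x + partials bs g x)"
  using assms(3)
proof (induction bs)
  case (Cons b bs)
  have "frechet_derivative (\<lambda>x. partials bs f x + partials bs g x) (at x) =
      (\<lambda>h. frechet_derivative (partials bs f) (at x) h + frechet_derivative (partials bs g) (at x) h)" for x
    by (rule frechet_derivative_at[symmetric]) (use Cons.prems in \<open>auto intro!: has_derivative_add smooth_partials_has_derivative assms\<close>)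
  with Cons show ?case
    by (simp add: partials_Cons)
qed simp

lemma partials_cmult:
  assumes "smooth f" "set bs \<subseteq> Basis"
  shows "partials bs (\<lambda>x. c * f x) = (\<lambda>x. c * partials bs f x)"
  using assms(2)
proof (induction bs)
  case (Cons b bs)
  have "frechet_derivative (\<lambda>x. c * partials bs f x) (at x) = (\<lambda>h. c * frechet_derivative (partials bs f) (at x) h)" for x
    by (rule frechet_derivative_at[symmetric]) (use Cons.prems in \<open>auto intro!: has_derivative_mult_right smooth_partials_has_derivative assms\<close>)
  with Cons show ?case
    by (simp add: partials_Cons)
qed simp

lemma smooth_add: "smooth f \<Longrightarrow> smooth g \<Longrightarrow> smooth (\<lambda>x. f x + g x)"
  by (subst smooth_def) (auto simp: partials_add smooth_def)

lemma smooth_cmult: "smooth f \<Longrightarrow> smooth (\<lambda>x. c * f x)"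
  by (subst smooth_def) (auto simp: partials_cmult smooth_def)

lemma partials_shift:
  assumes "smooth f" "set bs \<subseteq> Basis"
  shows "partials bs (\<lambda>x. f (x - a)) = (\<lambda>x. partials bs f (x - a))"
    and "(\<lambda>x. partials bs f (x - a)) differentiable at x"
proof -
  have d: "((\<lambda>x. partials bs f (x - a)) has_derivative frechet_derivative (partials bs f) (at (x - a))) (at x)"
    if "set bs \<subseteq> Basis" for bs x
  proof -
    have "((\<lambda>x. x - a) has_derivative (\<lambda>h. h)) (at x)"
      by (auto intro!: derivative_eq_intros)
    from has_derivative_compose[OF this smooth_partials_has_derivative[OF assms(1) that, of "x - a"]]
    show ?thesis by simp
  qed
  then show "(\<lambda>x. partials bs f (x - a)) differentiable at x"
    using assms(2) by (auto simp: differentiable_def)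
  show "partials bs (\<lambda>x. f (x - a)) = (\<lambda>x. partials bs f (x - a))"
    using assms(2)
  proof (induction bs)
    case (Cons b bs)
    then have "partials bs (\<lambda>x. f (x - a)) = (\<lambda>x. partials bs f (x - a))"
      by simp
    moreover have "frechet_derivative (\<lambda>x. partials bs f (x - a)) (at x) = frechet_derivative (partials bs f) (at (x - a))" for x
      by (rule frechet_derivative_at[symmetric, OF d]) (use Cons.prems in auto)
    ultimately show ?case
      by (simp add: partials_Cons)
  qed simp
qed

lemma smooth_shift: "smooth f \<Longrightarrow> smooth (\<lambda>x. f (x - a))"
  by (subst smooth_def) (auto simp: partials_shift)

section \<open>Test functions\<close>

lemma test_functionsI:
  assumes "smooth f" "compact K" "K \<subseteq> U" "\<And>x. x \<notin> K \<Longrightarrow> f x = 0"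
  shows "f \<in> test_functions U"
proof -
  have "closure {x. f x \<noteq> 0} \<subseteq> K"
    using assms by (intro closure_minimal) (auto intro: compact_imp_closed)
  moreover have "compact (closure {x. f x \<noteq> 0})"
    using calculation assms(2) compact_Int_closed[of K "closure {x. f x \<noteq> 0}"] by (simp add: Int_absorb1)
  ultimately show ?thesis
    using assms by (auto simp: test_functions_def)
qed

lemma test_functionsE:
  assumes "f \<in> test_functions U"
  obtains K where "smooth f" "compact K" "K \<subseteq> U" "\<And>x. x \<notin> K \<Longrightarrow> f x = 0"
proof (rule that)
  show "smooth f" "compact (closure {x. f x \<noteq> 0})" "closure {x. f x \<noteq> 0} \<subseteq> U"
    using assms by (auto simp: test_functions_def)
  show "f x = 0" if "x \<notin> closure {x. f x \<noteq> 0}" for x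
    using that closure_subset[of "{x. f x \<noteq> 0}"] by blast
qed

lemma test_functions_add:
  assumes "f \<in> test_functions U" "g \<in> test_functions U"
  shows "(\<lambda>x. f x + g x) \<in> test_functions U"
proof -
  obtain K where K: "smooth f" "compact K" "K \<subseteq> U" "\<And>x. x \<notin> K \<Longrightarrow> f x = 0"
    by (rule test_functionsE[OF assms(1)]) (rule that)
  obtain L where L: "smooth g" "compact L" "L \<subseteq> U" "\<And>x. x \<notin> L \<Longrightarrow> g x = 0"
    by (rule test_functionsE[OF assms(2)]) (rule that)
  from K L show ?thesis
    by (intro test_functionsI[of _ "K \<union> L"]) (auto intro: smooth_add)
qed

lemma test_functions_cmult:
  assumes "f \<in> test_functions U"
  shows "(\<lambda>x. c * f x) \<in> test_functions U"
proof -
  obtain K where "smooth f" "compact K" "K \<subseteq> U" "\<And>x. x \<notin> K \<Longrightarrow> f x = 0"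
    by (rule test_functionsE[OF assms]) (rule that)
  then show ?thesis
    by (intro test_functionsI[of _ K]) (auto intro: smooth_cmult)
qed

lemma smooth_zero: "smooth (\<lambda>x. 0)"
proof -
  have "partials bs (\<lambda>x. 0) = (\<lambda>x::'a. 0)" for bs :: "'a list"
    by (induction bs) (auto simp: partials_Cons)
  then show ?thesis by (simp add: smooth_def)
qed

lemma test_functions_sum:
  assumes "\<And>i. i \<in> I \<Longrightarrow> f i \<in> test_functions U"
  shows "(\<lambda>x. \<Sum>i\<in>I. f i x) \<in> test_functions U"
  using assms
  by (induction I rule: infinite_finite_induct)
    (auto intro!: test_functions_add intro: test_functionsI[of _ "{}"] smooth_zero)

lemma test_functions_shift:
  assumes "f \<in> test_functions U"
  shows "(\<lambda>z. f (z - x)) \<in> test_functions UNIV"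
proof -
  obtain K where K: "smooth f" "compact K" "K \<subseteq> U" "\<And>x. x \<notin> K \<Longrightarrow> f x = 0"
    by (rule test_functionsE[OF assms]) (rule that)
  have "z - x \<notin> K" if "z \<notin> (+) x ` K" for z
    using that by (metis add_diff_cancel_left' diff_add_cancel add.commute image_eqI)
  then show ?thesis
    using K by (intro test_functionsI[of _ "(+) x ` K"]) (auto intro: smooth_shift compact_translation)
qed

lemma test_functions_schwartz:
  assumes "f \<in> test_functions U"
  shows "f \<in> schwartz"
  unfolding schwartz_def
proof safe
  obtain K where K: "smooth f" "compact K" "K \<subseteq> U" "\<And>x. x \<notin> K \<Longrightarrow> f x = 0"
    by (rule test_functionsE[OF assms]) (rule that)
  show "smooth f" by fact
  fix bs :: "'a list" and N :: nat
  assume bs: "set bs \<subseteq> Basis"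
  have zero: "partials bs f x = 0" if "x \<notin> K" for x
    using bs that
  proof (induction bs arbitrary: x)
    case (Cons b bs)
    \<comment> \<open>By induction \<open>partials bs f\<close> vanishes on the open complement of
      \<open>K\<close>, hence so does its derivative.\<close>
    have "(partials bs f has_derivative (\<lambda>_. 0)) (at x)"
      by (rule has_derivative_transform_within_open[where f="\<lambda>_. 0" and s="- K"])
        (use Cons K compact_imp_closed[OF K(2)] in \<open>auto simp: open_Compl\<close>)
    then show ?case
      by (simp add: partials_Cons frechet_derivative_at[symmetric])
  qed (simp add: K)
  have cont: "continuous_on UNIV (partials bs f)"
    using K(1) bs by (simp add: smooth_def differentiable_imp_continuous_within continuous_on_eq_continuous_at)
  have "compact ((\<lambda>x. (1 + norm x) ^ N *\<^sub>R partials bs f x) ` K)"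
    by (intro compact_continuous_image K continuous_intros continuous_on_subset[OF cont]) auto
  then have "bounded (insert 0 ((\<lambda>x. (1 + norm x) ^ N *\<^sub>R partials bs f x) ` K))"
    by (simp add: compact_imp_bounded)
  then show "bounded (range (\<lambda>x. (1 + norm x) ^ N *\<^sub>R partials bs f x))"
  proof (rule bounded_subset, safe)
    fix x assume *: "(1 + norm x) ^ N *\<^sub>R partials bs f x \<notin> (\<lambda>x. (1 + norm x) ^ N *\<^sub>R partials bs f x) ` K"
    then have "x \<notin> K" by auto
    then show "(1 + norm x) ^ N *\<^sub>R partials bs f x = 0" by (simp add: zero)
  qed
qed

text \<open>The sequence lists \<open>D 0\<close> together with all its derivatives. Having them
  indexed lets an iterated partial derivative of a tensor product be recorded by its order in each
  coordinate.\<close>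

definition smooth_chain :: "(nat \<Rightarrow> real \<Rightarrow> complex) \<Rightarrow> bool" where
  "smooth_chain D \<longleftrightarrow> (\<forall>n x. (D n has_vector_derivative D (Suc n) x) (at x))"

text \<open>Differentiating along a basis vector \<open>a\<close> maps the product with orders
  \<open>m\<close> to the one with \<open>m a\<close> raised by one, so every iterated partial
  derivative is again such a product and is differentiable.\<close>

lemma smooth_chain_product:
  fixes F :: "'a::euclidean_space \<Rightarrow> nat \<Rightarrow> real \<Rightarrow> complex"
  assumes F: "\<And>b. b \<in> Basis \<Longrightarrow> smooth_chain (F b)"
  shows "smooth (\<lambda>x. \<Prod>b\<in>Basis. F b 0 (x \<bullet> b))"
proof -
  define h where "h m x = (\<Prod>b\<in>Basis. F b (m b) (x \<bullet> b))" for m and x :: 'a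
  have d: "(h m has_derivative (\<lambda>y. \<Sum>i\<in>Basis. ((y \<bullet> i) *\<^sub>R F i (Suc (m i)) (x \<bullet> i)) *
      (\<Prod>j\<in>Basis - {i}. F j (m j) (x \<bullet> j)))) (at x)" for m x
    unfolding h_def
  proof (rule has_derivative_prod)
    fix b :: 'a assume b: "b \<in> Basis"
    have "(F b (m b) has_derivative (\<lambda>t. t *\<^sub>R F b (Suc (m b)) (x \<bullet> b))) (at (x \<bullet> b))"
      using F[OF b] by (simp add: smooth_chain_def has_vector_derivative_def)
    from has_derivative_compose[OF bounded_linear.has_derivative[OF bounded_linear_inner_left has_derivative_ident] this]
    show "((\<lambda>x. F b (m b) (x \<bullet> b)) has_derivative (\<lambda>y. (y \<bullet> b) *\<^sub>R F b (Suc (m b)) (x \<bullet> b))) (at x)" .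
  qed
  have der: "frechet_derivative (h m) (at x) a = h (m(a := Suc (m a))) x" if a: "a \<in> Basis" for m x a
  proof -
    have "frechet_derivative (h m) (at x) a =
       (\<Sum>i\<in>Basis. ((a \<bullet> i) *\<^sub>R F i (Suc (m i)) (x \<bullet> i)) * (\<Prod>j\<in>Basis - {i}. F j (m j) (x \<bullet> j)))"
      by (simp add: frechet_derivative_at[OF d, symmetric])
    also have "\<dots> = (\<Sum>i\<in>Basis. if i = a then F a (Suc (m a)) (x \<bullet> a) * (\<Prod>j\<in>Basis - {a}. F j (m j) (x \<bullet> j)) else 0)"
      using a by (intro sum.cong refl) (auto simp: inner_Basis)
    also have "\<dots> = F a (Suc (m a)) (x \<bullet> a) * (\<Prod>j\<in>Basis - {a}. F j (m j) (x \<bullet> j))"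
      using a by simp
    also have "\<dots> = h (m(a := Suc (m a))) x"
      unfolding h_def using a by (subst (2) prod.remove[of _ a]) auto
    finally show ?thesis .
  qed
  have p: "\<exists>m. partials bs (h (\<lambda>_. 0)) = h m" if "set bs \<subseteq> Basis" for bs
    using that
  proof (induction bs)
    case (Cons b bs)
    then obtain m where m: "partials bs (h (\<lambda>_. 0)) = h m" by auto
    have "partials (b # bs) (h (\<lambda>_. 0)) = h (m(b := Suc (m b)))"
      unfolding partials_Cons m using der[of b m] Cons.prems by auto
    then show ?case by blast
  qed auto
  have "smooth (h (\<lambda>_. 0))"
    unfolding smooth_def
  proof safe
    fix bs :: "'a list" and x assume "set bs \<subseteq> Basis"
    from p[OF this] obtain m where "partials bs (h (\<lambda>_. 0)) = h m" by blast
    then show "partials bs (h (\<lambda>_. 0)) differentiable at x"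
      using d[of m x] by (auto simp: differentiable_def)
  qed
  then show ?thesis
    by (simp add: h_def[abs_def])
qed

section \<open>A smooth bump with integrable Fourier transform\<close>

text \<open>\<open>flat i\<close> is \<open>x\<^sup>-\<^sup>i exp (-1/x)\<close> on the positive axis; these functions are closed under
  differentiation up to linear combinations.\<close>

definition flat :: "nat \<Rightarrow> real \<Rightarrow> real" where
  "flat i x = (if x > 0 then inverse x ^ i * exp (- inverse x) else 0)"

text \<open>This is the difference quotient of \<open>flat i\<close> at 0, the only point where
  differentiability is in doubt. With \<open>y = 1 / x\<close> it becomes
  \<open>y ^ Suc i / exp y\<close> on the right; on the left it is zero.\<close>

lemma flat_div_tendsto: "((\<lambda>x. flat i x / x) \<longlongrightarrow> 0) (at 0)"
proof -
  have "((\<lambda>y::real. y ^ Suc i / exp y) \<longlongrightarrow> 0) at_top"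
    by (rule tendsto_power_div_exp_0)
  then have "((\<lambda>x::real. inverse x ^ Suc i / exp (inverse x)) \<longlongrightarrow> 0) (at_right 0)"
    by (rule filterlim_compose[OF _ filterlim_inverse_at_top_right])
  then have "((\<lambda>x. flat i x / x) \<longlongrightarrow> 0) (at_right 0)"
    by (rule Lim_transform_eventually)
      (auto simp: eventually_at_right_field flat_def exp_minus field_simps intro!: exI[of _ 1])
  moreover have "((\<lambda>x. flat i x / x) \<longlongrightarrow> 0) (at_left 0)"
    by (rule tendsto_eventually) (auto simp: eventually_at_left_field flat_def intro!: exI[of _ "-1"])
  ultimately show ?thesis
    by (simp add: filterlim_at_split)
qed

lemma flat_derivative:
  "(flat i has_real_derivative (- real i * flat (Suc i) x + flat (Suc (Suc i)) x)) (at x)"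
proof -
  consider "x > 0" | "x = 0" | "x < 0" by linarith
  then show ?thesis
  proof cases
    case 1
    have "((\<lambda>x. inverse x ^ i * exp (- inverse x)) has_real_derivative
        (- real i * flat (Suc i) x + flat (Suc (Suc i)) x)) (at x)"
    proof (rule DERIV_cong[OF DERIV_mult])
      show "((\<lambda>x. inverse x ^ i) has_real_derivative real i * (- (inverse x ^ Suc (Suc 0)) * inverse x ^ (i - Suc 0))) (at x)"
        by (rule DERIV_power[OF DERIV_inverse]) (use 1 in simp)
      have "((\<lambda>x. - inverse x) has_real_derivative inverse x ^ Suc (Suc 0)) (at x)"
        using DERIV_minus[OF DERIV_inverse[of x]] 1 by simp
      then show "((\<lambda>x. exp (- inverse x)) has_real_derivative exp (- inverse x) * inverse x ^ Suc (Suc 0)) (at x)"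
        by (rule DERIV_fun_exp)
      show "real i * (- (inverse x ^ Suc (Suc 0)) * inverse x ^ (i - Suc 0)) * exp (- inverse x) +
          exp (- inverse x) * inverse x ^ Suc (Suc 0) * inverse x ^ i = - real i * flat (Suc i) x + flat (Suc (Suc i)) x"
        \<comment> \<open>The exponent \<open>i - Suc 0\<close> is truncated at
          \<open>i = 0\<close>, where the factor \<open>real i\<close> removes the term.\<close>
        using 1 by (cases i) (auto simp: flat_def algebra_simps)
    qed
    then show ?thesis
      by (rule has_field_derivative_transform_within_open[where S="{0<..}"])
        (use 1 in \<open>auto simp: flat_def\<close>)
  next
    case 2
    then show ?thesis
      using flat_div_tendsto[of i] by (simp add: has_field_derivative_iff flat_def[of _ 0])
  next
    case 3
    have "((\<lambda>x. 0) has_real_derivative (- real i * flat (Suc i) x + flat (Suc (Suc i)) x)) (at x)"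
      using 3 by (simp add: flat_def)
    then show ?thesis
      by (rule has_field_derivative_transform_within_open[where S="{..<0}"])
        (use 3 in \<open>auto simp: flat_def\<close>)
  qed
qed

text \<open>Closure under differentiation is the purpose: it yields derivatives of every order for
  the bump without any formula for them. The generators have their flat points at -1 and at
  1.\<close>

inductive_set flat_algebra :: "(real \<Rightarrow> real) set" where
  left: "(\<lambda>x. flat i (1 + x)) \<in> flat_algebra"
| right: "(\<lambda>x. flat i (1 - x)) \<in> flat_algebra"
| add: "f \<in> flat_algebra \<Longrightarrow> g \<in> flat_algebra \<Longrightarrow> (\<lambda>x. f x + g x) \<in> flat_algebra"
| mult: "f \<in> flat_algebra \<Longrightarrow> g \<in> flat_algebra \<Longrightarrow> (\<lambda>x. f x * g x) \<in> flat_algebra"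
| cmult: "f \<in> flat_algebra \<Longrightarrow> (\<lambda>x. c * f x) \<in> flat_algebra"

lemma flat_algebra_derivative:
  "f \<in> flat_algebra \<Longrightarrow> \<exists>f'\<in>flat_algebra. \<forall>x. (f has_real_derivative f' x) (at x)"
proof (induction rule: flat_algebra.induct)
  case (left i)
  have "((\<lambda>x. flat i (1 + x)) has_real_derivative (- real i * flat (Suc i) (1 + x) + flat (Suc (Suc i)) (1 + x)) * 1) (at x)" for x
    by (rule DERIV_chain2[OF flat_derivative]) (auto intro!: derivative_eq_intros)
  then show ?case
    unfolding mult_1_right
    by (intro bexI[of _ "\<lambda>x. - real i * flat (Suc i) (1 + x) + flat (Suc (Suc i)) (1 + x)"])
      (use flat_algebra.add flat_algebra.cmult flat_algebra.left in blast)+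
next
  case (right i)
  have "((\<lambda>x. flat i (1 - x)) has_real_derivative (- real i * flat (Suc i) (1 - x) + flat (Suc (Suc i)) (1 - x)) * (- 1)) (at x)" for x
    by (rule DERIV_chain2[OF flat_derivative]) (auto intro!: derivative_eq_intros)
  then have "((\<lambda>x. flat i (1 - x)) has_real_derivative (- 1) * (- real i * flat (Suc i) (1 - x) + flat (Suc (Suc i)) (1 - x))) (at x)" for x
    by (simp only: mult.commute)
  then show ?case
    by (intro bexI[of _ "\<lambda>x. (- 1) * (- real i * flat (Suc i) (1 - x) + flat (Suc (Suc i)) (1 - x))"])
      (use flat_algebra.add flat_algebra.cmult flat_algebra.right in blast)+
next
  case (add f g)
  then obtain f' g' where "f' \<in> flat_algebra" "g' \<in> flat_algebra"
    "\<forall>x. (f has_real_derivative f' x) (at x)" "\<forall>x. (g has_real_derivative g' x) (at x)" by blast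
  then show ?case
    by (intro bexI[of _ "\<lambda>x. f' x + g' x"]) (auto intro!: derivative_intros flat_algebra.add)
next
  case (mult f g)
  then obtain f' g' where "f' \<in> flat_algebra" "g' \<in> flat_algebra"
    "\<forall>x. (f has_real_derivative f' x) (at x)" "\<forall>x. (g has_real_derivative g' x) (at x)" by blast
  then show ?case
    using mult by (intro bexI[of _ "\<lambda>x. f' x * g x + g' x * f x"])
      (auto intro!: DERIV_mult flat_algebra.add flat_algebra.mult)
next
  case (cmult f c)
  then obtain f' where "f' \<in> flat_algebra" "\<forall>x. (f has_real_derivative f' x) (at x)" by blast
  then show ?case
    by (intro bexI[of _ "\<lambda>x. c * f' x"]) (auto intro!: DERIV_cmult flat_algebra.cmult)
qed

text \<open>Between -1 and 1 this is the classical exp(-2 / (1 - x^2)).\<close>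

definition bump0 :: "real \<Rightarrow> real" where
  "bump0 x = flat 0 (1 + x) * flat 0 (1 - x)"

lemma bump0_nonneg: "0 \<le> bump0 x"
  and bump0_pos: "\<bar>x\<bar> < 1 \<Longrightarrow> 0 < bump0 x"
  and bump0_zero: "1 \<le> \<bar>x\<bar> \<Longrightarrow> bump0 x = 0"
  by (auto simp: bump0_def flat_def)

definition bump_deriv :: "nat \<Rightarrow> real \<Rightarrow> real" where
  "bump_deriv n = (deriv ^^ n) bump0"

lemma bump_deriv_algebra: "bump_deriv n \<in> flat_algebra"
  and bump_deriv_derivative: "(bump_deriv n has_real_derivative bump_deriv (Suc n) x) (at x)"
proof -
  have step: "deriv f \<in> flat_algebra \<and> (f has_real_derivative deriv f x) (at x)" if "f \<in> flat_algebra" for f x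
  proof -
    obtain f' where f': "f' \<in> flat_algebra" "\<And>x. (f has_real_derivative f' x) (at x)"
      using flat_algebra_derivative[OF \<open>f \<in> flat_algebra\<close>] by blast
    then have "deriv f = f'"
      by (auto intro: DERIV_imp_deriv)
    with f' show ?thesis by simp
  qed
  show *: "bump_deriv n \<in> flat_algebra" for n
  proof (induction n)
    case 0
    show ?case
      unfolding bump_deriv_def bump0_def[abs_def] by (auto intro!: flat_algebra.intros)
  next
    case (Suc n)
    then show ?case
      using step by (simp add: bump_deriv_def)
  qed
  show "(bump_deriv n has_real_derivative bump_deriv (Suc n) x) (at x)"
    using step[OF *[of n]] by (simp add: bump_deriv_def)
qed

text \<open>The strict inequality describes an open set, on which vanishing passes from each
  derivative to the next.\<close>

lemma bump_deriv_zero: "1 < \<bar>x\<bar> \<Longrightarrow> bump_deriv n x = 0"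
proof (induction n arbitrary: x)
  case 0
  then show ?case by (simp add: bump_deriv_def bump0_zero)
next
  case (Suc n)
  have "(bump_deriv n has_real_derivative 0) (at x)"
  proof (rule has_field_derivative_transform_within_open[where f="\<lambda>_. 0" and S="- {-1..1}"])
    show "0 = bump_deriv n y" if "y \<in> - {-1..1}" for y
    proof -
      have "1 < \<bar>y\<bar>" using that by auto
      then show ?thesis using Suc.IH by simp
    qed
  qed (use Suc.prems in \<open>auto simp: abs_if split: if_splits\<close>)
  then show ?case
    using bump_deriv_derivative DERIV_unique by blast
qed

lemma continuous_bump_deriv: "continuous_on S (bump_deriv n)"
  by (meson DERIV_isCont bump_deriv_derivative continuous_at_imp_continuous_on)

lemma integrable_bump_deriv: "integrable lborel (bump_deriv n)"
proof -
  have "set_integrable lborel {-1..1} (bump_deriv n)"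
    by (intro borel_integrable_atLeastAtMost' continuous_bump_deriv)
  moreover have "(\<lambda>x. indicator {-1..1} x *\<^sub>R bump_deriv n x) = bump_deriv n"
  proof
    show "indicator {-1..1} x *\<^sub>R bump_deriv n x = bump_deriv n x" for x
      using bump_deriv_zero[of x n] by (cases "1 < \<bar>x\<bar>") (auto simp: indicator_def)
  qed
  ultimately show ?thesis
    unfolding set_integrable_def by simp
qed

lemma integral_bump0_pos: "0 < (LINT x|lborel. bump0 x)"
proof -
  have i: "integrable lborel bump0"
    using integrable_bump_deriv[of 0] by (simp add: bump_deriv_def)
  have "0 \<le> (LINT x|lborel. bump0 x)"
    by (simp add: bump0_nonneg)
  moreover have "(LINT x|lborel. bump0 x) \<noteq> 0"
  proof
    assume "(LINT x|lborel. bump0 x) = 0"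
    then have "AE x in lborel. bump0 x = 0"
      using integral_nonneg_eq_0_iff_AE[OF i] by (simp add: bump0_nonneg)
    then have "AE x in lborel. x \<notin> {-1<..<1::real}"
    proof eventually_elim
      case (elim x)
      then show ?case using bump0_pos[of x] by (auto simp: abs_less_iff)
    qed
    then have "emeasure lborel {-1<..<1::real} = 0"
      by (subst (asm) AE_iff_measurable[of "{-1<..<1}"]) auto
    then show False by simp
  qed
  ultimately show ?thesis by linarith
qed

text \<open>Division by the integral of \<open>bump0\<close> gives total mass 1, so that the tensor
  products built from it are mollifiers with transform bounded by 1.\<close>

definition bump_chain :: "nat \<Rightarrow> real \<Rightarrow> complex" where
  "bump_chain n x = complex_of_real (bump_deriv n x / (LINT x|lborel. bump0 x))"

lemma bump_chain_derivative: "(bump_chain n has_vector_derivative bump_chain (Suc n) x) (at x)"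
  unfolding bump_chain_def[abs_def]
  by (intro has_vector_derivative_of_real DERIV_cdivide bump_deriv_derivative)

lemma bump_chain_zero: "1 < \<bar>x\<bar> \<Longrightarrow> bump_chain n x = 0"
  by (simp add: bump_chain_def bump_deriv_zero)

lemma continuous_bump_chain: "continuous_on S (bump_chain n)"
  unfolding bump_chain_def[abs_def] using integral_bump0_pos
  by (intro continuous_intros continuous_bump_deriv) auto

lemma borel_measurable_bump_chain [measurable]: "bump_chain n \<in> borel_measurable borel"
  by (intro borel_measurable_continuous_onI continuous_bump_chain)

lemma integrable_bump_chain: "integrable lborel (bump_chain n)"
  unfolding bump_chain_def[abs_def] by (intro integrable_of_real integrable_divide integrable_bump_deriv)

lemma bump_chain_0:
  "bump_chain 0 x = complex_of_real (norm (bump_chain 0 x))" "bump_chain 0 0 \<noteq> 0"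
  "(LINT x|lborel. norm (bump_chain 0 x)) = 1"
proof -
  have n: "norm (bump_chain 0 x) = bump0 x / (LINT x|lborel. bump0 x)" for x
    using integral_bump0_pos bump0_nonneg[of x] by (simp add: bump_chain_def bump_deriv_def norm_divide)
  show "bump_chain 0 x = complex_of_real (norm (bump_chain 0 x))"
    unfolding n by (simp add: bump_chain_def bump_deriv_def)
  show "bump_chain 0 0 \<noteq> 0"
    using bump0_pos[of 0] integral_bump0_pos by (simp add: bump_chain_def bump_deriv_def)
  show "(LINT x|lborel. norm (bump_chain 0 x)) = 1"
    unfolding n using integral_bump0_pos by simp
qed

text \<open>Integration by parts; two applications give the quadratic decay of the Fourier transform.\<close>

lemma bump_chain_fourier_Suc:
  "(LINT y|lborel. bump_chain (Suc n) y * unit_char (- (p * y))) =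
     2 * pi * p * \<i> * (LINT y|lborel. bump_chain n y * unit_char (- (p * y)))"
proof -
  let ?F = "\<lambda>y. bump_chain n y * unit_char (- (p * y))"
  let ?f = "\<lambda>y. bump_chain (Suc n) y * unit_char (- (p * y)) - 2 * pi * p * \<i> * ?F y"
  have u: "((\<lambda>y. unit_char (- (p * y))) has_vector_derivative - 2 * pi * p * \<i> * unit_char (- (p * y))) (at y)" for y
  proof -
    let ?c = "- 2 * pi * p * \<i>"
    have "((\<lambda>z. exp (z * ?c)) has_field_derivative ?c * exp (of_real y * ?c)) (at (of_real y))"
      by (auto intro!: derivative_eq_intros)
    from has_vector_derivative_real_field[OF this]
    have "((\<lambda>y. exp (of_real y * ?c)) has_vector_derivative ?c * exp (of_real y * ?c)) (at y)" .
    moreover have eq: "unit_char (- (p * y)) = exp (of_real y * ?c)" for y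
      by (simp add: unit_char_def cis_conv_exp mult_ac)
    ultimately show ?thesis
      by (simp only: eq)
  qed
  have der: "(?F has_vector_derivative ?f y) (at y)" for y
  proof (rule has_vector_derivative_eq_rhs[OF has_vector_derivative_mult[OF bump_chain_derivative[of n y] u[of y]]])
    show "bump_chain n y * (- 2 * pi * p * \<i> * unit_char (- (p * y))) + bump_chain (Suc n) y * unit_char (- (p * y)) = ?f y"
      by simp
  qed
  \<comment> \<open>The interval is larger than the support because \<open>bump_chain_zero\<close>
    says nothing at -1 and 1 themselves; at -2 and 2 the boundary terms vanish.\<close>
  have "(LBINT y. indicator {-2..2} y *\<^sub>R ?f y) = ?F 2 - ?F (- 2)"
  proof (rule integral_FTC_Icc)
    show "(?F has_vector_derivative ?f y) (at y within {-2..2})" for y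
      by (rule has_vector_derivative_at_within[OF der])
    show "continuous_on {-2..2} ?f"
      by (intro continuous_intros continuous_bump_chain)
  qed simp
  also have "\<dots> = 0"
    by (simp add: bump_chain_zero)
  also have "(\<lambda>y. indicator {-2..2} y *\<^sub>R ?f y) = ?f"
  proof
    fix y :: real
    show "indicator {-2..2} y *\<^sub>R ?f y = ?f y"
      using bump_chain_zero[of y n] bump_chain_zero[of y "Suc n"] by (cases "1 < \<bar>y\<bar>") (auto simp: indicator_def)
  qed
  finally have "(LINT y|lborel. ?f y) = 0" .
  moreover have "integrable lborel (\<lambda>y. bump_chain n y * unit_char (- (p * y)))" for n
    by (rule Bochner_Integration.integrable_bound[OF integrable_bump_chain[of n]]) (auto simp: norm_mult)
  ultimately show ?thesis
    by simp
qed

lemma integrable_bump_chain_fourier: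
  "integrable lborel (\<lambda>p. LINT y|lborel. bump_chain 0 y * unit_char (- (p * y)))"
proof -
  let ?I = "\<lambda>n p. LINT y|lborel. bump_chain n y * unit_char (- (p * y))"
  let ?C = "\<lambda>n. LINT y|lborel. norm (bump_chain n y)"
  have C: "norm (?I n p) \<le> ?C n" for n p
    using integral_norm_bound[of lborel "\<lambda>y. bump_chain n y * unit_char (- (p * y))"] by (simp add: norm_mult)
  have le: "norm (?I 0 p) \<le> (?C 0 + ?C 2) * inverse (1 + p\<^sup>2)" for p
  proof -
    have "?I (Suc (Suc 0)) p = (2 * pi * p * \<i>)\<^sup>2 * ?I 0 p"
      unfolding bump_chain_fourier_Suc by (simp only: power2_eq_square mult.assoc)
    then have "?I 2 p = (2 * pi * p * \<i>)\<^sup>2 * ?I 0 p"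
      by (simp only: numeral_2_eq_2[symmetric])
    then have "norm (?I 2 p) = (2 * pi * p)\<^sup>2 * norm (?I 0 p)"
      by (simp add: norm_mult norm_power power_mult_distrib)
    moreover have "p\<^sup>2 \<le> (2 * pi * p)\<^sup>2"
      using mult_right_mono[of 1 "(2 * pi)\<^sup>2" "p\<^sup>2"] pi_gt3 one_le_power[of "2 * pi" 2] by (simp add: power_mult_distrib)
    ultimately have "p\<^sup>2 * norm (?I 0 p) \<le> norm (?I 2 p)"
      by (simp add: mult_right_mono)
    with C[of 0 p] C[of 2 p] have "norm (?I 0 p) * (1 + p\<^sup>2) \<le> ?C 0 + ?C 2"
      by (simp add: algebra_simps)
    then show ?thesis
      by (simp add: divide_inverse[symmetric] pos_le_divide_eq add_pos_nonneg)
  qed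
  have "set_integrable lborel (einterval (- \<infinity>) \<infinity>) (\<lambda>x::real. inverse (1 + x\<^sup>2))"
    by (rule integrable_inverse_1_plus_square)
  then have "integrable lborel (\<lambda>p. (?C 0 + ?C 2) * inverse (1 + p\<^sup>2))"
    by (simp add: set_integrable_def)
  then show ?thesis
    by (rule Bochner_Integration.integrable_bound)
      (auto intro!: le order.trans[OF le abs_ge_self] lborel.borel_measurable_lebesgue_integral)
qed

text \<open>A tensor product rather than a radial bump: its Fourier transform factors, so the
  one-dimensional quadratic decay suffices for integrability in every dimension.\<close>

definition bump :: "'a::euclidean_space \<Rightarrow> complex" where
  "bump x = (\<Prod>b\<in>Basis. bump_chain 0 (x \<bullet> b))"

lemma integrable_bump: "integrable lborel (bump :: 'a::euclidean_space \<Rightarrow> complex)"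
  unfolding bump_def[abs_def] by (intro integrable_lborel_prod integrable_bump_chain)

lemma borel_measurable_bump [measurable]: "bump \<in> borel_measurable borel"
  unfolding bump_def[abs_def] by measurable

lemma integrable_fourier_bump: "integrable lborel (fourier (bump :: 'a::euclidean_space \<Rightarrow> complex))"
proof -
  have "fourier bump t = (\<Prod>b\<in>Basis. LINT y|lborel. bump_chain 0 y * unit_char (- ((t \<bullet> b) * y)))" for t :: 'a
  proof -
    have "bump y * unit_char (- (t \<bullet> y)) = (\<Prod>b\<in>Basis. bump_chain 0 (y \<bullet> b) * unit_char (- ((t \<bullet> b) * (y \<bullet> b))))" for y
      unfolding bump_def prod.distrib by (subst (1) euclidean_inner) (simp flip: unit_char_sum sum_negf)
    then show ?thesis
      unfolding fourier_unit_char
      by (simp, subst integral_lborel_prod)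
        (auto intro: Bochner_Integration.integrable_bound[OF integrable_bump_chain[of 0]] simp: norm_mult)
  qed
  then show ?thesis
    by (simp add: fun_eq_iff integrable_lborel_prod[OF integrable_bump_chain_fourier] cong: Bochner_Integration.integrable_cong)
qed

lemma bump_norm: "bump x = complex_of_real (norm (bump x))"
  unfolding bump_def prod_norm[symmetric] of_real_prod by (intro prod.cong refl bump_chain_0(1))

lemma bump_0: "bump 0 \<noteq> 0"
  by (simp add: bump_def bump_chain_0(2))

lemma integral_norm_bump: "(LINT x::'a::euclidean_space|lborel. norm (bump x)) = 1"
proof -
  have "complex_of_real (LINT x::'a|lborel. norm (bump x)) = (LINT x::'a|lborel. bump x)"
    unfolding integral_complex_of_real[symmetric] bump_norm[symmetric] ..
  also have "\<dots> = 1"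
    unfolding bump_def
  proof (subst integral_lborel_prod)
    have "(LINT x|lborel. bump_chain 0 x) = 1"
      using bump_chain_0(3) by (subst bump_chain_0(1)) simp
    then show "(\<Prod>b\<in>(Basis::'a set). LINT x|lborel. bump_chain 0 x) = 1" by simp
  qed (rule integrable_bump_chain)
  finally show ?thesis
    by (simp only: of_real_eq_1_iff)
qed

text \<open>The support lies in the unit cube, and the norm is at most the sum of the absolute
  coordinates, whence the radius \<open>DIM('a)\<close>.\<close>

lemma bump_zero:
  fixes x :: "'a::euclidean_space"
  assumes "real DIM('a) < norm x"
  shows "bump x = 0"
proof (rule ccontr)
  assume *: "bump x \<noteq> 0"
  have "\<bar>x \<bullet> b\<bar> \<le> 1" if "b \<in> Basis" for b
    using * bump_chain_zero[of "x \<bullet> b" 0] that by (force simp: bump_def)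
  then have "(\<Sum>b\<in>Basis. \<bar>x \<bullet> b\<bar>) \<le> (\<Sum>b\<in>(Basis::'a set). 1)"
    by (intro sum_mono)
  with norm_le_l1[of x] assms show False by simp
qed

lemma smooth_bump_affine:
  fixes a :: "'a::euclidean_space"
  shows "smooth (\<lambda>x. bump (r *\<^sub>R (x - a)))"
proof -
  let ?F = "\<lambda>b n y. complex_of_real (r ^ n) * bump_chain n (r * (y - a \<bullet> b))"
  have "smooth_chain (?F b)" for b
    unfolding smooth_chain_def
  proof safe
    fix n y
    have d: "((\<lambda>y. r * (y - a \<bullet> b)) has_vector_derivative r) (at y)"
      by (auto intro!: derivative_eq_intros simp: has_real_derivative_iff_has_vector_derivative[symmetric])
    show "(?F b n has_vector_derivative ?F b (Suc n) y) (at y)"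
      using has_vector_derivative_mult_right[OF vector_diff_chain_at[OF d bump_chain_derivative[of n]], of "complex_of_real (r ^ n)"]
      by (simp add: o_def scaleR_conv_of_real mult_ac)
  qed
  then have "smooth (\<lambda>x. \<Prod>b\<in>Basis. ?F b 0 (x \<bullet> b))"
    by (intro smooth_chain_product) auto
  then show ?thesis
    by (simp add: bump_def inner_diff_left)
qed

lemma test_function_bump_affine:
  fixes a :: "'a::euclidean_space"
  assumes r: "r > 0" and sub: "cball a (real DIM('a) / r) \<subseteq> U"
  shows "(\<lambda>x. bump (r *\<^sub>R (x - a))) \<in> test_functions U"
proof (rule test_functionsI[OF smooth_bump_affine compact_cball sub])
  fix x assume "x \<notin> cball a (real DIM('a) / r)"
  show "bump (r *\<^sub>R (x - a)) = 0"
  proof (rule bump_zero)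
    have "real DIM('a) / r < norm (x - a)"
      using \<open>x \<notin> _\<close> by (simp add: dist_norm norm_minus_commute)
    then show "real DIM('a) < norm (r *\<^sub>R (x - a))"
      using r unfolding norm_scaleR by (simp add: field_simps)
  qed
qed

lemma fourier_bump_affine:
  fixes a :: "'a::euclidean_space"
  assumes r: "r > 0"
  shows "fourier (\<lambda>x. bump (r *\<^sub>R (x - a))) t =
    complex_of_real (inverse r ^ DIM('a)) * unit_char (- (t \<bullet> a)) * fourier bump (inverse r *\<^sub>R t)"
proof -
  have "integrable lborel (\<lambda>x. bump (- (r *\<^sub>R a) + r *\<^sub>R x))"
    by (rule integrable_lborel_affine[OF _ integrable_bump]) (use r in auto)
  then have i: "integrable lborel (\<lambda>x. bump (r *\<^sub>R (x - a)) * unit_char (- (t \<bullet> x)))"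
    by (rule Bochner_Integration.integrable_bound) (auto simp: norm_mult scaleR_diff_right)
  have "fourier (\<lambda>x. bump (r *\<^sub>R (x - a))) t = \<bar>inverse r\<bar> ^ DIM('a) *\<^sub>R
     (LINT w|lborel. bump (r *\<^sub>R (a + inverse r *\<^sub>R w - a)) * unit_char (- (t \<bullet> (a + inverse r *\<^sub>R w))))"
    unfolding fourier_unit_char by (rule integral_lborel_affine[OF _ i]) (use r in auto)
  also have "(LINT w|lborel. bump (r *\<^sub>R (a + inverse r *\<^sub>R w - a)) * unit_char (- (t \<bullet> (a + inverse r *\<^sub>R w)))) =
     (LINT w|lborel. unit_char (- (t \<bullet> a)) * (bump w * unit_char (- ((inverse r *\<^sub>R t) \<bullet> w))))"
    using r by (intro Bochner_Integration.integral_cong refl)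
      (simp add: inner_add_right unit_char_diff[of "- (t \<bullet> a)"] mult_ac)
  also have "\<dots> = unit_char (- (t \<bullet> a)) * fourier bump (inverse r *\<^sub>R t)"
    by (simp add: fourier_unit_char)
  finally show ?thesis
    using r by (simp add: scaleR_conv_of_real mult_ac)
qed

section \<open>Mollification and the Plancherel inequality\<close>

text \<open>The average of \<open>g\<close> against the bump of scale \<open>1 / s\<close> centred
  at \<open>x\<close>, written after the substitution \<open>z = x + w / s\<close> so that the
  kernel does not depend on \<open>s\<close>.\<close>

definition mollify :: "real \<Rightarrow> ('a::euclidean_space \<Rightarrow> complex) \<Rightarrow> 'a \<Rightarrow> complex" where
  "mollify s g x = (LINT w|lborel. g (x + inverse s *\<^sub>R w) * bump w)"

lemma bump_L2: "bump \<in> L2"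
proof (rule L2_bounded_integrable[OF integrable_bump])
  fix x :: 'a
  have "(\<lambda>x::'a. bump (1 *\<^sub>R (x - 0))) \<in> test_functions UNIV"
    by (intro test_function_bump_affine) auto
  then have "(bump :: 'a \<Rightarrow> complex) \<in> schwartz"
    by (intro test_functions_schwartz) simp
  then show "norm (bump x) \<le> schwartz_seminorm 0 (bump :: 'a \<Rightarrow> complex)"
    by (rule schwartz_bounded)
qed

lemma L2_affine:
  fixes g :: "'a::euclidean_space \<Rightarrow> complex"
  assumes "g \<in> L2" "c \<noteq> 0"
  shows "(\<lambda>w. g (x + c *\<^sub>R w)) \<in> L2"
proof -
  have [measurable]: "g \<in> borel_measurable borel"
    using assms by (simp add: L2_def)
  show ?thesis
    using assms by (auto simp: L2_def intro: integrable_lborel_affine[of c "\<lambda>w. (norm (g w))\<^sup>2"])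
qed

lemma mollify_integrable:
  assumes "g \<in> L2" "s > 0"
  shows "integrable lborel (\<lambda>w. g (x + inverse s *\<^sub>R w) * bump w)"
  using assms by (intro L2_mult_integrable bump_L2 L2_affine) auto

lemma borel_measurable_mollify [measurable]:
  assumes [measurable]: "g \<in> borel_measurable borel"
  shows "mollify s g \<in> borel_measurable borel"
  unfolding mollify_def[abs_def] by (rule lborel.borel_measurable_lebesgue_integral) measurable

text \<open>Mollification of \<open>g\<close> corresponds to a bounded multiplier on \<open>f\<close>.\<close>

lemma L2_fourier_mollify:
  fixes f g :: "'a::euclidean_space \<Rightarrow> complex"
  assumes fg: "L2_fourier f g" and s: "s > 0"
  shows "fourier (\<lambda>t. f t * fourier bump (inverse s *\<^sub>R t)) x = mollify s g x"
proof -
  \<comment> \<open>This is the mollification kernel at \<open>x\<close>. It is a Schwartz function,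
    so the weak relation between \<open>f\<close> and \<open>g\<close> may be tested on it, and its
    transform is the multiplier times a character.\<close>
  let ?h = "\<lambda>z. complex_of_real (s ^ DIM('a)) * bump (s *\<^sub>R (z - x))"
  have f: "f \<in> L2" and g: "g \<in> L2"
    using fg by (auto simp: L2_fourier_def)
  have h: "?h \<in> schwartz"
    by (intro test_functions_schwartz[of _ UNIV] test_functions_cmult test_function_bump_affine) (use s in auto)
  have ft: "fourier ?h t = unit_char (- (x \<bullet> t)) * fourier bump (inverse s *\<^sub>R t)" for t
  proof -
    have "fourier ?h t = complex_of_real (s ^ DIM('a)) * fourier (\<lambda>z. bump (s *\<^sub>R (z - x))) t"
      by (simp add: fourier_unit_char mult.assoc)
    then show ?thesis
      using s by (simp add: fourier_bump_affine[OF s] inner_commute power_inverse)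
  qed
  have "fourier (\<lambda>t. f t * fourier bump (inverse s *\<^sub>R t)) x = function_distribution f (fourier ?h)"
    unfolding ft function_distribution_def fourier_unit_char
    by (intro Bochner_Integration.integral_cong refl) (simp add: mult_ac)
  also have "\<dots> = function_distribution g ?h"
    using fg h unfolding L2_fourier_def fourier_distribution_def by blast
  also have "\<dots> = (LINT z|lborel. g z * ?h z)"
    by (simp add: function_distribution_def)
  also have "\<dots> = \<bar>inverse s\<bar> ^ DIM('a) *\<^sub>R (LINT w|lborel. g (x + inverse s *\<^sub>R w) * ?h (x + inverse s *\<^sub>R w))"
    by (rule integral_lborel_affine) (use s g h schwartz_L2 in \<open>auto intro!: L2_mult_integrable\<close>)
  also have "\<dots> = mollify s g x"
    using s unfolding mollify_def integral_scaleR_right[symmetric]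
    by (intro Bochner_Integration.integral_cong refl) (simp add: scaleR_conv_of_real power_inverse)
  finally show ?thesis .
qed

text \<open>The multiplier is square-integrable, which makes its product with \<open>f\<close>
  integrable and \<open>nn_integral_fourier_le\<close> applicable. It is bounded by 1 because the
  bump has mass 1, so the estimate is uniform in \<open>s\<close>.\<close>

lemma mollify_L2:
  fixes f g :: "'a::euclidean_space \<Rightarrow> complex"
  assumes fg: "L2_fourier f g" and s: "s > 0"
  shows "(\<integral>\<^sup>+x. (norm (mollify s g x))\<^sup>2 \<partial>lborel) \<le> (\<integral>\<^sup>+x. (norm (f x))\<^sup>2 \<partial>lborel)"
proof -
  have f: "f \<in> L2"
    using fg by (auto simp: L2_fourier_def)
  have le1: "norm (fourier bump t) \<le> 1" for t :: 'a
    using norm_fourier_le[of bump t] by (simp add: integral_norm_bump)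
  have "(\<lambda>t::'a. fourier bump (0 + inverse s *\<^sub>R t)) \<in> L2"
    by (intro L2_affine L2_bounded_integrable[OF integrable_fourier_bump le1]) (use s in auto)
  then have i: "integrable lborel (\<lambda>t. f t * fourier bump (inverse s *\<^sub>R t))"
    using f by (intro L2_mult_integrable) auto
  have "(\<integral>\<^sup>+x. (norm (mollify s g x))\<^sup>2 \<partial>lborel) \<le> (\<integral>\<^sup>+t. (norm (f t * fourier bump (inverse s *\<^sub>R t)))\<^sup>2 \<partial>lborel)"
    using nn_integral_fourier_le[OF i] unfolding L2_fourier_mollify[OF fg s] .
  also have "\<dots> \<le> (\<integral>\<^sup>+x. (norm (f x))\<^sup>2 \<partial>lborel)"
    by (intro nn_integral_mono ennreal_leI power_mono) (auto simp: norm_mult intro!: mult_left_le le1)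
  finally show ?thesis .
qed

lemma bump_1: "(LINT w|lborel. bump w) = 1"
proof -
  have "(LINT w::'a|lborel. bump w) = complex_of_real (LINT w::'a|lborel. norm (bump w))"
    unfolding integral_complex_of_real[symmetric] bump_norm[symmetric] ..
  then show ?thesis by (simp add: integral_norm_bump)
qed

text \<open>A bounded continuous \<open>u\<close> close to \<open>g\<close> in L1 splits the error
  into \<open>g - u\<close> at the shifted point (\<open>?T1\<close>), the oscillation of
  \<open>u\<close> (\<open>?T2\<close>) and \<open>g - u\<close> at the centre (\<open>?T3\<close>);
  each contributes at most a third of \<open>e\<close>.\<close>

lemma mollify_L1_ball:
  fixes g :: "'a::euclidean_space \<Rightarrow> complex"
  assumes g: "g \<in> L2" and e: "e > 0"
  shows "\<forall>\<^sub>F n in sequentially.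
    (\<integral>\<^sup>+x. indicator (ball 0 R) x * ennreal (norm (mollify (real (Suc n)) g x - g x)) \<partial>lborel) \<le> ennreal e"
proof -
  have [measurable]: "g \<in> borel_measurable borel"
    using g by (simp add: L2_def)
  \<comment> \<open>The support radius of the bump. For \<open>s \<ge> 1\<close> the shifts by
    \<open>inverse s *\<^sub>R w\<close> have length at most \<open>\<rho>\<close>, so approximating
    \<open>g\<close> on the ball enlarged by \<open>\<rho>\<close> covers every shifted
    point.\<close>
  define \<rho> where "\<rho> = real DIM('a)"
  let ?B = "ball (0::'a) R" and ?B' = "ball (0::'a) (R + \<rho>)"
  have [measurable]: "?B \<in> sets borel" "?B' \<in> sets borel"
    by auto
  have \<rho>: "\<rho> > 0" by (simp add: \<rho>_def)
  have fin: "emeasure lborel ?B' < \<infinity>"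
    by (rule emeasure_lborel_ball_finite)
  have "integrable lborel (indicator ?B' :: 'a \<Rightarrow> real)"
    by (rule integrable_real_indicator[OF _ fin]) simp
  then have "integrable lborel (\<lambda>x. indicator ?B' x :: complex)"
    by (rule Bochner_Integration.integrable_bound) (auto simp: indicator_def)
  then have "(\<lambda>x. indicator ?B' x :: complex) \<in> L2"
    by (rule L2_bounded_integrable[of _ 1]) (auto simp: indicator_def)
  then have i1: "integrable lborel (\<lambda>x. indicator ?B' x * g x)"
    using g by (rule L2_mult_integrable)
  obtain u M where u: "continuous_on UNIV u" "\<And>x. norm (u x) \<le> M"
      and lt: "(LINT x|lborel. indicator ?B' x * norm (indicator ?B' x * g x - u x)) < e / 3"
    using continuous_L1_approx[OF i1 _ _ fin, of "e / 3"] e by auto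
  have [measurable]: "u \<in> borel_measurable borel"
    using u(1) by (rule borel_measurable_continuous_onI)
  have "integrable lborel (\<lambda>x. norm (indicator ?B' x * g x) + indicator ?B' x * M)"
    using i1 fin by (intro Bochner_Integration.integrable_add integrable_norm integrable_mult_left integrable_real_indicator) auto
  then have "integrable lborel (\<lambda>x. indicator ?B' x * norm (indicator ?B' x * g x - u x))"
    by (rule Bochner_Integration.integrable_bound)
      (auto simp: indicator_def intro!: order.trans[OF norm_triangle_ineq4] order.trans[OF _ abs_ge_self] u(2))
  then have A: "(\<integral>\<^sup>+x. indicator ?B' x * ennreal (norm (g x - u x)) \<partial>lborel) \<le> ennreal (e / 3)"
  proof -
    assume "integrable lborel (\<lambda>x. indicator ?B' x * norm (indicator ?B' x * g x - u x))"
    then have "(\<integral>\<^sup>+x. ennreal (indicator ?B' x * norm (indicator ?B' x * g x - u x)) \<partial>lborel) \<le> ennreal (e / 3)"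
      using lt by (subst nn_integral_eq_integral) (auto intro: ennreal_leI)
    also have "(\<integral>\<^sup>+x. ennreal (indicator ?B' x * norm (indicator ?B' x * g x - u x)) \<partial>lborel) =
        (\<integral>\<^sup>+x. indicator ?B' x * ennreal (norm (g x - u x)) \<partial>lborel)"
      by (intro nn_integral_cong) (auto simp: indicator_def)
    finally show ?thesis .
  qed
  define m where "m = measure lborel ?B"
  \<comment> \<open>The summand 1 keeps the denominator positive when the ball is empty.\<close>
  define \<eta> where "\<eta> = e / (3 * (m + 1))"
  have \<eta>: "\<eta> > 0" "\<eta> * m \<le> e / 3"
  proof -
    have "m \<ge> 0" by (simp add: m_def)
    then show "\<eta> > 0" "\<eta> * m \<le> e / 3"
      using e unfolding \<eta>_def by (auto simp: field_simps)
  qed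
  have "uniformly_continuous_on (cball 0 (R + \<rho>)) u"
    by (intro compact_uniformly_continuous continuous_on_subset[OF u(1)]) auto
  then obtain d where d: "d > 0" "\<And>x y. x \<in> cball 0 (R + \<rho>) \<Longrightarrow> y \<in> cball 0 (R + \<rho>) \<Longrightarrow> dist y x < d \<Longrightarrow> dist (u y) (u x) < \<eta>"
    unfolding uniformly_continuous_on_def using \<eta>(1) by metis
  obtain N :: nat where N: "\<rho> / d < real N"
    using reals_Archimedean2 by blast
  show ?thesis
  proof (rule eventually_sequentiallyI[of N])
    fix n assume "n \<ge> N"
    define s where "s = real (Suc n)"
    have s: "s \<ge> 1" by (simp add: s_def)
    have "\<rho> / d < s"
      using N \<open>n \<ge> N\<close> by (simp add: s_def)
    then have sd: "inverse s * \<rho> < d"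
      using s d(1) by (simp add: field_simps)
    have near: "norm (inverse s *\<^sub>R w) \<le> \<rho>" "norm (inverse s *\<^sub>R w) < d" if "bump w \<noteq> 0" for w :: 'a
    proof -
      have "norm w \<le> \<rho>"
        using bump_zero[of w] that by (force simp: \<rho>_def)
      then have "inverse s * norm w \<le> inverse s * \<rho>"
        using s by (intro mult_left_mono) auto
      moreover have "inverse s * \<rho> \<le> 1 * \<rho>"
        using s \<rho> by (intro mult_right_mono) (auto simp: inverse_le_1_iff)
      moreover have "norm (inverse s *\<^sub>R w) = inverse s * norm w"
        using s by simp
      ultimately show "norm (inverse s *\<^sub>R w) \<le> \<rho>" "norm (inverse s *\<^sub>R w) < d"
        using sd by linarith+
    qed
    let ?b = "\<lambda>w::'a. ennreal (norm (bump w))"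
    have b1: "(\<integral>\<^sup>+w. ?b w \<partial>lborel) = 1"
      using integrable_bump integral_norm_bump[where 'a='a] by (subst nn_integral_eq_integral) auto
    let ?T1 = "\<lambda>x w. indicator ?B x * ennreal (norm (g (x + inverse s *\<^sub>R w) - u (x + inverse s *\<^sub>R w))) * ?b w"
    let ?T3 = "\<lambda>x w. indicator ?B x * ennreal (norm (g x - u x)) * ?b w"
    let ?T2 = "\<lambda>x w. indicator ?B x * ennreal \<eta> * ?b w"
    have "indicator ?B x * ennreal (norm (mollify s g x - g x)) \<le> (\<integral>\<^sup>+w. ?T1 x w + ?T2 x w + ?T3 x w \<partial>lborel)" for x
    proof -
      have int: "integrable lborel (\<lambda>w. g (x + inverse s *\<^sub>R w) * bump w)"
        by (rule mollify_integrable[OF g]) (use s in auto)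
      have "mollify s g x - g x = (LINT w|lborel. g (x + inverse s *\<^sub>R w) * bump w - g x * bump w)"
        by (subst Bochner_Integration.integral_diff)
          (use int integrable_bump in \<open>auto simp: mollify_def bump_1\<close>)
      also have "ennreal (norm \<dots>) \<le> (\<integral>\<^sup>+w. norm (g (x + inverse s *\<^sub>R w) * bump w - g x * bump w) \<partial>lborel)"
        by (intro integral_norm_bound_ennreal Bochner_Integration.integrable_diff int) (auto intro: integrable_bump)
      finally have "indicator ?B x * ennreal (norm (mollify s g x - g x)) \<le>
          indicator ?B x * (\<integral>\<^sup>+w. norm (g (x + inverse s *\<^sub>R w) * bump w - g x * bump w) \<partial>lborel)"
        by (rule mult_left_mono) simp
      also have "\<dots> = (\<integral>\<^sup>+w. indicator ?B x * ennreal (norm (g (x + inverse s *\<^sub>R w) * bump w - g x * bump w)) \<partial>lborel)"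
        by (cases "x \<in> ?B") auto
      also have "\<dots> \<le> (\<integral>\<^sup>+w. ?T1 x w + ?T2 x w + ?T3 x w \<partial>lborel)"
      proof (intro nn_integral_mono)
        fix w
        show "indicator ?B x * ennreal (norm (g (x + inverse s *\<^sub>R w) * bump w - g x * bump w)) \<le> ?T1 x w + ?T2 x w + ?T3 x w"
        proof (cases "x \<in> ?B \<and> bump w \<noteq> 0")
          case True
          let ?y = "x + inverse s *\<^sub>R w"
          have "norm x < R"
            using True by simp
          with near[of w] True norm_triangle_ineq[of x "inverse s *\<^sub>R w"] \<rho>
          have "norm ?y \<le> R + \<rho>" "norm x \<le> R + \<rho>" "norm (inverse s *\<^sub>R w) < d"
            by linarith+
          then have "?y \<in> cball 0 (R + \<rho>)" "x \<in> cball 0 (R + \<rho>)" "dist ?y x < d"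
            by (simp_all only: mem_cball_0 dist_norm add_diff_cancel_left')
          then have "norm (u ?y - u x) \<le> \<eta>"
            using d(2)[of x ?y] by (simp add: dist_norm)
          moreover have "norm (g ?y - g x) \<le> norm (g ?y - u ?y) + norm (u ?y - u x) + norm (g x - u x)"
            using norm_triangle_ineq[of "g ?y - u ?y" "u ?y - u x"] norm_triangle_ineq4[of "g ?y - u x" "g x - u x"] by simp
          ultimately have "norm (g ?y - g x) \<le> norm (g ?y - u ?y) + \<eta> + norm (g x - u x)"
            by linarith
          then have "norm (g ?y - g x) * norm (bump w) \<le> (norm (g ?y - u ?y) + \<eta> + norm (g x - u x)) * norm (bump w)"
            by (rule mult_right_mono) simp
          then have "ennreal (norm (g ?y - g x) * norm (bump w)) \<le> ennreal ((norm (g ?y - u ?y) + \<eta> + norm (g x - u x)) * norm (bump w))"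
            by (rule ennreal_leI)
          also have "\<dots> = ?T1 x w + ?T2 x w + ?T3 x w"
            using \<eta> True by (simp add: ennreal_mult ennreal_plus distrib_right)
          finally show ?thesis
            using True by (simp add: norm_mult flip: left_diff_distrib)
        qed auto
      qed
      finally show ?thesis .
    qed
    then have "(\<integral>\<^sup>+x. indicator ?B x * ennreal (norm (mollify s g x - g x)) \<partial>lborel) \<le>
       (\<integral>\<^sup>+x. \<integral>\<^sup>+w. ?T1 x w + ?T2 x w + ?T3 x w \<partial>lborel \<partial>lborel)"
      by (intro nn_integral_mono)
    also have "\<dots> = (\<integral>\<^sup>+x. \<integral>\<^sup>+w. ?T1 x w \<partial>lborel \<partial>lborel) + (\<integral>\<^sup>+x. \<integral>\<^sup>+w. ?T2 x w \<partial>lborel \<partial>lborel) + (\<integral>\<^sup>+x. \<integral>\<^sup>+w. ?T3 x w \<partial>lborel \<partial>lborel)"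
    proof -
      have [measurable]: "(\<lambda>x. \<integral>\<^sup>+w. ?T1 x w \<partial>lborel) \<in> borel_measurable lborel"
        "(\<lambda>x. \<integral>\<^sup>+w. ?T2 x w \<partial>lborel) \<in> borel_measurable lborel"
        "(\<lambda>x. \<integral>\<^sup>+w. ?T3 x w \<partial>lborel) \<in> borel_measurable lborel"
        by (rule lborel.borel_measurable_nn_integral, measurable)+
      have "(\<integral>\<^sup>+w. ?T1 x w + ?T2 x w + ?T3 x w \<partial>lborel) =
          (\<integral>\<^sup>+w. ?T1 x w \<partial>lborel) + (\<integral>\<^sup>+w. ?T2 x w \<partial>lborel) + (\<integral>\<^sup>+w. ?T3 x w \<partial>lborel)" for x
        by (simp add: nn_integral_add)
      then show ?thesis
        by (simp only:) (subst nn_integral_add; (subst nn_integral_add)?; measurable)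
    qed
    \<comment> \<open>After exchanging the integrals, \<open>w\<close> is fixed and the shift is a
      translation carrying the small ball into the larger one, where the approximation bound
      \<open>A\<close> holds.\<close>
    also have "(\<integral>\<^sup>+x. \<integral>\<^sup>+w. ?T1 x w \<partial>lborel \<partial>lborel) \<le> ennreal (e / 3)"
    proof -
      have "(\<integral>\<^sup>+x. \<integral>\<^sup>+w. ?T1 x w \<partial>lborel \<partial>lborel) = (\<integral>\<^sup>+w. \<integral>\<^sup>+x. ?T1 x w \<partial>lborel \<partial>lborel)"
        by (rule lborel_pair.Fubini'[symmetric]) measurable
      also have "\<dots> \<le> (\<integral>\<^sup>+w. ennreal (e / 3) * ?b w \<partial>lborel)"
      proof (intro nn_integral_mono)
        fix w :: 'a
        show "(\<integral>\<^sup>+x. ?T1 x w \<partial>lborel) \<le> ennreal (e / 3) * ?b w"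
        proof (cases "bump w = 0")
          case False
          have "(\<integral>\<^sup>+x. ?T1 x w \<partial>lborel) \<le> (\<integral>\<^sup>+x. (indicator ?B' (inverse s *\<^sub>R w + 1 *\<^sub>R x) * ennreal (norm (g (inverse s *\<^sub>R w + 1 *\<^sub>R x) - u (inverse s *\<^sub>R w + 1 *\<^sub>R x)))) * ?b w \<partial>lborel)"
            using near(1)[OF False] norm_triangle_ineq[of _ "inverse s *\<^sub>R w"]
            by (intro nn_integral_mono) (fastforce simp: indicator_def add.commute intro: order.strict_trans1)
          also have "\<dots> = (\<integral>\<^sup>+x. indicator ?B' x * ennreal (norm (g x - u x)) \<partial>lborel) * ?b w"
            by (subst nn_integral_multc, simp, subst nn_integral_lborel_affine[of _ 1 "inverse s *\<^sub>R w"]) (auto simp: ennreal_mult ennreal_indicator)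
          also have "\<dots> \<le> ennreal (e / 3) * ?b w"
            by (intro mult_right_mono A) simp
          finally show ?thesis .
        qed simp
      qed
      also have "\<dots> = ennreal (e / 3)"
        by (simp add: nn_integral_cmult b1)
      finally show ?thesis .
    qed
    also have "(\<integral>\<^sup>+x. \<integral>\<^sup>+w. ?T2 x w \<partial>lborel \<partial>lborel) \<le> ennreal (e / 3)"
    proof -
      have "(\<integral>\<^sup>+x. \<integral>\<^sup>+w. ?T2 x w \<partial>lborel \<partial>lborel) = ennreal \<eta> * emeasure lborel ?B"
        by (simp add: nn_integral_cmult b1 nn_integral_multc mult.commute)
      also have "emeasure lborel ?B = ennreal m"
        unfolding m_def using emeasure_lborel_ball_finite[of "0::'a" R] by (simp add: emeasure_eq_ennreal_measure)
      also have "ennreal \<eta> * ennreal m \<le> ennreal (e / 3)"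
        using \<eta> by (simp add: m_def ennreal_leI flip: ennreal_mult)
      finally show ?thesis .
    qed
    also have "(\<integral>\<^sup>+x. \<integral>\<^sup>+w. ?T3 x w \<partial>lborel \<partial>lborel) \<le> ennreal (e / 3)"
    proof -
      have "(\<integral>\<^sup>+x. \<integral>\<^sup>+w. ?T3 x w \<partial>lborel \<partial>lborel) = (\<integral>\<^sup>+x. indicator ?B x * ennreal (norm (g x - u x)) \<partial>lborel)"
        by (simp add: nn_integral_cmult b1 ennreal_mult ennreal_indicator)
      also have "\<dots> \<le> (\<integral>\<^sup>+x. indicator ?B' x * ennreal (norm (g x - u x)) \<partial>lborel)"
        using \<rho> by (intro nn_integral_mono) (auto simp: indicator_def)
      finally show ?thesis using A by simp
    qed
    finally have "(\<integral>\<^sup>+x. indicator ?B x * ennreal (norm (mollify s g x - g x)) \<partial>lborel) \<le> ennreal (e / 3) + ennreal (e / 3) + ennreal (e / 3)"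
      by (simp add: add_mono)
    also have "\<dots> = ennreal e"
      using e by (simp flip: ennreal_plus)
    finally show "(\<integral>\<^sup>+x. indicator ?B x * ennreal (norm (mollify (real (Suc n)) g x - g x)) \<partial>lborel) \<le> ennreal e"
      unfolding s_def .
  qed
qed

text \<open>On a ball the mollifications converge to \<open>g\<close> in L1, hence almost everywhere
  along a subsequence. Fatou's lemma carries the uniform bound \<open>mollify_L2\<close> over to
  \<open>g\<close>.\<close>

lemma nn_integral_L2_fourier_ball_le:
  fixes f g :: "'a::euclidean_space \<Rightarrow> complex"
  assumes fg: "L2_fourier f g"
  shows "(\<integral>\<^sup>+x. indicator (ball 0 R) x * ennreal ((norm (g x))\<^sup>2) \<partial>lborel) \<le> (\<integral>\<^sup>+x. (norm (f x))\<^sup>2 \<partial>lborel)"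
proof -
  have f: "f \<in> L2" and g: "g \<in> L2"
    using fg by (auto simp: L2_fourier_def)
  have [measurable]: "g \<in> borel_measurable borel"
    using g by (simp add: L2_def)
  let ?B = "ball (0::'a) R"
  let ?m = "\<lambda>n. mollify (real (Suc n)) g"
  let ?u = "\<lambda>n x. complex_of_real (indicator ?B x) * (?m n x - g x)"
  have B: "integrable lborel (indicator ?B :: 'a \<Rightarrow> real)"
    by (rule integrable_real_indicator[OF _ emeasure_lborel_ball_finite]) simp
  have "(\<lambda>x. complex_of_real (indicator ?B x)) \<in> L2"
    by (rule L2_bounded_integrable[OF integrable_of_real[OF B], of 1]) (auto simp: indicator_def)
  moreover have "?m n \<in> L2" for n
    using mollify_L2[OF fg, of "real (Suc n)"] nn_integral_L2_norm[OF f]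
    by (auto simp: L2_iff_nn_integral intro: order.strict_trans1)
  ultimately have u: "integrable lborel (?u n)" for n
    using L2_add[OF _ L2_cmult[OF g, of "- 1"]] by (intro L2_mult_integrable) (auto simp: diff_conv_add_uminus simp del: add_uminus_conv_diff)
  have "(\<lambda>n. LINT x|lborel. norm (?u n x)) \<longlonglongrightarrow> 0"
  proof (rule LIMSEQ_I)
    fix r :: real assume r: "r > 0"
    have "\<forall>\<^sub>F n in sequentially. (\<integral>\<^sup>+x. indicator ?B x * ennreal (norm (?m n x - g x)) \<partial>lborel) \<le> ennreal (r / 2)"
      using r by (intro mollify_L1_ball[OF g]) simp
    then have "\<forall>\<^sub>F n in sequentially. norm ((LINT x|lborel. norm (?u n x)) - 0) < r"
    proof eventually_elim
      fix n
      assume *: "(\<integral>\<^sup>+x. indicator ?B x * ennreal (norm (?m n x - g x)) \<partial>lborel) \<le> ennreal (r / 2)"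
      have "ennreal (LINT x|lborel. norm (?u n x)) = (\<integral>\<^sup>+x. norm (?u n x) \<partial>lborel)"
        using u[of n] by (intro nn_integral_eq_integral[symmetric]) auto
      also have "\<dots> = (\<integral>\<^sup>+x. indicator ?B x * ennreal (norm (?m n x - g x)) \<partial>lborel)"
        by (intro nn_integral_cong) (auto simp: indicator_def)
      also have "\<dots> \<le> ennreal (r / 2)"
        by (rule *)
      finally have "(LINT x|lborel. norm (?u n x)) \<le> r / 2"
        using r by (subst (asm) ennreal_le_iff) auto
      then show "norm ((LINT x|lborel. norm (?u n x)) - 0) < r"
        using r by simp
    qed
    then show "\<exists>N. \<forall>n\<ge>N. norm ((LINT x|lborel. norm (?u n x)) - 0) < r"
      by (simp add: eventually_sequentially)
  qed
  from tendsto_L1_AE_subseq[OF u this] obtain k where k: "strict_mono k"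
      and ae: "AE x in lborel. (\<lambda>n. ?u (k n) x) \<longlonglongrightarrow> 0"
    by auto
  have "(\<integral>\<^sup>+x. indicator ?B x * ennreal ((norm (g x))\<^sup>2) \<partial>lborel) \<le>
      (\<integral>\<^sup>+x. liminf (\<lambda>n. ennreal ((norm (?m (k n) x))\<^sup>2)) \<partial>lborel)"
  proof (rule nn_integral_mono_AE, use ae in eventually_elim)
    fix x assume lim: "(\<lambda>n. ?u (k n) x) \<longlonglongrightarrow> 0"
    show "indicator ?B x * ennreal ((norm (g x))\<^sup>2) \<le> liminf (\<lambda>n. ennreal ((norm (?m (k n) x))\<^sup>2))"
    proof (cases "x \<in> ?B")
      case True
      then have "(\<lambda>n. ?m (k n) x) \<longlonglongrightarrow> g x"
        using lim by (simp add: LIM_zero_iff del: of_nat_Suc)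
      then have "(\<lambda>n. ennreal ((norm (?m (k n) x))\<^sup>2)) \<longlonglongrightarrow> ennreal ((norm (g x))\<^sup>2)"
        by (intro tendsto_ennrealI tendsto_intros)
      from lim_imp_Liminf[OF trivial_limit_sequentially this] True show ?thesis
        by simp
    qed simp
  qed
  also have "\<dots> \<le> liminf (\<lambda>n. \<integral>\<^sup>+x. ennreal ((norm (?m (k n) x))\<^sup>2) \<partial>lborel)"
    by (rule nn_integral_liminf) measurable
  also have "\<dots> \<le> (\<integral>\<^sup>+x. (norm (f x))\<^sup>2 \<partial>lborel)"
    by (intro Liminf_le always_eventually allI mollify_L2[OF fg]) auto
  finally show ?thesis .
qed

text \<open>Exhaustion by balls. This inequality yields both the uniqueness of the weak transform
  and the bound for the operator constructed later.\<close>

lemma L2_fourier_norm_le: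
  fixes f g :: "'a::euclidean_space \<Rightarrow> complex"
  assumes fg: "L2_fourier f g"
  shows "L2_norm g \<le> L2_norm f"
proof -
  have f: "f \<in> L2" and g: "g \<in> L2"
    using fg by (auto simp: L2_fourier_def)
  have [measurable]: "g \<in> borel_measurable borel"
    using g by (simp add: L2_def)
  have [measurable]: "ball (0::'a) (real n) \<in> sets borel" for n
    by simp
  have "(\<integral>\<^sup>+x. (norm (g x))\<^sup>2 \<partial>lborel) =
     (\<integral>\<^sup>+x. liminf (\<lambda>n. indicator (ball 0 (real n)) x * ennreal ((norm (g x))\<^sup>2)) \<partial>lborel)"
  proof (rule nn_integral_cong)
    fix x :: 'a
    obtain N :: nat where "norm x < real N"
      using reals_Archimedean2 by blast
    then have "(\<lambda>n. indicator (ball 0 (real n)) x * ennreal ((norm (g x))\<^sup>2)) \<longlonglongrightarrow> ennreal ((norm (g x))\<^sup>2)"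
      by (intro tendsto_eventually eventually_sequentiallyI[of N]) auto
    from lim_imp_Liminf[OF trivial_limit_sequentially this]
    show "ennreal ((norm (g x))\<^sup>2) = liminf (\<lambda>n. indicator (ball 0 (real n)) x * ennreal ((norm (g x))\<^sup>2))"
      by simp
  qed
  also have "\<dots> \<le> liminf (\<lambda>n. \<integral>\<^sup>+x. indicator (ball 0 (real n)) x * ennreal ((norm (g x))\<^sup>2) \<partial>lborel)"
    by (rule nn_integral_liminf) measurable
  also have "\<dots> \<le> (\<integral>\<^sup>+x. (norm (f x))\<^sup>2 \<partial>lborel)"
    by (intro Liminf_le always_eventually allI nn_integral_L2_fourier_ball_le[OF fg]) auto
  finally show ?thesis
    using L2_norm_le(2)[OF _ f, of g 1] by simp
qed

section \<open>Linearity and uniqueness of the weak Fourier transform\<close>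

lemma L2_fourier_add:
  assumes "L2_fourier f f'" "L2_fourier g g'"
  shows "L2_fourier (\<lambda>x. f x + g x) (\<lambda>x. f' x + g' x)"
  unfolding L2_fourier_def
proof (intro conjI ballI)
  have L: "f \<in> L2" "f' \<in> L2" "g \<in> L2" "g' \<in> L2"
    using assms by (auto simp: L2_fourier_def)
  then show "(\<lambda>x. f x + g x) \<in> L2" "(\<lambda>x. f' x + g' x) \<in> L2"
    by (auto intro: L2_add)
  fix h :: "'a \<Rightarrow> complex" assume h: "h \<in> schwartz"
  then have "fourier h \<in> L2" "h \<in> L2"
    by (auto intro: fourier_L2 schwartz_integrable schwartz_L2)
  with L h assms show "fourier_distribution (function_distribution (\<lambda>x. f x + g x)) h = function_distribution (\<lambda>x. f' x + g' x) h"
    by (simp add: L2_fourier_def fourier_distribution_def function_distribution_def distrib_right L2_mult_integrable)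
qed

lemma L2_fourier_cmult:
  assumes "L2_fourier f f'"
  shows "L2_fourier (\<lambda>x. c * f x) (\<lambda>x. c * f' x)"
  using assms by (auto simp: L2_fourier_def L2_cmult fourier_distribution_def function_distribution_def mult.assoc)

lemma L2_norm_zero_AE:
  assumes "f \<in> L2" "L2_norm f \<le> 0"
  shows "AE x in lborel. f x = 0"
proof -
  have "integrable lborel (\<lambda>x. (norm (f x))\<^sup>2)" "(LINT x|lborel. (norm (f x))\<^sup>2) = 0"
    using assms by (auto simp: L2_def L2_norm_def intro: antisym)
  then have "AE x in lborel. (norm (f x))\<^sup>2 = 0"
    by (subst (asm) integral_nonneg_eq_0_iff_AE) auto
  then show ?thesis by eventually_elim simp
qed

text \<open>The difference of two transforms of \<open>f\<close> is a transform of the zero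
  function, so the norm inequality forces it to vanish almost everywhere.\<close>

lemma L2_fourier_unique:
  fixes f :: "'a::euclidean_space \<Rightarrow> complex"
  assumes "L2_fourier f g" "L2_fourier f g'"
  shows "AE x in lborel. g x = g' x"
proof -
  have *: "L2_fourier (\<lambda>x. f x + - 1 * f x) (\<lambda>x. g x + - 1 * g' x)"
    by (intro L2_fourier_add L2_fourier_cmult assms)
  then have "L2_norm (\<lambda>x. g x + - 1 * g' x) \<le> 0"
    using L2_fourier_norm_le[OF *] by (simp add: L2_norm_def)
  then have "AE x in lborel. g x + - 1 * g' x = 0"
    using * by (intro L2_norm_zero_AE) (auto simp: L2_fourier_def)
  then show ?thesis by eventually_elim simp
qed

section \<open>Extreme points\<close>

text \<open>Otherwise segments in \<open>K\<close> with midpoints tending to \<open>x\<close> would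
  keep an endpoint at distance at least \<open>r\<close> from \<open>x\<close>, and a limit would be
  a nondegenerate segment in \<open>K\<close> centred at \<open>x\<close>. Since \<open>K\<close>
  may be unbounded, the half-segment vectors are rescaled by \<open>r / (r + norm v)\<close>: the
  factor is at most 1, so convexity keeps the new endpoints in \<open>K\<close>, the rescaled
  vectors are bounded by \<open>r\<close>, and they tend to 0 only if the original ones do.\<close>

lemma extreme_point_midpoint_aux:
  fixes K :: "'a::euclidean_space set"
  assumes K: "closed K" "convex K" and x: "x extreme_point_of K" and r: "r > 0"
  shows "\<exists>\<delta>>0. \<forall>y\<in>K. \<forall>z\<in>K. dist (midpoint y z) x < \<delta> \<longrightarrow> y \<in> ball x r"
proof (rule ccontr)
  assume "\<not> ?thesis"
  then have "\<exists>y z. y \<in> K \<and> z \<in> K \<and> dist (midpoint y z) x < inverse (real (Suc n)) \<and> y \<notin> ball x r" for n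
    by (meson inverse_positive_iff_positive of_nat_0_less_iff zero_less_Suc)
  then obtain y z where yz: "\<And>n. y n \<in> K" "\<And>n. z n \<in> K"
      "\<And>n. dist (midpoint (y n) (z n)) x < inverse (real (Suc n))" "\<And>n. y n \<notin> ball x r"
    by metis
  define m where "m n = midpoint (y n) (z n)" for n
  have m: "m \<longlonglongrightarrow> x"
  proof (rule metric_LIMSEQ_I)
    fix e :: real assume "e > 0"
    then obtain N where "inverse (real (Suc N)) < e"
      using reals_Archimedean by blast
    then have "dist (m n) x < e" if "n \<ge> N" for n
    proof -
      have "inverse (real (Suc n)) \<le> inverse (real (Suc N))"
        using that by (intro le_imp_inverse_le) auto
      then show ?thesis
        using yz(3)[of n] \<open>inverse (real (Suc N)) < e\<close> unfolding m_def by linarith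
    qed
    then show "\<exists>N. \<forall>n\<ge>N. dist (m n) x < e" by blast
  qed
  \<comment> \<open>Shrink the segment about its midpoint so that it stays in a compact set.\<close>
  define u where "u n = (r / (r + norm (y n - m n))) *\<^sub>R (y n - m n)" for n
  have pos: "r + norm (y n - m n) > 0" for n
    using r by (simp add: add_pos_nonneg)
  have yr: "norm (y n - x) \<ge> r" for n
    using yz(4)[of n] by (simp add: dist_norm norm_minus_commute)
  have bnd: "norm (u n) \<le> r" for n
  proof -
    have "norm (u n) = r / (r + norm (y n - m n)) * norm (y n - m n)"
      using r pos[of n] unfolding u_def norm_scaleR by simp
    also have "\<dots> \<le> r"
      using r pos[of n] by (simp add: field_simps)
    finally show ?thesis .
  qed
  have "compact (cball (0::'a) r)" by simp
  then obtain l k where l: "strict_mono (k :: nat \<Rightarrow> nat)" "(u \<circ> k) \<longlonglongrightarrow> l"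
    unfolding compact_def using bnd by (metis mem_cball_0)
  have mem: "m n + u n \<in> K" "m n - u n \<in> K" for n
  proof -
    define t where "t = r / (r + norm (y n - m n))"
    have t: "0 \<le> t" "t \<le> 1"
      using r pos[of n] by (auto simp: t_def)
    have mK: "m n \<in> K"
      using yz(1,2)[of n] convexD[OF K(2), of "y n" "z n" "1/2" "1/2"] by (simp add: m_def midpoint_def scaleR_add_right)
    have z: "z n - m n = - (y n - m n)"
      by (simp add: m_def midpoint_def algebra_simps flip: scaleR_2 scaleR_left_distrib)
    have "m n + u n = (1 - t) *\<^sub>R m n + t *\<^sub>R y n"
      by (simp add: u_def t_def[symmetric] algebra_simps)
    then show "m n + u n \<in> K"
      using convexD[OF K(2) mK yz(1)[of n], of "1 - t" t] t by simp
    have "m n - u n = m n + t *\<^sub>R (z n - m n)"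
      unfolding z by (simp add: u_def t_def[symmetric] algebra_simps)
    also have "\<dots> = (1 - t) *\<^sub>R m n + t *\<^sub>R z n"
      by (simp add: algebra_simps)
    finally show "m n - u n \<in> K"
      using convexD[OF K(2) mK yz(2)[of n], of "1 - t" t] t by simp
  qed
  have mk: "(\<lambda>n. m (k n)) \<longlonglongrightarrow> x"
    using LIMSEQ_subseq_LIMSEQ[OF m l(1)] by (simp add: o_def)
  have uk: "(\<lambda>n. u (k n)) \<longlonglongrightarrow> l"
    using l(2) by (simp add: o_def)
  have "x + l \<in> K" "x - l \<in> K"
    by (rule closed_sequentially[OF K(1)], rule mem(1), rule tendsto_add[OF mk uk])
      (rule closed_sequentially[OF K(1)], rule mem(2), rule tendsto_diff[OF mk uk])
  moreover have "l \<noteq> 0"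
  proof
    assume "l = 0"
    then have "(\<lambda>n. norm (u (k n))) \<longlonglongrightarrow> 0"
      using uk tendsto_norm_zero by blast
    moreover have "(\<lambda>n. norm (m (k n) - x)) \<longlonglongrightarrow> 0"
      using mk by (simp add: LIM_zero tendsto_norm_zero)
    ultimately have "\<forall>\<^sub>F n in sequentially. norm (u (k n)) < r / 3 \<and> norm (m (k n) - x) < r / 3"
      using r by (intro eventually_conj order_tendstoD(2)) auto
    then obtain n where n: "norm (u (k n)) < r / 3" "norm (m (k n) - x) < r / 3"
      by (auto simp: eventually_sequentially)
    let ?a = "norm (y (k n) - m (k n))"
    have "r \<le> ?a + norm (m (k n) - x)"
      using yr[of "k n"] norm_triangle_ineq[of "y (k n) - m (k n)" "m (k n) - x"] by simp
    \<comment> \<open>A half-segment longer than \<open>2 * r / 3\<close> has rescaled length above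
      \<open>2 * r / 5\<close>, which contradicts the bound \<open>r / 3\<close>.\<close>
    then have a: "2 * r / 3 < ?a"
      using n(2) by linarith
    have "norm (u (k n)) = r * ?a / (r + ?a)"
      using r pos[of "k n"] by (simp add: u_def)
    then have "r * ?a / (r + ?a) < r / 3"
      using n(1) by simp
    then have "r * ?a < r / 3 * (r + ?a)"
      using pos[of "k n"] by (simp only: pos_divide_less_eq)
    then have "r * ?a < r * ((r + ?a) / 3)"
      by simp
    then have "?a < (r + ?a) / 3"
      using r by (simp only: mult_less_cancel_left_pos)
    moreover have "\<not> b < (r + b) / 3" if "2 * r / 3 < b" for b
      using that r by (simp add: field_simps)
    ultimately show False
      using a by blast
  qed
  moreover have "x \<in> open_segment (x + l) (x - l)" if "l \<noteq> 0"
  proof -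
    have "x + l \<noteq> x - l"
    proof
      assume "x + l = x - l"
      then have "l + l = 0" by (simp add: algebra_simps)
      then have "2 *\<^sub>R l = 0" by (simp add: scaleR_2)
      with that show False by simp
    qed
    moreover have "x = midpoint (x + l) (x - l)"
      by (simp add: midpoint_def scaleR_2[symmetric])
    ultimately show ?thesis
      using midpoint_in_open_segment[of "x + l" "x - l"] by simp
  qed
  ultimately show False
    using x by (auto simp: extreme_point_of_def)
qed

lemma extreme_point_midpoint:
  fixes K :: "'a::euclidean_space set"
  assumes K: "closed K" "convex K" and x: "x extreme_point_of K" and r: "r > 0"
  obtains \<delta> where "\<delta> > 0"
    "\<And>y z. y \<in> K \<Longrightarrow> z \<in> K \<Longrightarrow> dist (midpoint y z) x < \<delta> \<Longrightarrow> y \<in> ball x r \<and> z \<in> ball x r"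
proof -
  obtain \<delta> where d: "\<delta> > 0" "\<And>y z. y \<in> K \<Longrightarrow> z \<in> K \<Longrightarrow> dist (midpoint y z) x < \<delta> \<Longrightarrow> y \<in> ball x r"
    using extreme_point_midpoint_aux[OF assms] by blast
  show thesis
  proof (rule that[OF d(1)])
    fix y z assume "y \<in> K" "z \<in> K" "dist (midpoint y z) x < \<delta>"
    then show "y \<in> ball x r \<and> z \<in> ball x r"
      using d(2)[of y z] d(2)[of z y] by (simp add: midpoint_sym)
  qed
qed

text \<open>Points of \<open>E\<close> may accumulate at other points of \<open>E\<close>, so an
  infinite subset without limit points of its own is extracted first: a sequence converging to a
  limit point \<open>l\<close> that it avoids, or \<open>E\<close> itself if there is no limit
  point. Radii of half the distance to the remaining points then make the balls disjoint.\<close>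

lemma infinite_discrete_sequence:
  fixes E :: "'a::metric_space set"
  assumes "infinite E"
  obtains x :: "nat \<Rightarrow> 'a" and r where "\<And>n. x n \<in> E" "\<And>n. 0 < r n"
    "\<And>m n. m \<noteq> n \<Longrightarrow> ball (x m) (r m) \<inter> ball (x n) (r n) = {}"
proof -
  have "\<exists>D\<subseteq>E. infinite D \<and> (\<forall>d\<in>D. \<not> d islimpt D)"
  proof (cases "\<exists>l. l islimpt E")
    case True
    then obtain l and f :: "nat \<Rightarrow> 'a" where f: "\<And>n. f n \<in> E - {l}" "f \<longlonglongrightarrow> l"
      unfolding islimpt_sequential by auto
    have "f n \<in> range f - {l}" for n
      using f(1)[of n] by auto
    then have "l islimpt range f"
      using f(2) unfolding islimpt_sequential by blast
    then have "infinite (range f)"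
      using islimpt_finite by blast
    moreover have "\<not> f n islimpt range f" for n
      using sequence_unique_limpt[OF f(2), of "f n"] f(1)[of n] by auto
    ultimately show ?thesis
      using f(1) by (intro exI[of _ "range f"]) auto
  next
    case False
    with assms show ?thesis by auto
  qed
  then obtain D where D: "D \<subseteq> E" "infinite D" "\<And>d. d \<in> D \<Longrightarrow> \<not> d islimpt D"
    by auto
  obtain f :: "nat \<Rightarrow> 'a" where f: "inj f" "range f \<subseteq> D"
    using infinite_countable_subset[OF D(2)] by auto
  have nl: "\<not> f n islimpt range f" for n
    using f(2) D(3)[of "f n"] islimpt_subset[of "f n" "range f" D] by blast
  have "\<exists>e>0. \<forall>m. m \<noteq> n \<longrightarrow> e \<le> dist (f m) (f n)" for n
    using nl[of n] f(1) unfolding islimpt_approachable by (metis injD not_less rangeI)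
  then obtain e where e: "\<And>n. 0 < e n" "\<And>m n. m \<noteq> n \<Longrightarrow> e n \<le> dist (f m) (f n)"
    by metis
  show thesis
  proof (rule that[of f "\<lambda>n. e n / 2"])
    fix m n :: nat assume mn: "m \<noteq> n"
    have "False" if "dist (f m) z < e m / 2" "dist (f n) z < e n / 2" for z
      using that e(2)[OF mn] e(2)[OF mn[symmetric]] dist_triangle2[of "f m" "f n" z] by (simp add: dist_commute)
    then show "ball (f m) (e m / 2) \<inter> ball (f n) (e n / 2) = {}"
      by auto
  qed (use f D(1) e(1) in auto)
qed

section \<open>Hankel operators of dipole sums\<close>

lemma suminf_single:
  fixes f :: "nat \<Rightarrow> 'a::{comm_monoid_add, t2_space}"
  assumes "\<And>m. m \<noteq> n \<Longrightarrow> f m = 0"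
  shows "suminf f = f n"
  using suminf_finite[of "{n}" f] assms by simp

text \<open>The Fourier transform of the symbol is the sum of \<open>c n\<close> times the unit mass at \<open>2 p n\<close> minus
  that at \<open>2 q n\<close>. The reflection assumptions say that the Hankel operator is block diagonal over the
  disjoint balls; the distance between \<open>p n\<close> and \<open>q n\<close> controls the seminorms of the dipoles, and
  the summable radii make the range of the operator integrable.\<close>

locale dipole_configuration =
  fixes \<Omega> :: "'a::euclidean_space set" and x p q :: "nat \<Rightarrow> 'a" and r c :: "nat \<Rightarrow> real"
  assumes \<Omega>_open: "open \<Omega>"
    and r_pos: "0 < r n" and r_le: "r n \<le> (1 / 2) ^ n"
    and disjoint: "m \<noteq> n \<Longrightarrow> ball (x m) (r m) \<inter> ball (x n) (r n) = {}"
    and p_reflect: "y \<in> \<Omega> \<Longrightarrow> 2 *\<^sub>R p n - y \<in> \<Omega> \<Longrightarrow> y \<in> ball (x n) (r n) \<and> 2 *\<^sub>R p n - y \<in> ball (x n) (r n)"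
    and q_reflect: "y \<in> \<Omega> \<Longrightarrow> 2 *\<^sub>R q n - y \<in> \<Omega> \<Longrightarrow> y \<in> ball (x n) (r n) \<and> 2 *\<^sub>R q n - y \<in> ball (x n) (r n)"
    and dist_pq: "dist (p n) (q n) \<le> (1 / 2) ^ n"
    and c_le: "\<bar>c n\<bar> \<le> 1"
begin

definition U :: "nat \<Rightarrow> 'a set" where
  "U n = ball (x n) (r n) \<inter> \<Omega>"

lemma U_measurable [measurable]: "U n \<in> sets borel"
  and \<Omega>_measurable [measurable]: "\<Omega> \<in> sets borel"
  using \<Omega>_open by (auto simp: U_def)

lemma U_disjoint: "y \<in> U m \<Longrightarrow> y \<in> U n \<Longrightarrow> m = n"
  using disjoint[of m n] unfolding U_def by blast

definition cut :: "('a \<Rightarrow> complex) \<Rightarrow> 'a \<Rightarrow> complex" where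
  "cut g y = (if y \<in> \<Omega> then g y else 0)"

text \<open>A unit mass at \<open>2 p\<close> turns the Hankel integral into the reflection of
  \<open>g\<close> at \<open>p\<close>, cut off outside \<Omega>. Restricting to \<open>U n\<close>
  loses nothing: elsewhere in \<Omega> the reflection assumptions put both reflected points outside
  \<Omega>.\<close>

definition local_part :: "nat \<Rightarrow> ('a \<Rightarrow> complex) \<Rightarrow> 'a \<Rightarrow> complex" where
  "local_part n g y = (if y \<in> U n then complex_of_real (c n) * (cut g (2 *\<^sub>R p n - y) - cut g (2 *\<^sub>R q n - y)) else 0)"

text \<open>For each \<open>y\<close> at most one summand is nonzero, so the series never diverges.\<close>

definition hankel :: "('a \<Rightarrow> complex) \<Rightarrow> 'a \<Rightarrow> complex" where
  "hankel g y = (\<Sum>n. local_part n g y)"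

lemma hankel_in: "y \<in> U n \<Longrightarrow> hankel g y = local_part n g y"
  unfolding hankel_def by (rule suminf_single) (auto simp: local_part_def dest: U_disjoint)

lemma hankel_out: "(\<And>n. y \<notin> U n) \<Longrightarrow> hankel g y = 0"
  by (simp add: hankel_def local_part_def)

lemma hankel_outside: "y \<notin> \<Omega> \<Longrightarrow> hankel g y = 0"
  by (rule hankel_out) (auto simp: U_def)

lemma hankel_add: "hankel (\<lambda>y. f y + g y) y = hankel f y + hankel g y"
  by (cases "\<exists>n. y \<in> U n")
    (auto simp: hankel_in hankel_out local_part_def cut_def algebra_simps)

lemma hankel_cmult: "hankel (\<lambda>y. a * g y) y = a * hankel g y"
  by (cases "\<exists>n. y \<in> U n")
    (auto simp: hankel_in hankel_out local_part_def cut_def algebra_simps)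

lemma borel_measurable_local_part [measurable]:
  assumes [measurable]: "g \<in> borel_measurable borel"
  shows "local_part n g \<in> borel_measurable borel"
  unfolding local_part_def[abs_def] cut_def[abs_def] by measurable

lemma borel_measurable_hankel [measurable]:
  assumes [measurable]: "g \<in> borel_measurable borel"
  shows "hankel g \<in> borel_measurable borel"
  unfolding hankel_def[abs_def] by measurable

text \<open>A point reflection preserves Lebesgue measure, and the assumption confines to
  \<open>U n\<close> every reflected point at which \<open>cut g\<close> can be nonzero.\<close>

lemma nn_integral_reflect:
  fixes a :: 'a
  assumes [measurable]: "g \<in> borel_measurable borel"
    and refl: "\<And>y. y \<in> \<Omega> \<Longrightarrow> 2 *\<^sub>R a - y \<in> \<Omega> \<Longrightarrow> 2 *\<^sub>R a - y \<in> ball (x n) (r n)"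
  shows "(\<integral>\<^sup>+y. indicator (U n) y * ennreal ((norm (cut g (2 *\<^sub>R a - y)))\<^sup>2) \<partial>lborel) \<le>
     (\<integral>\<^sup>+y. indicator (U n) y * ennreal ((norm (g y))\<^sup>2) \<partial>lborel)"
proof -
  have "(\<integral>\<^sup>+y. indicator (U n) y * ennreal ((norm (cut g (2 *\<^sub>R a - y)))\<^sup>2) \<partial>lborel) \<le>
     (\<integral>\<^sup>+y. indicator (U n) (2 *\<^sub>R a + (- 1) *\<^sub>R y) * ennreal ((norm (g (2 *\<^sub>R a + (- 1) *\<^sub>R y)))\<^sup>2) \<partial>lborel)"
    using refl by (intro nn_integral_mono) (auto simp: indicator_def cut_def U_def)
  also have "\<dots> = (\<integral>\<^sup>+y. indicator (U n) y * ennreal ((norm (g y))\<^sup>2) \<partial>lborel)"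
    by (subst nn_integral_lborel_affine[of "\<lambda>y. indicator (U n) y * ennreal ((norm (g y))\<^sup>2)" "- 1" "2 *\<^sub>R a"]) auto
  finally show ?thesis .
qed

lemma norm_diff_sq_le: "(norm (a - b))\<^sup>2 \<le> 2 * (norm a)\<^sup>2 + 2 * (norm b)\<^sup>2" for a b :: complex
  using power_mono[OF norm_triangle_ineq4[of a b], of 2] sum_squares_bound[of "norm a" "norm b"]
  by (simp add: power2_sum)

text \<open>On \<open>U n\<close> the operator is a difference of two contractions that use only the
  values of \<open>g\<close> on \<open>U n\<close>, which gives norm 2 and the factor 4 for squares.
  Disjointness of the sets \<open>U n\<close> keeps this constant when all blocks are added.\<close>

lemma nn_integral_hankel_le:
  assumes [measurable]: "g \<in> borel_measurable borel"
  shows "(\<integral>\<^sup>+y. (norm (hankel g y))\<^sup>2 \<partial>lborel) \<le> ennreal (2\<^sup>2) * (\<integral>\<^sup>+y. (norm (g y))\<^sup>2 \<partial>lborel)"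
proof -
  have [measurable]: "cut g \<in> borel_measurable borel"
    unfolding cut_def[abs_def] by measurable
  let ?I = "\<lambda>n. \<integral>\<^sup>+y. indicator (U n) y * ennreal ((norm (g y))\<^sup>2) \<partial>lborel"
  have loc: "(\<integral>\<^sup>+y. ennreal ((norm (local_part n g y))\<^sup>2) \<partial>lborel) \<le> 4 * ?I n" for n
  proof -
    let ?P = "\<lambda>y. indicator (U n) y * ennreal ((norm (cut g (2 *\<^sub>R p n - y)))\<^sup>2)"
    let ?Q = "\<lambda>y. indicator (U n) y * ennreal ((norm (cut g (2 *\<^sub>R q n - y)))\<^sup>2)"
    have "(\<integral>\<^sup>+y. ennreal ((norm (local_part n g y))\<^sup>2) \<partial>lborel) \<le> (\<integral>\<^sup>+y. 2 * ?P y + 2 * ?Q y \<partial>lborel)"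
    proof (intro nn_integral_mono)
      fix y
      show "ennreal ((norm (local_part n g y))\<^sup>2) \<le> 2 * ?P y + 2 * ?Q y"
      proof (cases "y \<in> U n")
        case True
        let ?a = "cut g (2 *\<^sub>R p n - y)" and ?b = "cut g (2 *\<^sub>R q n - y)"
        have "(norm (local_part n g y))\<^sup>2 = \<bar>c n\<bar>\<^sup>2 * (norm (?a - ?b))\<^sup>2"
          using True by (simp add: local_part_def norm_mult power_mult_distrib)
        also have "\<dots> \<le> 1 * (norm (?a - ?b))\<^sup>2"
          using c_le[of n] by (intro mult_right_mono power_le_one) auto
        also have "\<dots> \<le> 2 * (norm ?a)\<^sup>2 + 2 * (norm ?b)\<^sup>2"
          using norm_diff_sq_le[of ?a ?b] by simp
        finally have "ennreal ((norm (local_part n g y))\<^sup>2) \<le> ennreal (2 * (norm ?a)\<^sup>2 + 2 * (norm ?b)\<^sup>2)"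
          by (rule ennreal_leI)
        with True show ?thesis
          by (simp add: ennreal_plus ennreal_mult)
      qed (simp add: local_part_def)
    qed
    also have "\<dots> = 2 * (\<integral>\<^sup>+y. ?P y \<partial>lborel) + 2 * (\<integral>\<^sup>+y. ?Q y \<partial>lborel)"
      by (subst nn_integral_add, measurable) (simp add: nn_integral_cmult)
    also have "\<dots> \<le> 2 * ?I n + 2 * ?I n"
      by (intro add_mono mult_left_mono nn_integral_reflect) (use p_reflect q_reflect in auto)
    also have "\<dots> = (2 + 2) * ?I n"
      by (simp only: distrib_right)
    finally show ?thesis by simp
  qed
  have "(\<integral>\<^sup>+y. (norm (hankel g y))\<^sup>2 \<partial>lborel) \<le> (\<integral>\<^sup>+y. (\<Sum>n. ennreal ((norm (local_part n g y))\<^sup>2)) \<partial>lborel)"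
  proof (intro nn_integral_mono)
    fix y
    show "ennreal ((norm (hankel g y))\<^sup>2) \<le> (\<Sum>n. ennreal ((norm (local_part n g y))\<^sup>2))"
    proof (cases "\<exists>n. y \<in> U n")
      case True
      then obtain n where n: "y \<in> U n" by blast
      have "(\<Sum>n. ennreal ((norm (local_part n g y))\<^sup>2)) = ennreal ((norm (local_part n g y))\<^sup>2)"
        by (rule suminf_single) (use n in \<open>auto simp: local_part_def dest: U_disjoint\<close>)
      then show ?thesis using n by (simp add: hankel_in)
    qed (simp add: hankel_out)
  qed
  also have "\<dots> = (\<Sum>n. \<integral>\<^sup>+y. ennreal ((norm (local_part n g y))\<^sup>2) \<partial>lborel)"
    by (rule nn_integral_suminf) measurable
  also have "\<dots> \<le> (\<Sum>n. 4 * ?I n)"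
    by (intro suminf_le loc summableI)
  also have "\<dots> = (\<integral>\<^sup>+y. (\<Sum>n. 4 * (indicator (U n) y * ennreal ((norm (g y))\<^sup>2))) \<partial>lborel)"
    by (subst nn_integral_suminf, measurable) (simp add: nn_integral_cmult)
  also have "\<dots> \<le> (\<integral>\<^sup>+y. 4 * ennreal ((norm (g y))\<^sup>2) \<partial>lborel)"
  proof (intro nn_integral_mono)
    fix y
    show "(\<Sum>n. 4 * (indicator (U n) y * ennreal ((norm (g y))\<^sup>2))) \<le> 4 * ennreal ((norm (g y))\<^sup>2)"
    proof (cases "\<exists>n. y \<in> U n")
      case True
      then obtain n where n: "y \<in> U n" by blast
      have "(\<Sum>n. 4 * (indicator (U n) y * ennreal ((norm (g y))\<^sup>2))) = 4 * (indicator (U n) y * ennreal ((norm (g y))\<^sup>2))"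
        by (rule suminf_single) (use n U_disjoint in \<open>auto simp: indicator_def\<close>)
      then show ?thesis using n by simp
    qed simp
  qed
  also have "\<dots> = ennreal (2\<^sup>2) * (\<integral>\<^sup>+y. (norm (g y))\<^sup>2 \<partial>lborel)"
    by (simp add: nn_integral_cmult)
  finally show ?thesis .
qed

lemma hankel_L2:
  assumes "g \<in> L2"
  shows "hankel g \<in> L2" and "L2_norm (hankel g) \<le> 2 * L2_norm g"
proof -
  have [measurable]: "g \<in> borel_measurable borel"
    using assms by (simp add: L2_def)
  show "hankel g \<in> L2" and "L2_norm (hankel g) \<le> 2 * L2_norm g"
    using L2_norm_le[OF _ assms, of "hankel g" 2] nn_integral_hankel_le[of g] by auto
qed

text \<open>The radii are at most 1 and the dimension is at least 1, so \<open>r n ^ DIM('a)\<close>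
  is dominated by \<open>r n\<close> and the volumes form a convergent series.\<close>

lemma emeasure_UN_U: "emeasure lborel (\<Union>n. U n) < \<infinity>"
proof -
  let ?V = "unit_ball_vol (real DIM('a))"
  have "emeasure lborel (U n) \<le> ennreal (?V * (1 / 2) ^ n)" for n
  proof -
    have "emeasure lborel (U n) \<le> emeasure lborel (ball (x n) (r n))"
      by (intro emeasure_mono) (auto simp: U_def)
    also have "\<dots> = ennreal (?V * r n ^ DIM('a))"
      using r_pos[of n] by (simp add: emeasure_ball)
    also have "\<dots> \<le> ennreal (?V * (1 / 2) ^ n)"
    proof (intro ennreal_leI mult_left_mono)
      have "r n \<le> 1"
        using r_le[of n] power_le_one[of "1 / 2 :: real" n] by linarith
      then have "r n ^ DIM('a) \<le> r n ^ 1"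
        using r_pos[of n] by (intro power_decreasing) (auto simp: Suc_le_eq)
      then show "r n ^ DIM('a) \<le> (1 / 2) ^ n"
        using r_le[of n] by simp
    qed simp
    finally show ?thesis .
  qed
  then have "emeasure lborel (\<Union>n. U n) \<le> (\<Sum>n. ennreal (?V * (1 / 2) ^ n))"
    by (intro order.trans[OF emeasure_subadditive_countably] suminf_le summableI) auto
  also have "\<dots> < \<infinity>"
  proof -
    have "summable (\<lambda>n. ?V * (1 / 2) ^ n)"
      by (intro summable_mult summable_geometric) simp
    then show ?thesis
      by (subst suminf_ennreal2) auto
  qed
  finally show ?thesis .
qed

text \<open>The image lives on a set of finite measure, where the modulus is at most 1 plus its
  square. Integrability is what allows the inverse transform in \<open>T\<close> to be a plain
  integral.\<close>

lemma hankel_integrable: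
  assumes "g \<in> L2"
  shows "integrable lborel (hankel g)"
proof -
  have [measurable]: "g \<in> borel_measurable borel"
    using assms by (simp add: L2_def)
  have "integrable lborel (\<lambda>y. indicator (\<Union>n. U n) y + (norm (hankel g y))\<^sup>2)"
    using hankel_L2(1)[OF assms] emeasure_UN_U
    by (intro Bochner_Integration.integrable_add integrable_real_indicator) (auto simp: L2_def)
  then show ?thesis
  proof (rule Bochner_Integration.integrable_bound)
    have sq: "a \<le> 1 + a\<^sup>2" for a :: real
    proof -
      have "2 * a \<le> a\<^sup>2 + 1"
        using zero_le_power2[of "a - 1"] by (simp add: power2_diff)
      then show ?thesis using zero_le_power2[of a] by linarith
    qed
    show "AE y in lborel. norm (hankel g y) \<le> norm (indicator (\<Union>n. U n) y + (norm (hankel g y))\<^sup>2)"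
    proof (rule AE_I2)
      fix y
      show "norm (hankel g y) \<le> norm (indicator (\<Union>n. U n) y + (norm (hankel g y))\<^sup>2)"
        by (cases "\<exists>n. y \<in> U n") (auto simp: hankel_out sq)
    qed
  qed measurable
qed

text \<open>Invariance under null sets follows from linearity and the L2 bound applied to the
  difference, without tracing null sets through the reflections.\<close>

lemma hankel_cong_AE:
  assumes "g \<in> L2" "g' \<in> L2" "AE y in lborel. g y = g' y"
  shows "AE y in lborel. hankel g y = hankel g' y"
proof -
  let ?d = "\<lambda>y. g y + - 1 * g' y"
  have d: "?d \<in> L2"
    by (intro L2_add L2_cmult assms)
  have "(LINT y|lborel. (norm (?d y))\<^sup>2) = (LINT y::'a|lborel. 0)"
    using d assms(3) by (intro integral_cong_AE) (auto simp: L2_def)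
  then have "L2_norm ?d = 0"
    by (simp add: L2_norm_def)
  then have "AE y in lborel. hankel ?d y = 0"
    using hankel_L2[OF d] by (intro L2_norm_zero_AE) auto
  then show ?thesis
    by eventually_elim (simp only: hankel_add hankel_cmult, simp)
qed

text \<open>Functions in the Paley-Wiener space have a transform only through the relation
  \<open>L2_fourier\<close>, so a representative is chosen.\<close>

definition hat :: "('a \<Rightarrow> complex) \<Rightarrow> 'a \<Rightarrow> complex" where
  "hat f = (SOME g. L2_fourier f g)"

definition T :: "('a \<Rightarrow> complex) \<Rightarrow> 'a \<Rightarrow> complex" where
  "T f = inv_fourier (hankel (hat f))"

lemma L2_fourier_hat: "L2_fourier f g \<Longrightarrow> L2_fourier f (hat f)"
  unfolding hat_def by (rule someI[of "L2_fourier f" g])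

lemma hat: "f \<in> paley_wiener \<Omega> \<Longrightarrow> L2_fourier f (hat f)"
  by (auto simp: paley_wiener_def intro: L2_fourier_hat)

lemma hankel_hat:
  assumes "L2_fourier f g"
  shows "AE y in lborel. hankel (hat f) y = hankel g y"
proof -
  have "L2_fourier f (hat f)"
    using assms by (rule L2_fourier_hat)
  with assms show ?thesis
    by (intro hankel_cong_AE L2_fourier_unique[of f]) (auto simp: L2_fourier_def)
qed

text \<open>Any transform \<open>g\<close> may replace the chosen one: they agree almost everywhere,
  and \<open>inv_fourier\<close> integrates the difference away. The equality of functions therefore
  holds at every point.\<close>

lemma T_eq:
  assumes "L2_fourier f g"
  shows "T f = inv_fourier (hankel g)"
proof
  fix t
  have g: "g \<in> L2" "hat f \<in> L2"
    using assms L2_fourier_hat[OF assms] by (auto simp: L2_fourier_def)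
  then have [measurable]: "g \<in> borel_measurable borel" "hat f \<in> borel_measurable borel"
    by (auto simp: L2_def)
  show "T f t = inv_fourier (hankel g) t"
    unfolding T_def inv_fourier_def
  proof (rule integral_cong_AE)
    show "AE y in lborel. hankel (hat f) y * unit_char (y \<bullet> t) = hankel g y * unit_char (y \<bullet> t)"
      using hankel_hat[OF assms] by eventually_elim simp
  qed measurable
qed

lemma L2_fourier_T:
  assumes "L2_fourier f g"
  shows "L2_fourier (T f) (hankel g)"
  unfolding T_eq[OF assms] using assms
  by (intro L2_fourier_inv_fourier hankel_integrable hankel_L2) (auto simp: L2_fourier_def)

lemma T_paley_wiener: "L2_fourier f g \<Longrightarrow> T f \<in> paley_wiener \<Omega>"
  unfolding paley_wiener_def by (intro CollectI exI[of _ "hankel g"] conjI L2_fourier_T) (auto simp: hankel_outside)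

lemma bounded_T: "bounded_operator_on_paley_wiener \<Omega> T"
  unfolding bounded_operator_on_paley_wiener_def
proof (intro conjI ballI allI)
  show "T f \<in> paley_wiener \<Omega>" if "f \<in> paley_wiener \<Omega>" for f
    by (rule T_paley_wiener[OF hat[OF that]])
  have i: "integrable lborel (\<lambda>y. hankel g y * unit_char (y \<bullet> t))" if "g \<in> L2" for g t
  proof -
    have [measurable]: "g \<in> borel_measurable borel"
      using that by (simp add: L2_def)
    show ?thesis
      by (rule Bochner_Integration.integrable_bound[OF hankel_integrable[OF that]]) (auto simp: norm_mult)
  qed
  show "AE t in lborel. T (\<lambda>y. f y + g y) t = T f t + T g t"
    if f: "f \<in> paley_wiener \<Omega>" and g: "g \<in> paley_wiener \<Omega>" for f g
  proof (rule AE_I2)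
    fix t
    have L: "hat f \<in> L2" "hat g \<in> L2"
      using hat[OF f] hat[OF g] by (auto simp: L2_fourier_def)
    show "T (\<lambda>y. f y + g y) t = T f t + T g t"
      unfolding T_eq[OF L2_fourier_add[OF hat[OF f] hat[OF g]]]
      unfolding T_def inv_fourier_def hankel_add distrib_right
      by (rule Bochner_Integration.integral_add[OF i[OF L(1)] i[OF L(2)]])
  qed
  show "AE t in lborel. T (\<lambda>y. a * f y) t = a * T f t" if f: "f \<in> paley_wiener \<Omega>" for f a
    unfolding T_eq[OF L2_fourier_cmult[OF hat[OF f]]]
    unfolding T_def inv_fourier_def hankel_cmult mult.assoc by simp
  show "\<exists>C. \<forall>f\<in>paley_wiener \<Omega>. L2_norm (T f) \<le> C * L2_norm f"
  proof (intro exI ballI)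
    fix f assume "f \<in> paley_wiener \<Omega>"
    note F = hat[OF this]
    then have L: "hat f \<in> L2"
      by (simp add: L2_fourier_def)
    have "L2_norm (T f) \<le> L2_norm (hankel (hat f))"
      unfolding T_def by (intro inv_fourier_L2 hankel_integrable hankel_L2 L)
    also have "\<dots> \<le> 2 * L2_norm (hat f)"
      by (rule hankel_L2[OF L])
    also have "\<dots> \<le> 2 * L2_norm f"
      using L2_fourier_norm_le[OF F] by simp
    finally show "L2_norm (T f) \<le> 2 * L2_norm f" .
  qed
qed

end

section \<open>The symbol as a tempered distribution\<close>

context dipole_configuration
begin

definition dipole :: "nat \<Rightarrow> 'a \<Rightarrow> complex" where
  "dipole n t = unit_char ((2 *\<^sub>R p n) \<bullet> t) - unit_char ((2 *\<^sub>R q n) \<bullet> t)"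

text \<open>The Gaussian limit agrees with the plain integral for integrable \<open>f\<close>, and it also exists
  for \<open>f = fourier h\<close> without any information about the decay of \<open>fourier h\<close>.\<close>

definition pairing :: "nat \<Rightarrow> ('a \<Rightarrow> complex) \<Rightarrow> complex" where
  "pairing n f = lim (\<lambda>k. LINT t|lborel. f t * dipole n t * complex_of_real (gauss (real (Suc k)) t))"

definition symbol :: "('a \<Rightarrow> complex) \<Rightarrow> complex" where
  "symbol f = (\<Sum>n. complex_of_real (c n) * pairing n f)"

lemma borel_measurable_dipole [measurable]: "dipole n \<in> borel_measurable borel"
  unfolding dipole_def[abs_def] by measurable

text \<open>The closeness of \<open>p n\<close> and \<open>q n\<close> buys the summable factor
  \<open>(1 / 2) ^ n\<close> at the price of growth in \<open>norm t\<close>. The constant is the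
  Lipschitz constant \<open>2 * pi\<close> of \<open>unit_char\<close>, doubled because the masses
  sit at twice the points.\<close>

lemma norm_dipole_le: "norm (dipole n t) \<le> 4 * pi * (1 / 2) ^ n * norm t"
proof -
  have "norm (dipole n t) \<le> 2 * pi * \<bar>(2 *\<^sub>R p n) \<bullet> t - (2 *\<^sub>R q n) \<bullet> t\<bar>"
    unfolding dipole_def by (rule norm_unit_char_diff_le)
  also have "(2 *\<^sub>R p n) \<bullet> t - (2 *\<^sub>R q n) \<bullet> t = 2 * ((p n - q n) \<bullet> t)"
    by (simp add: inner_diff_left)
  also have "2 * pi * \<bar>2 * ((p n - q n) \<bullet> t)\<bar> = 4 * pi * \<bar>(p n - q n) \<bullet> t\<bar>"
    by (simp add: abs_mult)
  also have "\<dots> \<le> 4 * pi * (norm (p n - q n) * norm t)"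
    by (intro mult_left_mono Cauchy_Schwarz_ineq2) simp
  also have "\<dots> \<le> 4 * pi * ((1 / 2) ^ n * norm t)"
    using dist_pq[of n] by (intro mult_left_mono mult_right_mono) (auto simp: dist_norm)
  finally show ?thesis by simp
qed

lemma norm_dipole_le_2: "norm (dipole n t) \<le> 2"
  using norm_triangle_ineq4[of "unit_char ((2 *\<^sub>R p n) \<bullet> t)" "unit_char ((2 *\<^sub>R q n) \<bullet> t)"]
  by (simp add: dipole_def)

lemma integrable_dipole: "integrable lborel f \<Longrightarrow> integrable lborel (\<lambda>t. f t * dipole n t)"
  by (rule Bochner_Integration.integrable_bound[where f="\<lambda>t. 2 * f t"])
    (auto simp: norm_mult mult.commute[of 2] intro!: mult_left_mono norm_dipole_le_2)

lemma pairing_integrable: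
  assumes f: "integrable lborel f"
  shows "pairing n f = (LINT t|lborel. f t * dipole n t)"
proof -
  have [measurable]: "f \<in> borel_measurable borel"
    using f by auto
  have "(\<lambda>k. LINT t|lborel. f t * dipole n t * complex_of_real (gauss (real (Suc k)) t)) \<longlonglongrightarrow>
     (LINT t|lborel. f t * dipole n t)"
  proof (rule integral_dominated_convergence[OF _ _ integrable_norm[OF integrable_dipole[OF f]]])
    show "AE t in lborel. (\<lambda>k. f t * dipole n t * complex_of_real (gauss (real (Suc k)) t)) \<longlonglongrightarrow> f t * dipole n t"
    proof (rule AE_I2)
      fix t
      have "(\<lambda>k. f t * dipole n t * complex_of_real (gauss (real (Suc k)) t)) \<longlonglongrightarrow> f t * dipole n t * complex_of_real 1"
        by (intro tendsto_intros gauss_tendsto)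
      then show "(\<lambda>k. f t * dipole n t * complex_of_real (gauss (real (Suc k)) t)) \<longlonglongrightarrow> f t * dipole n t"
        by simp
    qed
    show "AE t in lborel. norm (f t * dipole n t * complex_of_real (gauss (real (Suc k)) t)) \<le> norm (f t * dipole n t)" for k
      by (auto simp: norm_mult mult.assoc intro!: mult_left_mono mult_left_le)
  qed measurable
  then show ?thesis
    unfolding pairing_def by (rule limI)
qed

text \<open>Of the order \<open>2 * DIM('a) + 1\<close>, the last power absorbs the factor
  \<open>norm t\<close> of the dipole, and the others provide an integrable weight.\<close>

lemma pairing_schwartz_bound:
  assumes f: "f \<in> schwartz"
  shows "norm (pairing n f) \<le> (1 / 2) ^ n *
    (4 * pi * schwartz_seminorm (2 * DIM('a) + 1) f * (LINT t::'a|lborel. inverse ((1 + norm t) ^ (2 * DIM('a)))))"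
proof -
  let ?S = "schwartz_seminorm (2 * DIM('a) + 1) f"
  let ?w = "\<lambda>t::'a. inverse ((1 + norm t) ^ (2 * DIM('a)))"
  have S: "0 \<le> ?S"
    using order.trans[OF mult_nonneg_nonneg schwartz_seminorm_bound[OF f, of 0 "2 * DIM('a) + 1"]] by simp
  have "norm (pairing n f) \<le> (LINT t|lborel. norm (f t * dipole n t))"
    unfolding pairing_integrable[OF schwartz_integrable[OF f]] by (rule integral_norm_bound)
  also have "\<dots> \<le> (LINT t|lborel. (4 * pi * (1 / 2) ^ n * ?S) * ?w t)"
  proof (rule integral_mono')
    show "integrable lborel (\<lambda>t. (4 * pi * (1 / 2) ^ n * ?S) * ?w t)"
      by (intro integrable_mult_right integrable_inverse_one_plus_norm)
    fix t :: 'a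
    have "norm (f t) * norm t \<le> ?S * inverse ((1 + norm t) ^ (2 * DIM('a) + 1)) * (1 + norm t)"
      by (intro mult_mono schwartz_decay[OF f]) (use S in auto)
    also have "\<dots> = ?S * ?w t"
    proof -
      have gen: "s * inverse (a ^ (m + 1)) * a = s * inverse (a ^ m)" if "a > 0" for s a :: real and m :: nat
        using that by (simp add: field_simps)
      show ?thesis
        by (rule gen) (simp add: add_pos_nonneg)
    qed
    finally have *: "norm (f t) * norm t \<le> ?S * ?w t" .
    have "norm (f t * dipole n t) \<le> norm (f t) * (4 * pi * (1 / 2) ^ n * norm t)"
      unfolding norm_mult by (intro mult_left_mono norm_dipole_le) simp
    also have "\<dots> = 4 * pi * (1 / 2) ^ n * (norm (f t) * norm t)"
      by simp
    also have "\<dots> \<le> 4 * pi * (1 / 2) ^ n * (?S * ?w t)"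
      by (intro mult_left_mono *) simp
    finally show "norm (f t * dipole n t) \<le> (4 * pi * (1 / 2) ^ n * ?S) * ?w t"
      by (simp only: mult.assoc)
  qed (use S in auto)
  also have "\<dots> = (1 / 2) ^ n * (4 * pi * ?S * (LINT t::'a|lborel. ?w t))"
    by simp
  finally show ?thesis .
qed

lemma symbol_summable:
  assumes f: "f \<in> schwartz"
  shows "summable (\<lambda>n. norm (complex_of_real (c n) * pairing n f))"
    and "norm (symbol f) \<le> 8 * pi * (LINT t::'a|lborel. inverse ((1 + norm t) ^ (2 * DIM('a)))) * schwartz_seminorm (2 * DIM('a) + 1) f"
proof -
  let ?K = "4 * pi * schwartz_seminorm (2 * DIM('a) + 1) f * (LINT t::'a|lborel. inverse ((1 + norm t) ^ (2 * DIM('a))))"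
  have le: "norm (complex_of_real (c n) * pairing n f) \<le> (1 / 2) ^ n * ?K" for n
  proof -
    have "norm (complex_of_real (c n) * pairing n f) \<le> 1 * norm (pairing n f)"
      unfolding norm_mult using c_le[of n] by (intro mult_right_mono) auto
    with pairing_schwartz_bound[OF f, of n] show ?thesis by simp
  qed
  have s: "summable (\<lambda>n. (1 / 2) ^ n * ?K)"
    by (intro summable_mult2 summable_geometric) simp
  show sum: "summable (\<lambda>n. norm (complex_of_real (c n) * pairing n f))"
    by (rule summable_comparison_test'[OF s]) (use le in auto)
  have "norm (symbol f) \<le> (\<Sum>n. norm (complex_of_real (c n) * pairing n f))"
    unfolding symbol_def by (rule summable_norm[OF sum])
  also have "\<dots> \<le> (\<Sum>n. (1 / 2) ^ n * ?K)"
    by (rule suminf_le[OF le sum s])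
  also have "\<dots> = 2 * ?K"
    by (subst suminf_mult2[symmetric]) (auto simp: suminf_geometric)
  finally show "norm (symbol f) \<le> 8 * pi * (LINT t::'a|lborel. inverse ((1 + norm t) ^ (2 * DIM('a)))) * schwartz_seminorm (2 * DIM('a) + 1) f"
    by (simp add: mult_ac)
qed

lemma tempered_symbol: "tempered_distribution symbol"
  unfolding tempered_distribution_def
proof (intro conjI ballI allI)
  fix f g :: "'a \<Rightarrow> complex" assume f: "f \<in> schwartz" and g: "g \<in> schwartz"
  note i = schwartz_integrable[OF f] schwartz_integrable[OF g]
  have "pairing n (\<lambda>x. f x + g x) = pairing n f + pairing n g" for n
    using i by (simp add: pairing_integrable distrib_right integrable_dipole)
  then show "symbol (\<lambda>x. f x + g x) = symbol f + symbol g"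
    unfolding symbol_def
    using suminf_add[OF summable_norm_cancel[OF symbol_summable(1)[OF f]] summable_norm_cancel[OF symbol_summable(1)[OF g]]]
    by (simp add: distrib_left)
next
  fix f :: "'a \<Rightarrow> complex" and a assume f: "f \<in> schwartz"
  have "pairing n (\<lambda>x. a * f x) = a * pairing n f" for n
    using schwartz_integrable[OF f] by (simp add: pairing_integrable mult.assoc)
  then show "symbol (\<lambda>x. a * f x) = a * symbol f"
    unfolding symbol_def
    using suminf_mult[OF summable_norm_cancel[OF symbol_summable(1)[OF f]], of a]
    by (simp add: mult.left_commute)
next
  show "\<exists>C N. \<forall>f\<in>schwartz. norm (symbol f) \<le> C * schwartz_seminorm N f"
    using symbol_summable(2) by blast
qed

text \<open>Gaussian inversion evaluates each exponential of the dipole separately; the definition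
  of \<open>pairing\<close> by Gaussian limits is made for this.\<close>

lemma fourier_symbol:
  assumes h: "h \<in> schwartz"
  shows "fourier_distribution symbol h = (\<Sum>n. complex_of_real (c n) * (h (2 *\<^sub>R p n) - h (2 *\<^sub>R q n)))"
proof -
  have [measurable]: "h \<in> borel_measurable borel"
    by (rule schwartz_measurable[OF h])
  have i: "integrable lborel (\<lambda>t. fourier h t * unit_char (a \<bullet> t) * complex_of_real (gauss (real (Suc k)) t))" for a k
    by (rule Bochner_Integration.integrable_bound[OF integrable_mult_right[OF integrable_gauss[of "real (Suc k)"], of "LINT y|lborel. norm (h y)"]])
      (auto simp: norm_mult intro!: mult_right_mono norm_fourier_le)
  have "pairing n (fourier h) = h (2 *\<^sub>R p n) - h (2 *\<^sub>R q n)" for n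
  proof -
    have "(\<lambda>k. (LINT t|lborel. fourier h t * unit_char ((2 *\<^sub>R p n) \<bullet> t) * complex_of_real (gauss (real (Suc k)) t)) -
        (LINT t|lborel. fourier h t * unit_char ((2 *\<^sub>R q n) \<bullet> t) * complex_of_real (gauss (real (Suc k)) t)))
       \<longlonglongrightarrow> h (2 *\<^sub>R p n) - h (2 *\<^sub>R q n)"
      by (intro tendsto_diff inv_fourier_fourier_tendsto[OF schwartz_continuous[OF h] schwartz_bounded[OF h] schwartz_integrable[OF h]])
    then have "(\<lambda>k. LINT t|lborel. fourier h t * dipole n t * complex_of_real (gauss (real (Suc k)) t))
       \<longlonglongrightarrow> h (2 *\<^sub>R p n) - h (2 *\<^sub>R q n)"
      unfolding dipole_def right_diff_distrib left_diff_distrib Bochner_Integration.integral_diff[OF i i] .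
    then show ?thesis
      unfolding pairing_def by (rule limI)
  qed
  then show ?thesis
    by (simp add: fourier_distribution_def symbol_def)
qed

text \<open>The true Hankel image contains all summands at every point of \<Omega>, whereas
  \<open>hankel\<close> keeps only the one belonging to the block. They agree because, for a point
  of \<Omega> outside \<open>U n\<close>, both reflected points lie outside \<Omega>, where
  \<open>g\<close> vanishes.\<close>

lemma hankel_image:
  assumes f: "f \<in> hankel_domain \<Omega>"
  shows "is_hankel_image \<Omega> symbol f (T f)"
proof -
  obtain g where g: "g \<in> test_functions \<Omega>" and fg: "L2_fourier f g"
    using f by (auto simp: hankel_domain_def)
  obtain K where "K \<subseteq> \<Omega>" "\<And>y. y \<notin> K \<Longrightarrow> g y = 0"
    by (rule test_functionsE[OF g]) (rule that)
  then have g0: "g y = 0" if "y \<notin> \<Omega>" for y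
    using that by blast
  then have cut: "cut g = g"
    by (auto simp: cut_def fun_eq_iff)
  have "hankel g y = fourier_distribution symbol (\<lambda>z. g (z - y))" if y: "y \<in> \<Omega>" for y
  proof -
    have "local_part n g y = complex_of_real (c n) * (g (2 *\<^sub>R p n - y) - g (2 *\<^sub>R q n - y))" for n
    proof (cases "y \<in> U n")
      case False
      then have "2 *\<^sub>R p n - y \<notin> \<Omega>" "2 *\<^sub>R q n - y \<notin> \<Omega>"
        using p_reflect[OF y, of n] q_reflect[OF y, of n] y unfolding U_def by blast+
      with False g0 show ?thesis by (simp add: local_part_def)
    qed (simp add: local_part_def cut)
    then show ?thesis
      using fourier_symbol[OF test_functions_schwartz[OF test_functions_shift[OF g, of y]]]
      by (simp add: hankel_def)
  qed
  with g fg L2_fourier_T[OF fg] T_paley_wiener[OF fg] show ?thesis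
    unfolding is_hankel_image_def by (intro conjI bexI[of _ g] exI[of _ "hankel g"]) auto
qed

lemma symbol_generates_bounded: "generates_bounded_hankel \<Omega> symbol"
  unfolding generates_bounded_hankel_def using bounded_T hankel_image by blast

text \<open>Pairing with a bounded \<psi> is controlled by the L1 norm of \<open>fourier h\<close>.
  This is the only consequence of the Nehari property that gets contradicted.\<close>

lemma nehari_bounded_symbol:
  assumes "nehari_theorem_true \<Omega>"
  obtains C where "C \<ge> 0" "\<And>h. h \<in> test_functions ((*\<^sub>R) 2 ` \<Omega>) \<Longrightarrow> integrable lborel (fourier h) \<Longrightarrow>
    norm (\<Sum>n. complex_of_real (c n) * (h (2 *\<^sub>R p n) - h (2 *\<^sub>R q n))) \<le> C * (LINT t|lborel. norm (fourier h t))"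
proof -
  obtain \<psi> where \<psi>: "\<psi> \<in> L_infinity" and eq: "distributions_eq_on ((*\<^sub>R) 2 ` \<Omega>)
      (fourier_distribution symbol) (fourier_distribution (function_distribution \<psi>))"
    using assms tempered_symbol symbol_generates_bounded unfolding nehari_theorem_true_def by blast
  obtain C where C: "AE t in lborel. norm (\<psi> t) \<le> C" and [measurable]: "\<psi> \<in> borel_measurable borel"
    using \<psi> by (auto simp: L_infinity_def)
  \<comment> \<open>The maximum with 0 makes the constant visibly nonnegative.\<close>
  show thesis
  proof (rule that[of "max C 0"])
    fix h assume h: "h \<in> test_functions ((*\<^sub>R) 2 ` \<Omega>)" and i: "integrable lborel (fourier h)"
    have m: "h \<in> borel_measurable borel"
      using h by (intro schwartz_measurable test_functions_schwartz)
    note [measurable] = borel_measurable_fourier[OF m]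
    have le: "AE t in lborel. norm (\<psi> t * fourier h t) \<le> norm (max C 0 * norm (fourier h t))"
      using C by eventually_elim (auto simp: norm_mult intro!: mult_right_mono)
    have i1: "integrable lborel (\<lambda>t. max C 0 * norm (fourier h t))"
      using i by auto
    have i2: "integrable lborel (\<lambda>t. norm (\<psi> t * fourier h t))"
      by (intro integrable_norm Bochner_Integration.integrable_bound[OF i1 _ le]) measurable
    have "(\<Sum>n. complex_of_real (c n) * (h (2 *\<^sub>R p n) - h (2 *\<^sub>R q n))) = fourier_distribution symbol h"
      using fourier_symbol[OF test_functions_schwartz[OF h]] by simp
    also have "\<dots> = (LINT t|lborel. \<psi> t * fourier h t)"
      using eq h by (simp add: distributions_eq_on_def fourier_distribution_def function_distribution_def)
    also have "norm \<dots> \<le> (LINT t|lborel. norm (\<psi> t * fourier h t))"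
      by (rule integral_norm_bound)
    also have "\<dots> \<le> (LINT t|lborel. max C 0 * norm (fourier h t))"
      by (rule integral_mono_AE[OF i2 i1]) (use le in \<open>auto simp: norm_mult abs_mult\<close>)
    finally show "norm (\<Sum>n. complex_of_real (c n) * (h (2 *\<^sub>R p n) - h (2 *\<^sub>R q n))) \<le> max C 0 * (LINT t|lborel. norm (fourier h t))"
      by simp
  qed simp
qed

end

section \<open>Choice of signs\<close>

text \<open>Signs chosen one after the other, each making the new cross term nonpositive, keep the
  weighted square mean of the sum as small as if the summands were orthogonal.\<close>

lemma exists_signs:
  fixes w :: "'a::euclidean_space \<Rightarrow> real" and z :: "nat \<Rightarrow> 'a \<Rightarrow> complex"
  assumes w: "integrable lborel w" "\<And>t. 0 \<le> w t"
    and z: "\<And>i. z i \<in> borel_measurable borel" "\<And>i t. norm (z i t) = 1"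
    and A: "finite A"
  shows "\<exists>c::nat \<Rightarrow> real. (\<forall>i. \<bar>c i\<bar> = 1) \<and>
    integrable lborel (\<lambda>t. w t * (norm (\<Sum>i\<in>A. complex_of_real (c i) * z i t))\<^sup>2) \<and>
    (LINT t|lborel. w t * (norm (\<Sum>i\<in>A. complex_of_real (c i) * z i t))\<^sup>2) \<le> real (card A) * (LINT t|lborel. w t)"
  using A
proof (induction A)
  case empty
  show ?case by (intro exI[of _ "\<lambda>_. 1"]) simp
next
  case (insert j A)
  note [measurable] = z(1)
  have [measurable]: "w \<in> borel_measurable borel"
    using w by auto
  obtain c :: "nat \<Rightarrow> real" where c: "\<And>i. \<bar>c i\<bar> = 1"
    and i: "integrable lborel (\<lambda>t. w t * (norm (\<Sum>i\<in>A. complex_of_real (c i) * z i t))\<^sup>2)"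
    and le: "(LINT t|lborel. w t * (norm (\<Sum>i\<in>A. complex_of_real (c i) * z i t))\<^sup>2) \<le> real (card A) * (LINT t|lborel. w t)"
    using insert.IH by blast
  define S where "S t = (\<Sum>i\<in>A. complex_of_real (c i) * z i t)" for t
  have [measurable]: "S \<in> borel_measurable borel"
    unfolding S_def[abs_def] by measurable
  have [measurable]: "(\<lambda>t. cnj (z j t)) \<in> borel_measurable borel"
    by (rule measurable_compose[OF z(1)]) (intro borel_measurable_continuous_onI continuous_intros)
  define X where "X = (LINT t|lborel. w t * Re (cnj (z j t) * S t))"
  define s :: real where "s = (if X \<le> 0 then 1 else - 1)"
  have s: "\<bar>s\<bar> = 1" "s * X \<le> 0"
    by (auto simp: s_def)
  have sq: "(norm (complex_of_real s * z j t + S t))\<^sup>2 = 1 + (norm (S t))\<^sup>2 + 2 * s * Re (cnj (z j t) * S t)" for t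
  proof -
    have "(norm (complex_of_real s * z j t + S t))\<^sup>2 =
      (norm (complex_of_real s * z j t))\<^sup>2 + (norm (S t))\<^sup>2 + 2 * Re (cnj (complex_of_real s * z j t) * S t)"
      unfolding cmod_power2 by (simp add: power2_eq_square algebra_simps)
    then show ?thesis
      using s(1) z(2)[of j t] by (simp add: norm_mult algebra_simps)
  qed
  have iS: "integrable lborel (\<lambda>t. w t * (norm (S t))\<^sup>2)"
    using i by (simp add: S_def)
  have iX: "integrable lborel (\<lambda>t. w t * Re (cnj (z j t) * S t))"
  proof (rule Bochner_Integration.integrable_bound[OF Bochner_Integration.integrable_add[OF w(1) iS]])
    show "AE t in lborel. norm (w t * Re (cnj (z j t) * S t)) \<le> norm (w t + w t * (norm (S t))\<^sup>2)"
    proof (rule AE_I2)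
      fix t
      have "\<bar>Re (cnj (z j t) * S t)\<bar> \<le> norm (cnj (z j t) * S t)"
        by (rule abs_Re_le_cmod)
      also have "\<dots> = norm (S t)"
        using z(2)[of j t] by (simp add: norm_mult)
      also have "\<dots> \<le> 1 + (norm (S t))\<^sup>2"
        using sum_squares_bound[of 1 "norm (S t)"] zero_le_power2[of "norm (S t)"] by (simp only: mult_1_right one_power2)
      finally have le: "w t * \<bar>Re (cnj (z j t) * S t)\<bar> \<le> w t * (1 + (norm (S t))\<^sup>2)"
        using w(2) by (rule mult_left_mono)
      have "norm (w t * Re (cnj (z j t) * S t)) = w t * \<bar>Re (cnj (z j t) * S t)\<bar>"
        unfolding real_norm_def abs_mult using w(2)[of t] by (simp only: abs_of_nonneg)
      also note le
      also have "w t * (1 + (norm (S t))\<^sup>2) \<le> norm (w t + w t * (norm (S t))\<^sup>2)"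
        by (simp add: distrib_left)
      finally show "norm (w t * Re (cnj (z j t) * S t)) \<le> norm (w t + w t * (norm (S t))\<^sup>2)" .
    qed
  qed measurable
  have eq: "w t * (norm (complex_of_real s * z j t + S t))\<^sup>2 =
      w t + w t * (norm (S t))\<^sup>2 + 2 * s * (w t * Re (cnj (z j t) * S t))" for t
    unfolding sq by (simp add: algebra_simps)
  have int: "integrable lborel (\<lambda>t. w t * (norm (complex_of_real s * z j t + S t))\<^sup>2)"
    unfolding eq using w(1) iS iX by (intro Bochner_Integration.integrable_add integrable_mult_right)
  have "(LINT t|lborel. w t * (norm (complex_of_real s * z j t + S t))\<^sup>2) =
     (LINT t|lborel. w t) + (LINT t|lborel. w t * (norm (S t))\<^sup>2) + 2 * s * X"
    unfolding eq X_def using w(1) iS iX by simp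
  also have "\<dots> \<le> (LINT t|lborel. w t) + real (card A) * (LINT t|lborel. w t)"
    using le s(2) by (simp add: S_def)
  also have "\<dots> = real (card (insert j A)) * (LINT t|lborel. w t)"
    using insert.hyps by (simp add: algebra_simps)
  finally have bound: "(LINT t|lborel. w t * (norm (complex_of_real s * z j t + S t))\<^sup>2) \<le> \<dots>" .
  have sum: "(\<Sum>i\<in>insert j A. complex_of_real ((c(j := s)) i) * z i t) = complex_of_real s * z j t + S t" for t
    unfolding S_def using insert.hyps by (subst sum.insert) (auto intro!: sum.cong)
  show ?case
    by (rule exI[of _ "c(j := s)"], unfold sum) (use c s(1) int bound in auto)
qed

text \<open>All translates have transforms of the same modulus \<open>w\<close> and differ only by
  unimodular characters, so \<open>exists_signs\<close> applies with weight \<open>w\<close>. The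
  integral of \<open>w\<close> is invariant under dilation, hence the bound does not involve
  \<open>R\<close> and the bumps may be as narrow as needed.\<close>

lemma exists_fourier_bump_sum_small:
  fixes a :: "nat \<Rightarrow> 'a::euclidean_space"
  assumes R: "R > 0" and A: "finite A"
  shows "\<exists>c::nat \<Rightarrow> real. (\<forall>i. \<bar>c i\<bar> = 1) \<and>
    integrable lborel (fourier (\<lambda>x. \<Sum>i\<in>A. complex_of_real (c i) * bump (R *\<^sub>R (x - a i)))) \<and>
    (LINT t|lborel. norm (fourier (\<lambda>x. \<Sum>i\<in>A. complex_of_real (c i) * bump (R *\<^sub>R (x - a i))) t)) \<le>
      sqrt (real (card A)) * (LINT t::'a|lborel. norm (fourier bump t))"
proof (cases "A = {}")
  case True
  then show ?thesis
    by (intro exI[of _ "\<lambda>_. 1"]) (simp add: fourier_unit_char[abs_def])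
next
  case False
  define w where "w t = norm (complex_of_real (inverse R ^ DIM('a)) * fourier bump (inverse R *\<^sub>R t))" for t :: 'a
  let ?z = "\<lambda>i t. unit_char (- (t \<bullet> a i))"
  let ?W = "LINT t::'a|lborel. norm (fourier bump t)"
  let ?N = "real (card A)"
  have N: "?N > 0"
    using False A by (simp add: card_gt_0_iff)
  have wi: "integrable lborel w"
    using integrable_lborel_affine[OF _ integrable_fourier_bump, of "inverse R" "0::'a"] R
    unfolding w_def[abs_def] by (intro integrable_norm integrable_mult_right) simp
  have [measurable]: "w \<in> borel_measurable borel"
    using wi by auto
  have wint: "(LINT t|lborel. w t) = ?W"
    using integral_lborel_affine[OF _ integrable_norm[OF integrable_fourier_bump], of "inverse R" "0::'a"] R
    by (simp add: w_def norm_mult norm_power norm_inverse abs_of_pos)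
  have "\<exists>c::nat \<Rightarrow> real. (\<forall>i. \<bar>c i\<bar> = 1) \<and>
    integrable lborel (\<lambda>t. w t * (norm (\<Sum>i\<in>A. complex_of_real (c i) * ?z i t))\<^sup>2) \<and>
    (LINT t|lborel. w t * (norm (\<Sum>i\<in>A. complex_of_real (c i) * ?z i t))\<^sup>2) \<le> ?N * (LINT t|lborel. w t)"
    by (rule exists_signs[OF wi _ _ _ A]) (auto simp: w_def)
  then obtain c :: "nat \<Rightarrow> real" where c: "\<And>i. \<bar>c i\<bar> = 1"
    and i: "integrable lborel (\<lambda>t. w t * (norm (\<Sum>i\<in>A. complex_of_real (c i) * ?z i t))\<^sup>2)"
    and le: "(LINT t|lborel. w t * (norm (\<Sum>i\<in>A. complex_of_real (c i) * ?z i t))\<^sup>2) \<le> ?N * ?W"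
    unfolding wint by blast
  define S where "S t = (\<Sum>i\<in>A. complex_of_real (c i) * ?z i t)" for t
  let ?g = "\<lambda>x. \<Sum>i\<in>A. complex_of_real (c i) * bump (R *\<^sub>R (x - a i))"
  have ib: "integrable lborel (\<lambda>x. bump (R *\<^sub>R (x - b)))" for b :: 'a
    by (intro schwartz_integrable test_functions_schwartz[of _ UNIV] test_function_bump_affine R) simp
  have ib': "integrable lborel (\<lambda>x. bump (R *\<^sub>R (x - b)) * unit_char (- (t \<bullet> x)))" for b t :: 'a
    by (rule Bochner_Integration.integrable_bound[OF ib[of b]]) (auto simp: norm_mult)
  have ft: "fourier ?g t = complex_of_real (inverse R ^ DIM('a)) * fourier bump (inverse R *\<^sub>R t) * S t" for t
  proof -
    have "fourier ?g t = (LINT x|lborel. (\<Sum>i\<in>A. complex_of_real (c i) * (bump (R *\<^sub>R (x - a i)) * unit_char (- (t \<bullet> x)))))"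
      unfolding fourier_unit_char by (simp add: sum_distrib_right mult.assoc)
    also have "\<dots> = (\<Sum>i\<in>A. complex_of_real (c i) * fourier (\<lambda>x. bump (R *\<^sub>R (x - a i))) t)"
      unfolding fourier_unit_char using ib' by (subst Bochner_Integration.integral_sum) auto
    also have "\<dots> = complex_of_real (inverse R ^ DIM('a)) * fourier bump (inverse R *\<^sub>R t) * S t"
      unfolding fourier_bump_affine[OF R] S_def by (simp add: sum_distrib_left mult_ac)
    finally show ?thesis .
  qed
  then have nft: "norm (fourier ?g t) = w t * norm (S t)" for t
    by (simp add: w_def norm_mult)
  \<comment> \<open>AM-GM in place of the Cauchy-Schwarz inequality\<close>
  let ?b = "\<lambda>t. sqrt ?N / 2 * w t + 1 / (2 * sqrt ?N) * (w t * (norm (S t))\<^sup>2)"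
  have bi: "integrable lborel ?b"
    using wi i by (intro Bochner_Integration.integrable_add integrable_mult_right) (auto simp: S_def)
  have amgm: "w t * norm (S t) \<le> ?b t" for t
  proof -
    have "0 \<le> (sqrt ?N - norm (S t))\<^sup>2" by simp
    then have "2 * sqrt ?N * norm (S t) \<le> ?N + (norm (S t))\<^sup>2"
      by (simp add: power2_diff)
    then have "norm (S t) \<le> (?N + (norm (S t))\<^sup>2) / (2 * sqrt ?N)"
      using N by (simp add: field_simps)
    also have "\<dots> = sqrt ?N / 2 + 1 / (2 * sqrt ?N) * (norm (S t))\<^sup>2"
      using N real_div_sqrt[of ?N] by (simp add: add_divide_distrib)
    finally have "w t * norm (S t) \<le> w t * (sqrt ?N / 2 + 1 / (2 * sqrt ?N) * (norm (S t))\<^sup>2)"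
      by (rule mult_left_mono) (simp add: w_def)
    then show ?thesis by (simp add: algebra_simps)
  qed
  have "?g \<in> borel_measurable borel"
    using ib by (intro borel_measurable_sum borel_measurable_times) auto
  note [measurable] = borel_measurable_fourier[OF this]
  have gi: "integrable lborel (fourier ?g)"
    by (rule Bochner_Integration.integrable_bound[OF bi])
      (measurable, use order.trans[OF amgm abs_ge_self] in \<open>simp only: nft real_norm_def AE_I2\<close>)
  have "(LINT t|lborel. norm (fourier ?g t)) \<le> (LINT t|lborel. ?b t)"
    by (rule integral_mono[OF integrable_norm[OF gi] bi]) (simp only: nft amgm)
  also have "\<dots> = sqrt ?N / 2 * ?W + 1 / (2 * sqrt ?N) * (LINT t|lborel. w t * (norm (S t))\<^sup>2)"
    using wi i wint by (subst Bochner_Integration.integral_add) (auto simp: S_def)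
  also have "\<dots> \<le> sqrt ?N / 2 * ?W + 1 / (2 * sqrt ?N) * (?N * ?W)"
    using le by (intro add_left_mono mult_left_mono) (auto simp: S_def)
  also have "\<dots> = sqrt ?N * ?W"
    using N real_div_sqrt[of ?N] by (simp add: field_simps)
  finally show ?thesis
    using c gi by blast
qed

section \<open>Failure of the Nehari theorem\<close>

text \<open>The confinement of reflected pairs holds for every centre close enough to the extreme
  point, and \<Omega> contains a small ball of such centres. Hence \<open>p\<close> and
  \<open>q\<close> can both be taken there, with \<open>q\<close> kept out of the ball around
  \<open>p\<close> that is reserved for the bump.\<close>

lemma dipole_near_extreme_point:
  fixes \<Omega> :: "'a::euclidean_space set"
  assumes \<Omega>: "open \<Omega>" "convex \<Omega>" and x: "x extreme_point_of closure \<Omega>" and r: "r > 0" and \<epsilon>: "\<epsilon> > 0"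
  shows "\<exists>p q \<rho>. 0 < \<rho> \<and> ball p \<rho> \<subseteq> \<Omega> \<inter> ball x r \<and> q \<in> ball x r \<and> q \<notin> ball p \<rho> \<and> dist p q \<le> \<epsilon> \<and>
    (\<forall>a\<in>{p, q}. \<forall>y\<in>\<Omega>. 2 *\<^sub>R a - y \<in> \<Omega> \<longrightarrow> y \<in> ball x r \<and> 2 *\<^sub>R a - y \<in> ball x r)"
proof -
  obtain \<delta> where \<delta>: "\<delta> > 0" "\<And>y z. y \<in> closure \<Omega> \<Longrightarrow> z \<in> closure \<Omega> \<Longrightarrow> dist (midpoint y z) x < \<delta> \<Longrightarrow> y \<in> ball x r \<and> z \<in> ball x r"
    using extreme_point_midpoint[OF closed_closure convex_closure[OF \<Omega>(2)] x r] by blast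
  let ?O = "\<Omega> \<inter> ball x (min \<delta> r)"
  have "x \<in> closure \<Omega>"
    using x by (simp add: extreme_point_of_def)
  then obtain p where "p \<in> \<Omega>" "dist p x < min \<delta> r"
    unfolding closure_approachable using \<delta>(1) r by (metis min_less_iff_conj)
  then have "p \<in> ?O"
    by (simp add: dist_commute)
  moreover have "open ?O"
    using \<Omega>(1) by (intro open_Int) auto
  ultimately obtain e where e: "e > 0" "ball p e \<subseteq> ?O"
    by (metis open_contains_ball)
  obtain b :: 'a where b: "b \<in> Basis"
    using nonempty_Basis by blast
  \<comment> \<open>The half of \<open>e\<close> keeps \<open>q\<close> inside the ball of
    admissible centres. Placing \<open>q\<close> at distance exactly \<open>\<rho>\<close> puts it
    just outside the open ball of radius \<open>\<rho>\<close> around \<open>p\<close>.\<close>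
  define \<rho> where "\<rho> = min (e / 2) \<epsilon>"
  have \<rho>: "0 < \<rho>" "\<rho> < e" "\<rho> \<le> \<epsilon>"
    using e(1) \<epsilon> by (auto simp: \<rho>_def)
  define q where "q = p + \<rho> *\<^sub>R b"
  have q: "dist p q = \<rho>"
    using b \<rho> by (simp add: q_def dist_norm)
  have pq: "p \<in> ?O" "q \<in> ?O"
  proof -
    have "p \<in> ball p e" "q \<in> ball p e"
      using e(1) q \<rho> by auto
    then show "p \<in> ?O" "q \<in> ?O"
      using e(2) by blast+
  qed
  have refl: "y \<in> ball x r \<and> 2 *\<^sub>R a - y \<in> ball x r" if "a \<in> ?O" "y \<in> \<Omega>" "2 *\<^sub>R a - y \<in> \<Omega>" for a y
  proof (rule \<delta>(2))
    show "y \<in> closure \<Omega>" "2 *\<^sub>R a - y \<in> closure \<Omega>"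
      using that closure_subset by auto
    show "dist (midpoint y (2 *\<^sub>R a - y)) x < \<delta>"
      using that(1) by (simp add: midpoint_def dist_commute)
  qed
  have "ball p \<rho> \<subseteq> \<Omega> \<inter> ball x r"
    using e(2) \<rho>(2) subset_ball[of \<rho> e p] by auto
  with \<rho> q pq refl show ?thesis
    by (intro exI[of _ p] exI[of _ q] exI[of _ \<rho>]) auto
qed

lemma not_nehari_if_infinite_extreme_points:
  fixes \<Omega> :: "'a::euclidean_space set"
  assumes \<Omega>: "open \<Omega>" "convex \<Omega>" and inf: "infinite {x. x extreme_point_of closure \<Omega>}"
  shows "\<not> nehari_theorem_true \<Omega>"
proof
  assume nehari: "nehari_theorem_true \<Omega>"
  obtain x :: "nat \<Rightarrow> 'a" and r0 where x: "\<And>n. x n extreme_point_of closure \<Omega>"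
      and r0: "\<And>n. 0 < r0 n" "\<And>m n. m \<noteq> n \<Longrightarrow> ball (x m) (r0 m) \<inter> ball (x n) (r0 n) = {}"
    by (rule infinite_discrete_sequence[OF inf]) auto
  define r where "r n = min (r0 n) ((1 / 2) ^ n)" for n
  have r: "0 < r n" "r n \<le> (1 / 2) ^ n" for n
    using r0(1)[of n] by (auto simp: r_def)
  have disj: "ball (x m) (r m) \<inter> ball (x n) (r n) = {}" if "m \<noteq> n" for m n
    using r0(2)[OF that] by (auto simp: r_def)
  define Q where "Q n p q \<rho> \<longleftrightarrow> 0 < \<rho> \<and> ball p \<rho> \<subseteq> \<Omega> \<inter> ball (x n) (r n) \<and> q \<in> ball (x n) (r n) \<and> q \<notin> ball p \<rho> \<and> dist p q \<le> (1 / 2) ^ n \<and>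
    (\<forall>a\<in>{p, q}. \<forall>y\<in>\<Omega>. 2 *\<^sub>R a - y \<in> \<Omega> \<longrightarrow> y \<in> ball (x n) (r n) \<and> 2 *\<^sub>R a - y \<in> ball (x n) (r n))"
    for n p q and \<rho> :: real
  have "\<forall>n. \<exists>p q \<rho>. Q n p q \<rho>"
    unfolding Q_def by (intro allI dipole_near_extreme_point \<Omega> x r) simp
  then obtain p q \<rho> where Q: "\<And>n. Q n (p n) (q n) (\<rho> n)"
    by metis
  have \<rho>: "0 < \<rho> n" and sub: "ball (p n) (\<rho> n) \<subseteq> \<Omega> \<inter> ball (x n) (r n)"
      and q: "q n \<in> ball (x n) (r n)" "q n \<notin> ball (p n) (\<rho> n)" "dist (p n) (q n) \<le> (1 / 2) ^ n" for n
    using Q[of n] by (auto simp only: Q_def)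
  have refl: "y \<in> ball (x n) (r n) \<and> 2 *\<^sub>R a - y \<in> ball (x n) (r n)"
    if "a \<in> {p n, q n}" "y \<in> \<Omega>" "2 *\<^sub>R a - y \<in> \<Omega>" for n a y
    using Q[of n] that unfolding Q_def by blast
  \<comment> \<open>The pairing function yields disjoint blocks, one for each constant to be
    defeated. Size 4^k makes the square root of the cardinality equal to 2^k.\<close>
  define A where "A k = (\<lambda>j. prod_encode (k, j)) ` {..<4 ^ k}" for k :: nat
  have A: "finite (A k)" "card (A k) = 4 ^ k" "A k \<noteq> {}" for k
  proof -
    show "finite (A k)" "A k \<noteq> {}"
      by (auto simp: A_def lessThan_empty_iff)
    show "card (A k) = 4 ^ k"
      unfolding A_def by (subst card_image) (auto simp: inj_on_def)
  qed
  have A_block: "fst (prod_decode i) = k" if "i \<in> A k" for i k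
    using that by (auto simp: A_def)
  \<comment> \<open>One scale serves the whole block: each bump around \<open>2 p i\<close> has
    radius at most \<open>\<rho> i\<close>, strictly less than the radius
    \<open>2 * \<rho> i\<close> of the doubled ball.\<close>
  define R where "R k = real DIM('a) / Min (\<rho> ` A k)" for k
  have minpos: "0 < Min (\<rho> ` A k)" for k
    using A \<rho> by (subst Min_gr_iff) auto
  have R: "0 < R k" for k
    using minpos by (simp add: R_def)
  have R_le: "real DIM('a) / R k \<le> \<rho> i" if "i \<in> A k" for i k
    using A that minpos[of k] by (simp add: R_def)
  define h where "h k c z = (\<Sum>i\<in>A k. complex_of_real (c i) * bump (R k *\<^sub>R (z - 2 *\<^sub>R p i)))"
    for k and c :: "nat \<Rightarrow> real" and z
  let ?W = "LINT t::'a|lborel. norm (fourier bump t)"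
  have "\<forall>k. \<exists>c::nat \<Rightarrow> real. (\<forall>i. \<bar>c i\<bar> = 1) \<and> integrable lborel (fourier (h k c)) \<and>
    (LINT t|lborel. norm (fourier (h k c) t)) \<le> sqrt (real (card (A k))) * ?W"
    unfolding h_def[abs_def] by (intro allI exists_fourier_bump_sum_small R A)
  then obtain C :: "nat \<Rightarrow> nat \<Rightarrow> real" where C: "\<And>k i. \<bar>C k i\<bar> = 1"
    "\<And>k. integrable lborel (fourier (h k (C k)))"
    "\<And>k. (LINT t|lborel. norm (fourier (h k (C k)) t)) \<le> sqrt (real (card (A k))) * ?W"
    by metis
  \<comment> \<open>Each index takes its sign from the choice made for its own block, so that one
    symbol carries all sign patterns at once.\<close>
  define c where "c i = C (fst (prod_decode i)) i" for i
  have c: "\<bar>c i\<bar> = 1" for i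
    by (simp add: c_def C)
  interpret dipole_configuration \<Omega> x p q r c
  proof
    show "open \<Omega>" by fact
    show "0 < r n" "r n \<le> (1 / 2) ^ n" "dist (p n) (q n) \<le> (1 / 2) ^ n" "\<bar>c n\<bar> \<le> 1" for n
      using r[of n] q(3)[of n] c[of n] by auto
    show "ball (x m) (r m) \<inter> ball (x n) (r n) = {}" if "m \<noteq> n" for m n
      by (rule disj[OF that])
    show "y \<in> ball (x n) (r n) \<and> 2 *\<^sub>R p n - y \<in> ball (x n) (r n)"
      if "y \<in> \<Omega>" "2 *\<^sub>R p n - y \<in> \<Omega>" for y n
      using refl[of "p n" n y] that by blast
    show "y \<in> ball (x n) (r n) \<and> 2 *\<^sub>R q n - y \<in> ball (x n) (r n)"
      if "y \<in> \<Omega>" "2 *\<^sub>R q n - y \<in> \<Omega>" for y n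
      using refl[of "q n" n y] that by blast
  qed
  obtain M where M: "M \<ge> 0" "\<And>h. h \<in> test_functions ((*\<^sub>R) 2 ` \<Omega>) \<Longrightarrow> integrable lborel (fourier h) \<Longrightarrow>
    norm (\<Sum>n. complex_of_real (c n) * (h (2 *\<^sub>R p n) - h (2 *\<^sub>R q n))) \<le> M * (LINT t|lborel. norm (fourier h t))"
    by (rule nehari_bounded_symbol[OF nehari]) (rule that)
  \<comment> \<open>The 4^k masses of the block add up coherently, while the transform has L1 norm
    at most \<open>2 ^ k * ?W\<close>; dividing by 2^k leaves an unbounded left side.\<close>
  have bound: "2 ^ k * norm (bump (0::'a)) \<le> M * ?W" for k
  proof -
    let ?h = "h k (C k)"
    have cC: "c i = C k i" if "i \<in> A k" for i
      using A_block[OF that] by (simp add: c_def)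
    have "(\<lambda>z. bump (R k *\<^sub>R (z - 2 *\<^sub>R p i))) \<in> test_functions ((*\<^sub>R) 2 ` \<Omega>)" if i: "i \<in> A k" for i
    proof (rule test_function_bump_affine[OF R], rule subsetI)
      fix z assume "z \<in> cball (2 *\<^sub>R p i) (real DIM('a) / R k)"
      then have "norm (z - 2 *\<^sub>R p i) < 2 * \<rho> i"
        using R_le[OF i] \<rho>[of i] by (simp add: dist_norm norm_minus_commute)
      moreover have "z - 2 *\<^sub>R p i = 2 *\<^sub>R ((1 / 2) *\<^sub>R z - p i)"
        by (simp add: scaleR_diff_right)
      ultimately have "norm ((1 / 2) *\<^sub>R z - p i) < \<rho> i"
        by (simp only: norm_scaleR)
      then have "(1 / 2) *\<^sub>R z \<in> ball (p i) (\<rho> i)"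
        by (simp only: mem_ball dist_norm norm_minus_commute)
      then have "(1 / 2) *\<^sub>R z \<in> \<Omega>"
        using sub by blast
      then show "z \<in> (*\<^sub>R) 2 ` \<Omega>"
        by (rule rev_image_eqI) simp
    qed
    then have h_test: "?h \<in> test_functions ((*\<^sub>R) 2 ` \<Omega>)"
      unfolding h_def[abs_def] by (intro test_functions_sum test_functions_cmult)
    \<comment> \<open>A bump of block \<open>k\<close> cannot be seen from the double of a point
      outside the ball around \<open>p i\<close>. This removes all points \<open>2 q n\<close> and
      all points \<open>2 p n\<close> with \<open>n\<close> different from \<open>i\<close>.\<close>
    have far: "bump (R k *\<^sub>R (2 *\<^sub>R y - 2 *\<^sub>R p i)) = 0" if i: "i \<in> A k" and y: "y \<notin> ball (p i) (\<rho> i)" for i y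
    proof (rule bump_zero)
      have "real DIM('a) \<le> R k * \<rho> i"
        using R_le[OF i] R[of k] by (simp add: field_simps)
      also have "\<dots> < R k * (2 * \<rho> i)"
        using R[of k] \<rho>[of i] by simp
      also have "\<dots> \<le> R k * (2 * norm (y - p i))"
        using y R[of k] by (simp add: dist_norm norm_minus_commute)
      also have "\<dots> = norm (R k *\<^sub>R (2 *\<^sub>R y - 2 *\<^sub>R p i))"
        using R[of k] unfolding scaleR_diff_right[symmetric] norm_scaleR by simp
      finally show "real DIM('a) < norm (R k *\<^sub>R (2 *\<^sub>R y - 2 *\<^sub>R p i))" .
    qed
    have p_ball: "p n \<in> ball (x n) (r n)" for n
      using sub[of n] \<rho>[of n] by (meson IntD2 centre_in_ball subsetD)
    have other: "y \<notin> ball (p i) (\<rho> i)" if "y \<in> ball (x n) (r n)" "n \<noteq> i" for y n i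
      using disj[OF that(2)] that(1) sub[of i] by blast
    have hp: "?h (2 *\<^sub>R p n) = (if n \<in> A k then complex_of_real (c n) * bump (0::'a) else 0)" for n
    proof -
      have "?h (2 *\<^sub>R p n) = (\<Sum>i\<in>A k. if i = n then complex_of_real (c n) * bump (0::'a) else 0)"
        unfolding h_def using far other[OF p_ball[of n]] by (intro sum.cong refl) (auto simp: cC)
      then show ?thesis using A by simp
    qed
    have hq: "?h (2 *\<^sub>R q n) = 0" for n
    proof -
      have "q n \<notin> ball (p i) (\<rho> i)" for i
        using other[OF q(1)[of n], of i] q(2)[of n] by (cases "i = n") auto
      then show ?thesis
        unfolding h_def using far by (intro sum.neutral) auto
    qed
    have cc: "complex_of_real (c n) * (complex_of_real (c n) * z) = z" for n z
    proof -
      have "c n * c n = 1"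
        using c[of n] by (metis abs_mult_self_eq mult_1_right)
      then have "complex_of_real (c n) * complex_of_real (c n) = 1"
        by (metis of_real_1 of_real_mult)
      then show ?thesis
        by (simp flip: mult.assoc)
    qed
    \<comment> \<open>Only the positive masses of block \<open>k\<close> meet the test function, and
      there each sign occurs twice, once in the symbol and once in the test function.\<close>
    have "(\<Sum>n. complex_of_real (c n) * (?h (2 *\<^sub>R p n) - ?h (2 *\<^sub>R q n))) = (\<Sum>n\<in>A k. bump (0::'a))"
      using A by (subst suminf_finite[of "A k"]) (auto simp: hp hq cc)
    also have "\<dots> = 4 ^ k * bump (0::'a)"
      using A by simp
    finally have "norm (4 ^ k * bump (0::'a)) \<le> M * (LINT t|lborel. norm (fourier ?h t))"
      using M(2)[OF h_test C(2)] by simp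
    also have "\<dots> \<le> M * (sqrt (real (card (A k))) * ?W)"
      by (intro mult_left_mono C M)
    also have "sqrt (real (card (A k))) = 2 ^ k"
    proof -
      have "(4::real) ^ k = (2 ^ k)\<^sup>2"
        by (simp add: power2_eq_square flip: power_mult_distrib)
      then show ?thesis
        using A by simp
    qed
    finally have "2 ^ k * (2 ^ k * norm (bump (0::'a))) \<le> 2 ^ k * (M * ?W)"
      by (simp add: norm_mult norm_power mult_ac flip: power_mult_distrib)
    then show ?thesis
      by simp
  qed
  have b0: "0 < norm (bump (0::'a))"
    by (simp add: bump_0)
  obtain k where "M * ?W / norm (bump (0::'a)) < 2 ^ k"
    using real_arch_pow[of 2] by auto
  with bound[of k] b0 show False
    by (simp add: field_simps)
qed

theorem corollary7:
  fixes \<Omega> :: "'a::euclidean_space set"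
  assumes "\<Omega> \<noteq> {}" and "open \<Omega>" and "convex \<Omega>"
  shows "(infinite {x. x extreme_point_of closure \<Omega>} \<longrightarrow> \<not> nehari_theorem_true \<Omega>) \<and>
         (bounded \<Omega> \<and> \<not> polytope (closure \<Omega>) \<longrightarrow> \<not> nehari_theorem_true \<Omega>)"
proof (intro conjI impI)
  assume "infinite {x. x extreme_point_of closure \<Omega>}"
  then show "\<not> nehari_theorem_true \<Omega>"
    by (rule not_nehari_if_infinite_extreme_points[OF assms(2,3)])
next
  assume *: "bounded \<Omega> \<and> \<not> polytope (closure \<Omega>)"
  then have "compact (closure \<Omega>)"
    by simp
  \<comment> \<open>A compact convex set is the hull of its extreme points, so finitely many of them
    would make it a polytope.\<close>
  then have "closure \<Omega> = convex hull {x. x extreme_point_of closure \<Omega>}"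
    by (rule Krein_Milman_Minkowski) (simp add: convex_closure assms)
  then have "infinite {x. x extreme_point_of closure \<Omega>}"
    using * unfolding polytope_def by blast
  then show "\<not> nehari_theorem_true \<Omega>"
    by (rule not_nehari_if_infinite_extreme_points[OF assms(2,3)])
qed

end
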